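(* Fix $a<b$, $K\ge1$, $\sigma>0$, $x_0\in[a,b]$. Let $\mathcal{R}\subset\mathcal{R}_{x_0}$ be the subfamily of tuples $\vartheta=(p_X,f,\{\lambda_k\},\{m_k\})$ for which, in addition, the joint density $p_X(x)\sum_{k=1}^K\lambda_kf(y-m_k(x))$ is $\beta$-Hölder continuous for some $\beta>0$. Index the components so that $\lambda_1<\dots<\lambda_K$. Then there exist estimators $\widehat f_n$, $\{\widehat\lambda_{n,k}\}_{k=1}^K$, $\{\widehat m_{n,k}\}_{k=1}^K$, functions of $n$ i.i.d. samples $\{(X_i,Y_i)\}_{i=1}^n$ from the joint density, such that for every $\vartheta\in\mathcal{R}$, with probability one, $$\|\widehat f_n-f\|_1\vee\max_k|\widehat\lambda_{n,k}-\lambda_k|\vee\max_k\|\widehat m_{n,k}-m_k\|_{L^1[a,b]}\xrightarrow{n\to\infty}0.$$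
   Context: $\phi_\sigma$ is the density of $\mathcal{N}(0,\sigma^2)$; $(\phi_\sigma\ast G)(y)=\int\phi_\sigma(y-\theta)\,dG(\theta)$ for a probability measure $G$ on $\mathbb{R}$. $\|\cdot\|_1$ is the $L^1(\mathbb{R})$ norm. $\mathcal{R}_{x_0}$ is the set of tuples $(p_X,f,\{\lambda_k\}_{k=1}^K,\{m_k\}_{k=1}^K)$ with $p_X$ a probability density on $[a,b]$ with $\inf_{[a,b]}p_X>0$, $f$ a probability density on $\mathbb{R}$ with $\int yf(y)\,dy=0$, $\min_k\lambda_k>0$, $\sum_k\lambda_k=1$, $m_k$ continuous on $[a,b]$, and such that: (A1) $f=\phi_\sigma\ast G_0$ for some compactly supported probability measure $G_0$; (A2) $\min_{j\ne k}|\lambda_j-\lambda_k|>0$; (A3) $\min_{j\ne k}|m_j(x_0)-m_k(x_0)|>2\operatorname{diam}(\operatorname{supp}(G_0))$; (A4) $\{x\in[a,b]:\exists\, j\ne k,\ m_j(x)=m_k(x)\}$ is countable. The quantities $a,b,K,\sigma,x_0$ are known, so estimators may depend on them, but not on $\vartheta$. The joint density (on $[a,b]\times\mathbb{R}$) is $p(x,y)=p_X(x)\sum_{k=1}^K\lambda_kf(y-m_k(x))$. *)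

theory Defs
  imports "HOL-Probability.Probability"
begin

definition density_on :: "real set \<Rightarrow> (real \<Rightarrow> real) \<Rightarrow> bool" where
  "density_on S p \<longleftrightarrow>
     (\<forall>x\<in>S. 0 \<le> p x) \<and> set_integrable lborel S p \<and> (LINT x:S|lborel. p x) = 1"

definition measure_supp :: "real measure \<Rightarrow> real set" where
  "measure_supp G = {x. \<forall>U. open U \<longrightarrow> x \<in> U \<longrightarrow> 0 < emeasure G U}"

definition compactly_supported_prob :: "real measure \<Rightarrow> bool" where
  "compactly_supported_prob G \<longleftrightarrow>
     prob_space G \<and> sets G = sets borel \<and> compact (measure_supp G)"

definition gauss_conv :: "real \<Rightarrow> real measure \<Rightarrow> real \<Rightarrow> real" where
  "gauss_conv \<sigma> G y = (LINT \<theta>|G. normal_density 0 \<sigma> (y - \<theta>))"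

definition holder_continuous_on :: "real \<Rightarrow> 'a::metric_space set \<Rightarrow> ('a \<Rightarrow> real) \<Rightarrow> bool" where
  "holder_continuous_on \<beta> S g \<longleftrightarrow>
     (\<exists>C. \<forall>z\<in>S. \<forall>w\<in>S. \<bar>g z - g w\<bar> \<le> C * dist z w powr \<beta>)"

text \<open>
  A tuple \<open>(pX, f, lam, m)\<close> is the parameter of the model with components \<open>1, \<dots>, K\<close>; the values
  of \<open>lam\<close> and \<open>m\<close> at other indices, and those of \<open>pX\<close> and \<open>m k\<close> outside \<open>[a, b]\<close>, are irrelevant.
\<close>

type_synonym param =
  "(real \<Rightarrow> real) \<times> (real \<Rightarrow> real) \<times> (nat \<Rightarrow> real) \<times> (nat \<Rightarrow> real \<Rightarrow> real)"

definition joint :: "nat \<Rightarrow> param \<Rightarrow> real \<times> real \<Rightarrow> real" where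
  "joint K = (\<lambda>(pX, f, lam, m) (x, y). pX x * (\<Sum>k=1..K. lam k * f (y - m k x)))"

definition joint_measure :: "real \<Rightarrow> real \<Rightarrow> nat \<Rightarrow> param \<Rightarrow> (real \<times> real) measure" where
  "joint_measure a b K \<tau> =
     density lborel (\<lambda>z. ennreal (indicator ({a..b} \<times> UNIV) z * joint K \<tau> z))"

text \<open>
  The minima over \<open>j \<noteq> k\<close> are written as pairwise conditions, so that they are vacuous for \<open>K = 1\<close>.
\<close>

definition model_class :: "real \<Rightarrow> real \<Rightarrow> nat \<Rightarrow> real \<Rightarrow> real \<Rightarrow> param set" where
  "model_class a b K \<sigma> x0 = {(pX, f, lam, m).
     density_on {a..b} pX \<and> 0 < (INF x\<in>{a..b}. pX x) \<and>
     density_on UNIV f \<and> has_bochner_integral lborel (\<lambda>y. y * f y) 0 \<and>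
     (\<forall>k\<in>{1..K}. 0 < lam k) \<and> (\<Sum>k=1..K. lam k) = 1 \<and>
     (\<forall>k\<in>{1..K}. continuous_on {a..b} (m k)) \<and>
     (\<forall>j\<in>{1..K}. \<forall>k\<in>{1..K}. j \<noteq> k \<longrightarrow> 0 < \<bar>lam j - lam k\<bar>) \<and>
     (\<exists>G0. compactly_supported_prob G0 \<and> f = gauss_conv \<sigma> G0 \<and>
        (\<forall>j\<in>{1..K}. \<forall>k\<in>{1..K}. j \<noteq> k \<longrightarrow>
           2 * diameter (measure_supp G0) < \<bar>m j x0 - m k x0\<bar>)) \<and>
     countable {x\<in>{a..b}. \<exists>j\<in>{1..K}. \<exists>k\<in>{1..K}. j \<noteq> k \<and> m j x = m k x}}"

definition holder_model_class :: "real \<Rightarrow> real \<Rightarrow> nat \<Rightarrow> real \<Rightarrow> real \<Rightarrow> param set" where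
  "holder_model_class a b K \<sigma> x0 =
     {\<tau> \<in> model_class a b K \<sigma> x0.
        \<exists>\<beta>>0. holder_continuous_on \<beta> ({a..b} \<times> UNIV) (joint K \<tau>)}"

abbreviation sample_space :: "nat \<Rightarrow> (nat \<Rightarrow> real \<times> real) measure" where
  "sample_space n \<equiv> (\<Pi>\<^sub>M i\<in>{..<n}. borel)"

text \<open>
  \<open>[0, \<infinity>]\<close>-valued \<open>L\<^sup>1\<close> distance: unlike with the Bochner integral, a non-integrable difference is at
  distance \<open>\<infinity>\<close> rather than \<open>0\<close>.
\<close>

definition L1_dist_on :: "real set \<Rightarrow> (real \<Rightarrow> real) \<Rightarrow> (real \<Rightarrow> real) \<Rightarrow> ennreal" where
  "L1_dist_on S g h = (\<integral>\<^sup>+x\<in>S. ennreal \<bar>g x - h x\<bar> \<partial>lborel)"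

end

theory Submission
  imports Defs "HOL-Real_Asymp.Real_Asymp"
begin

text \<open>
  The estimator is a minimum distance estimator. The density of the pair \<open>(X, Y)\<close> is estimated by a
  histogram at the points \<open>(x0, q)\<close> and \<open>(x, q)\<close> with \<open>q\<close> rational; by Hoelder continuity, Hoeffding's
  inequality and the Borel--Cantelli lemma the error is eventually below a tolerance that does not
  depend on the parameter, uniformly in \<open>x\<close>. Among countably many candidate parameters, arranged in
  an increasing sequence of compact levels, one matching the histogram is chosen at the lowest
  possible level. Hence the chosen candidates stay in one compact level, and consistency reduces to
  identifiability: Gaussian smoothing is injective, so the mixing distribution at \<open>x0\<close> is known; by
  the separation condition its clusters give \<open>G\<^sub>0\<close> and the weights; and the moments of the mixing
  distribution at \<open>x\<close> then give the locations \<open>m\<^sub>k x\<close>, labelled by their distinct weights, whenever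
  these are distinct, which is the case for almost every \<open>x\<close>.
\<close>

section \<open>Gaussian convolutions\<close>

text \<open>The obstacle is uniformity. The Hoelder exponent and constant, the support of the mixing
  measure, the smallest weight and the size of the locations carry in general no bound over the
  class, so no compact parameter set is given in advance. Moreover, the locations are separated at
  x0 only. A candidate therefore describes two sections of one density, at x0 and at x, that share
  the mixing measure and the weights: the section at x0 settles the shared parts, and these decode
  the section at x, where the clusters may overlap. The fits at different x are made independently;
  their labels agree because each of them orders its components by weight. Since nothing ties the
  fit at x to the fit at a neighbouring point, convergence is proved point by point and passes to L1
  by dominated convergence, the level being the common bound. For this, one null set of samples has
  to serve all x, which is why the histogram error is controlled uniformly in x. Compactness takes
  the place of rates, so no speed of convergence results.\<close>

lemma normal_density_le:
  assumes "0 < \<sigma>"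
  shows "normal_density \<mu> \<sigma> x \<le> 1 / sqrt (2 * pi * \<sigma>\<^sup>2)"
proof -
  have "exp (- (x - \<mu>)\<^sup>2 / (2 * \<sigma>\<^sup>2)) \<le> 1" by simp
  then show ?thesis
    unfolding normal_density_def using assms by (simp add: divide_simps)
qed

lemma mult_exp_neg_square_le: "\<bar>u\<bar> * exp (- u\<^sup>2 / 2) \<le> (1::real)"
proof -
  have "\<bar>u\<bar> \<le> 1 + u\<^sup>2 / 2"
    using sum_squares_bound[of "\<bar>u\<bar>" 1] by (simp add: power2_eq_square)
  also have "\<dots> \<le> exp (u\<^sup>2 / 2)" by (rule exp_ge_add_one_self)
  finally show ?thesis by (simp add: exp_minus field_simps)
qed

lemma normal_density_lipschitz:
  assumes s: "0 < \<sigma>"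
  shows "\<bar>normal_density 0 \<sigma> x - normal_density 0 \<sigma> y\<bar> \<le> 1 / (sqrt (2 * pi * \<sigma>\<^sup>2) * \<sigma>) * \<bar>x - y\<bar>"
proof -
  let ?c = "1 / sqrt (2 * pi * \<sigma>\<^sup>2)"
  let ?f' = "\<lambda>x. ?c * (exp (- x\<^sup>2 / (2 * \<sigma>\<^sup>2)) * (- x / \<sigma>\<^sup>2))"
  have c: "0 < ?c" using s by simp
  have d: "(normal_density 0 \<sigma> has_field_derivative ?f' x) (at x within UNIV)" for x
  proof -
    have *: "((\<lambda>x. c * exp (- x\<^sup>2 / (2 * \<sigma>\<^sup>2))) has_field_derivative
        c * (exp (- x\<^sup>2 / (2 * \<sigma>\<^sup>2)) * (- x / \<sigma>\<^sup>2))) (at x)" for c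
      using s by (auto intro!: derivative_eq_intros simp: field_simps)
    have "normal_density 0 \<sigma> = (\<lambda>x. ?c * exp (- x\<^sup>2 / (2 * \<sigma>\<^sup>2)))"
      by (simp add: normal_density_def fun_eq_iff)
    then show ?thesis using *[of ?c] by (simp only:)
  qed
  \<comment> \<open>With u = x / \<sigma> this is the bound for |u| exp (-u^2 / 2), one factor 1 /
    \<sigma> being left over.\<close>
  have b: "norm (?f' x) \<le> ?c / \<sigma>" for x
  proof -
    have "\<bar>x / \<sigma>\<bar> * exp (- (x / \<sigma>)\<^sup>2 / 2) \<le> 1" by (rule mult_exp_neg_square_le)
    then have "exp (- x\<^sup>2 / (2 * \<sigma>\<^sup>2)) * (\<bar>x\<bar> / \<sigma>\<^sup>2) \<le> 1 / \<sigma>"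
      using s by (simp add: power_divide field_simps power2_eq_square)
    then have "?c * (exp (- x\<^sup>2 / (2 * \<sigma>\<^sup>2)) * (\<bar>x\<bar> / \<sigma>\<^sup>2)) \<le> ?c * (1 / \<sigma>)"
      using c by (intro mult_left_mono) auto
    then show ?thesis by (simp add: abs_mult)
  qed
  have "norm (normal_density 0 \<sigma> x - normal_density 0 \<sigma> y) \<le> ?c / \<sigma> * norm (x - y)"
    by (rule field_differentiable_bound[OF convex_UNIV d b]) auto
  then show ?thesis by (simp add: mult.commute)
qed

lemma continuous_on_normal_density: "continuous_on A (normal_density \<mu> \<sigma>)"
  unfolding normal_density_def by (cases "\<sigma> = 0") (auto intro!: continuous_intros)

lemma normal_density_diff: "normal_density 0 \<sigma> (y - t) = normal_density t \<sigma> y"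
  by (simp add: normal_density_def)

lemma has_bochner_integral_normal_density_diff:
  "0 < \<sigma> \<Longrightarrow> has_bochner_integral lborel (\<lambda>y. normal_density 0 \<sigma> (y - t)) 1"
  by (simp add: normal_density_diff has_bochner_integral_iff)

lemma real_distribution_integrable_bounded:
  fixes u :: "real \<Rightarrow> 'b::{banach, second_countable_topology}"
  assumes "real_distribution G" "u \<in> borel_measurable borel" "\<And>t. norm (u t) \<le> B"
  shows "integrable G u"
proof -
  interpret real_distribution G by fact
  show ?thesis
    by (rule integrable_const_bound[where B = B]) (use assms in auto)
qed

context
  fixes G :: "real measure" and \<sigma> :: real
  assumes G: "real_distribution G" and s: "0 < \<sigma>"
begin

interpretation real_distribution G by (rule G)

lemma integrable_normal_density_diff: "integrable G (\<lambda>t. normal_density 0 \<sigma> (y - t))"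
  by (rule real_distribution_integrable_bounded[OF G])
     (use normal_density_le[OF s, of 0] in \<open>auto simp: abs_of_nonneg\<close>)

lemma gauss_conv_nonneg: "0 \<le> gauss_conv \<sigma> G y"
  unfolding gauss_conv_def by (rule Bochner_Integration.integral_nonneg) auto

text \<open>The constant depends on \<sigma> only. This uniformity in \<open>G\<close> lets the
  argument move together with the measure in \<open>gauss_conv_tendsto\<close>.\<close>

lemma gauss_conv_lipschitz:
  "\<bar>gauss_conv \<sigma> G x - gauss_conv \<sigma> G y\<bar> \<le> 1 / (sqrt (2 * pi * \<sigma>\<^sup>2) * \<sigma>) * \<bar>x - y\<bar>"
proof -
  have "\<bar>gauss_conv \<sigma> G x - gauss_conv \<sigma> G y\<bar>
      = \<bar>LINT t|G. normal_density 0 \<sigma> (x - t) - normal_density 0 \<sigma> (y - t)\<bar>"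
    unfolding gauss_conv_def by (subst Bochner_Integration.integral_diff) (auto intro: integrable_normal_density_diff)
  also have "\<dots> \<le> (LINT t|G. \<bar>normal_density 0 \<sigma> (x - t) - normal_density 0 \<sigma> (y - t)\<bar>)"
    by (rule integral_abs_bound)
  also have "\<dots> \<le> (LINT t|G. 1 / (sqrt (2 * pi * \<sigma>\<^sup>2) * \<sigma>) * \<bar>x - y\<bar>)"
    using normal_density_lipschitz[OF s, of "x - t" "y - t" for t]
    by (intro integral_mono integrable_abs Bochner_Integration.integrable_diff)
       (auto intro: integrable_normal_density_diff)
  finally show ?thesis using prob_space by simp
qed

lemma continuous_on_gauss_conv: "continuous_on A (gauss_conv \<sigma> G)"
proof -
  let ?L = "1 / (sqrt (2 * pi * \<sigma>\<^sup>2) * \<sigma>)"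
  have "?L-lipschitz_on A (gauss_conv \<sigma> G)"
    using gauss_conv_lipschitz s by (intro lipschitz_onI) (auto simp: dist_real_def)
  then show ?thesis by (rule lipschitz_on_continuous_on)
qed

lemma borel_measurable_gauss_conv [measurable]: "gauss_conv \<sigma> G \<in> borel_measurable borel"
  by (intro borel_measurable_continuous_onI continuous_on_gauss_conv)

lemma has_bochner_integral_gauss_conv: "has_bochner_integral lborel (gauss_conv \<sigma> G) 1"
proof -
  have "(\<integral>\<^sup>+y. ennreal (gauss_conv \<sigma> G y) \<partial>lborel)
      = (\<integral>\<^sup>+y. \<integral>\<^sup>+t. ennreal (normal_density 0 \<sigma> (y - t)) \<partial>G \<partial>lborel)"
    unfolding gauss_conv_def
    by (intro nn_integral_cong nn_integral_eq_integral[symmetric] integrable_normal_density_diff) auto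
  also have "\<dots> = (\<integral>\<^sup>+t. \<integral>\<^sup>+y. ennreal (normal_density 0 \<sigma> (y - t)) \<partial>lborel \<partial>G)"
  proof -
    interpret pair_sigma_finite lborel G ..
    show ?thesis by (rule Fubini'[symmetric]) measurable
  qed
  also have "\<dots> = (\<integral>\<^sup>+t. 1 \<partial>G)"
    by (intro nn_integral_cong)
       (use has_bochner_integral_normal_density_diff[OF s] in
        \<open>auto simp: has_bochner_integral_iff nn_integral_eq_integral\<close>)
  also have "\<dots> = 1" using emeasure_space_1 by simp
  finally show ?thesis
    by (intro has_bochner_integral_nn_integral) (auto simp: gauss_conv_nonneg)
qed

text \<open>All points of the support are within A + B of y. The bound is the same for every such
  \<open>G\<close>; in \<open>holder_model_classE\<close> it bounds the covariate density from
  above.\<close>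

lemma gauss_conv_lower_bound:
  assumes "AE t in G. \<bar>t\<bar> \<le> A" "\<bar>y\<bar> \<le> B"
  shows "normal_density 0 \<sigma> (A + B) \<le> gauss_conv \<sigma> G y"
proof -
  have "(LINT t|G. normal_density 0 \<sigma> (A + B)) \<le> gauss_conv \<sigma> G y"
    unfolding gauss_conv_def
  proof (rule integral_mono_AE)
    show "AE t in G. normal_density 0 \<sigma> (A + B) \<le> normal_density 0 \<sigma> (y - t)"
      using assms(1)
    proof eventually_elim
      fix t assume "\<bar>t\<bar> \<le> A"
      then have "\<bar>y - t\<bar> \<le> \<bar>A + B\<bar>" using assms(2) by linarith
      then have "(y - t)\<^sup>2 \<le> (A + B)\<^sup>2" by (rule iffD1[OF abs_le_square_iff])
      then show "normal_density 0 \<sigma> (A + B) \<le> normal_density 0 \<sigma> (y - t)"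
        using s by (auto simp: normal_density_def divide_simps)
    qed
  qed (auto intro: integrable_normal_density_diff)
  then show ?thesis using prob_space by simp
qed

text \<open>An integrable envelope that depends on the support radius alone, made for dominated
  convergence. Half of the quadratic exponent is given up to absorb the shift t, hence the doubled
  variance; \<open>sqrt 2\<close> corrects the normalisation.\<close>

lemma gauss_conv_upper_bound:
  assumes "AE t in G. \<bar>t\<bar> \<le> A" 
  shows "gauss_conv \<sigma> G y \<le> exp (A\<^sup>2 / (2 * \<sigma>\<^sup>2)) * sqrt 2 * normal_density 0 (sqrt 2 * \<sigma>) y"
    (is "_ \<le> ?R")
proof -
  have "gauss_conv \<sigma> G y \<le> (LINT t|G. ?R)"
    unfolding gauss_conv_def
  proof (rule integral_mono_AE)
    show "AE t in G. normal_density 0 \<sigma> (y - t) \<le> ?R"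
      using assms
    proof eventually_elim
      fix t assume "\<bar>t\<bar> \<le> A"
      then have "\<bar>t\<bar> \<le> \<bar>A\<bar>" by linarith
      then have t: "t\<^sup>2 \<le> A\<^sup>2" by (rule iffD1[OF abs_le_square_iff])
      \<comment> \<open>Completing the square leaves (y - 2 t)^2, which is dropped.\<close>
      have "2 * (y - t)\<^sup>2 = y\<^sup>2 - 2 * t\<^sup>2 + (y - 2 * t)\<^sup>2" by (simp add: power2_eq_square algebra_simps)
      then have "y\<^sup>2 - 2 * A\<^sup>2 \<le> 2 * (y - t)\<^sup>2" using t zero_le_power2[of "y - 2 * t"] by linarith
      then have "- (y - t)\<^sup>2 / (2 * \<sigma>\<^sup>2) \<le> A\<^sup>2 / (2 * \<sigma>\<^sup>2) + - y\<^sup>2 / (2 * (2 * \<sigma>\<^sup>2))"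
        using s by (simp add: divide_simps)
      then have "exp (- (y - t)\<^sup>2 / (2 * \<sigma>\<^sup>2)) \<le> exp (A\<^sup>2 / (2 * \<sigma>\<^sup>2)) * exp (- y\<^sup>2 / (2 * (2 * \<sigma>\<^sup>2)))"
        by (simp flip: exp_add)
      then have "1 / sqrt (2 * pi * \<sigma>\<^sup>2) * exp (- (y - t)\<^sup>2 / (2 * \<sigma>\<^sup>2))
          \<le> 1 / sqrt (2 * pi * \<sigma>\<^sup>2) * (exp (A\<^sup>2 / (2 * \<sigma>\<^sup>2)) * exp (- y\<^sup>2 / (2 * (2 * \<sigma>\<^sup>2))))"
        using s by (intro mult_left_mono) auto
      moreover have "sqrt (2 * pi * (sqrt 2 * \<sigma>)\<^sup>2) = sqrt 2 * sqrt (2 * pi * \<sigma>\<^sup>2)"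
        by (simp add: real_sqrt_mult power_mult_distrib)
      then have "?R = 1 / sqrt (2 * pi * \<sigma>\<^sup>2) * (exp (A\<^sup>2 / (2 * \<sigma>\<^sup>2)) * exp (- y\<^sup>2 / (2 * (2 * \<sigma>\<^sup>2))))"
        unfolding normal_density_def by (simp add: power_mult_distrib)
      ultimately show "normal_density 0 \<sigma> (y - t) \<le> ?R" by (simp add: normal_density_def)
    qed
  qed (auto intro: integrable_normal_density_diff)
  then show ?thesis using prob_space by simp
qed

end

text \<open>The Fourier transform of the convolution is the product of the characteristic functions
  of the Gaussian and of the measure. The Gaussian factor has no zeros, so it cancels, and a measure
  is determined by its characteristic function.\<close>

lemma gauss_conv_inj:
  assumes G: "real_distribution G" and H: "real_distribution H" and s: "0 < \<sigma>"
    and eq: "gauss_conv \<sigma> G = gauss_conv \<sigma> H"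
  shows "G = H"
proof (rule Levy_uniqueness[OF G H], rule ext)
  fix v :: real
  let ?c = "LINT y|lborel. iexp (v * y) * complex_of_real (normal_density 0 \<sigma> y)"
  have key: "(LINT y|lborel. iexp (v * y) * complex_of_real (gauss_conv \<sigma> M y)) = ?c * char M v"
    if M: "real_distribution M" for M
  proof -
    interpret real_distribution M by fact
    interpret P: pair_sigma_finite lborel M ..
    have sh: "has_bochner_integral lborel (\<lambda>y. iexp (v * y) * complex_of_real (normal_density 0 \<sigma> (y - t)))
        (?c * iexp (v * t))" for t
    proof -
      have i: "integrable lborel (\<lambda>y. iexp (v * y) * complex_of_real (normal_density 0 \<sigma> y))"
        by (rule Bochner_Integration.integrable_bound[of _ "normal_density 0 \<sigma>"])
           (use s in \<open>auto simp: norm_mult\<close>)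
      have "has_bochner_integral lborel (\<lambda>y. iexp (v * (-t + 1 * y)) * complex_of_real (normal_density 0 \<sigma> (- t + 1 * y)))
          (?c /\<^sub>R \<bar>1\<bar>)"
        by (subst lborel_has_bochner_integral_real_affine_iff[of 1 _ _ "-t", symmetric])
           (use i in \<open>auto simp: has_bochner_integral_iff\<close>)
      then have "has_bochner_integral lborel
         (\<lambda>y. (iexp (v * (-t + 1 * y)) * complex_of_real (normal_density 0 \<sigma> (- t + 1 * y))) * iexp (v * t))
          (?c /\<^sub>R \<bar>1\<bar> * iexp (v * t))"
        by (intro has_bochner_integral_mult_left) auto
      moreover have "iexp (v * (-t + y)) * iexp (v * t) = iexp (v * y)" for y
        by (simp add: algebra_simps flip: exp_add)
      ultimately show ?thesis by (simp add: algebra_simps)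
    qed
    have I: "integrable (lborel \<Otimes>\<^sub>M M) (\<lambda>(y, t). iexp (v * y) * complex_of_real (normal_density 0 \<sigma> (y - t)))"
    proof (rule P.Fubini_integrable)
      have "(LINT t|M. cmod (iexp (v * y) * complex_of_real (normal_density 0 \<sigma> (y - t)))) = gauss_conv \<sigma> M y" for y
        by (simp add: gauss_conv_def norm_mult)
      then show "integrable lborel (\<lambda>y. LINT t|M. norm (case (y, t) of (y, t) \<Rightarrow>
          iexp (v * y) * complex_of_real (normal_density 0 \<sigma> (y - t))))"
        using has_bochner_integral_gauss_conv[OF M s] by (simp add: has_bochner_integral_iff)
      show "AE y in lborel. integrable M (\<lambda>t. case (y, t) of (y, t) \<Rightarrow>
          iexp (v * y) * complex_of_real (normal_density 0 \<sigma> (y - t)))"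
        using integrable_normal_density_diff[OF M s] by simp
    qed simp
    have "(LINT y|lborel. iexp (v * y) * complex_of_real (gauss_conv \<sigma> M y))
        = (LINT y|lborel. LINT t|M. iexp (v * y) * complex_of_real (normal_density 0 \<sigma> (y - t)))"
      by (simp add: gauss_conv_def integral_complex_of_real)
    also have "\<dots> = (LINT t|M. LINT y|lborel. iexp (v * y) * complex_of_real (normal_density 0 \<sigma> (y - t)))"
      using P.Fubini_integral[OF I] by simp
    also have "\<dots> = (LINT t|M. ?c * iexp (v * t))"
      using sh by (simp add: has_bochner_integral_iff)
    also have "\<dots> = ?c * char M v"
      by (simp add: char_def)
    finally show ?thesis .
  qed
  \<comment> \<open>Scaling by \<sigma> turns \<open>?c\<close> into the standard normal
    characteristic function at \<sigma> v, which is an exponential.\<close>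
  have "?c \<noteq> 0"
  proof -
    have "char std_normal_distribution (\<sigma> * v) = (LINT y|lborel. std_normal_density y *\<^sub>R iexp (\<sigma> * v * y))"
      unfolding char_def by (subst integral_density) auto
    also have "\<dots> = (LINT y|lborel. iexp (v * (0 + \<sigma> * y)) * complex_of_real (\<sigma> * normal_density 0 \<sigma> (0 + \<sigma> * y)))"
      using s by (intro Bochner_Integration.integral_cong)
        (auto simp: normal_density_def scaleR_conv_of_real real_sqrt_mult power_mult_distrib algebra_simps)
    also have "\<dots> = (LINT y|lborel. \<sigma> *\<^sub>R (iexp (v * (0 + \<sigma> * y)) * complex_of_real (normal_density 0 \<sigma> (0 + \<sigma> * y))))"
      by (simp add: scaleR_conv_of_real mult_ac)
    also have "\<dots> = \<sigma> *\<^sub>R (LINT y|lborel. (iexp (v * (0 + \<sigma> * y)) * complex_of_real (normal_density 0 \<sigma> (0 + \<sigma> * y))))"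
      by (rule integral_scaleR_right)
    also have "\<dots> = ?c"
      using s by (subst lborel_integral_real_affine[of \<sigma> _ 0]) auto
    finally have "char std_normal_distribution (\<sigma> * v) = ?c" .
    then show ?thesis by (auto simp: char_std_normal_distribution)
  qed
  moreover have "?c * char G v = ?c * char H v"
    using key[OF G] key[OF H] eq by simp
  ultimately show "char G v = char H v" by simp
qed

section \<open>Identifiability of mixtures\<close>

text \<open>The law of t + u k, where the label k is drawn with weights \<open>l\<close> and,
  independently, t from \<open>G\<close>. As the image of a product measure it inherits its
  integrals from Fubini.\<close>

definition mixing :: "nat \<Rightarrow> (nat \<Rightarrow> real) \<Rightarrow> (nat \<Rightarrow> real) \<Rightarrow> real measure \<Rightarrow> real measure" where
  "mixing K l u G = distr (point_measure {1..K} (\<lambda>k. ennreal (l k)) \<Otimes>\<^sub>M G) borel (\<lambda>(k, t). t + u k)"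

section \<open>Integrals against finite mixtures of translates\<close>

context
  fixes K :: nat and l u :: "nat \<Rightarrow> real" and G :: "real measure"
  assumes G: "real_distribution G" and l: "\<And>k. k \<in> {1..K} \<Longrightarrow> 0 \<le> l k" and sl: "(\<Sum>k=1..K. l k) = 1"
begin

lemma prob_space_weights: "prob_space (point_measure {1..K} (\<lambda>k. ennreal (l k)))"
proof
  have "(\<Sum>k=1..K. ennreal (l k)) = ennreal (\<Sum>k=1..K. l k)"
    using l by (intro sum_ennreal) auto
  then show "emeasure (point_measure {1..K} (\<lambda>k. ennreal (l k))) (space (point_measure {1..K} (\<lambda>k. ennreal (l k)))) = 1"
    using sl by (simp add: emeasure_point_measure_finite space_point_measure)
qed

lemma measurable_mixing_map:
  "(\<lambda>(k, t). t + u k) \<in> borel_measurable (point_measure {1..K} (\<lambda>k. ennreal (l k)) \<Otimes>\<^sub>M G)"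
proof -
  interpret G: real_distribution G by (rule G)
  have [measurable]: "u \<in> borel_measurable (point_measure {1..K} (\<lambda>k. ennreal (l k)))"
    by simp
  show ?thesis by measurable
qed

lemma real_distribution_mixing: "real_distribution (mixing K l u G)"
proof -
  interpret G: real_distribution G by (rule G)
  interpret W: prob_space "point_measure {1..K} (\<lambda>k. ennreal (l k))" by (rule prob_space_weights)
  interpret P: pair_prob_space "point_measure {1..K} (\<lambda>k. ennreal (l k))" G ..
  interpret M: prob_space "mixing K l u G"
    unfolding mixing_def by (rule P.prob_space_distr[OF measurable_mixing_map])
  show ?thesis
    by unfold_locales (simp add: mixing_def)
qed

lemma integral_mixing:
  fixes g :: "real \<Rightarrow> real"
  assumes g: "g \<in> borel_measurable borel"
    and i: "\<And>k. k \<in> {1..K} \<Longrightarrow> integrable G (\<lambda>t. g (t + u k))"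
  shows "integral\<^sup>L (mixing K l u G) g = (\<Sum>k=1..K. l k * (LINT t|G. g (t + u k)))"
proof -
  interpret G: real_distribution G by (rule G)
  let ?W = "point_measure {1..K} (\<lambda>k. ennreal (l k))"
  interpret W: prob_space ?W by (rule prob_space_weights)
  interpret P: pair_prob_space ?W G ..
  have m: "(\<lambda>z. g (case z of (k, t) \<Rightarrow> t + u k)) \<in> borel_measurable (?W \<Otimes>\<^sub>M G)"
    using measurable_compose[OF measurable_mixing_map g] .
  have I: "integrable (?W \<Otimes>\<^sub>M G) (\<lambda>z. g (case z of (k, t) \<Rightarrow> t + u k))"
  proof (rule P.Fubini_integrable[OF m])
    show "integrable ?W (\<lambda>x. LINT y|G. norm (g (case (x, y) of (k, t) \<Rightarrow> t + u k)))"
      by (rule integrable_point_measure_finite) simp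
    show "AE x in ?W. integrable G (\<lambda>y. g (case (x, y) of (k, t) \<Rightarrow> t + u k))"
      using i by (intro AE_I2) (simp add: space_point_measure)
  qed
  have "integral\<^sup>L (mixing K l u G) g = (LINT z|(?W \<Otimes>\<^sub>M G). g (case z of (k, t) \<Rightarrow> t + u k))"
    unfolding mixing_def by (rule integral_distr[OF measurable_mixing_map g])
  also have "\<dots> = (LINT k|?W. LINT t|G. g (t + u k))"
    using P.integral_fst'[OF I] by simp
  also have "\<dots> = (\<Sum>k=1..K. l k * (LINT t|G. g (t + u k)))"
    using l by (subst lebesgue_integral_point_measure_finite) (auto intro!: sum.cong)
  finally show ?thesis .
qed

lemma measure_mixing:
  assumes E: "E \<in> sets borel"
  shows "measure (mixing K l u G) E = (\<Sum>k=1..K. l k * measure (distr G borel (\<lambda>t. t + u k)) E)"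
proof -
  interpret G: real_distribution G by (rule G)
  interpret M: real_distribution "mixing K l u G" by (rule real_distribution_mixing)
  have "measure (mixing K l u G) E = integral\<^sup>L (mixing K l u G) (indicat_real E)"
    using E by simp
  also have "\<dots> = (\<Sum>k=1..K. l k * (LINT t|G. indicat_real E (t + u k)))"
    by (intro integral_mixing borel_measurable_indicator E G.integrable_const_bound[where B = 1])
       (use E in \<open>auto simp: indicator_def\<close>)
  also have "(\<lambda>k. LINT t|G. indicat_real E (t + u k)) = (\<lambda>k. measure (distr G borel (\<lambda>t. t + u k)) E)"
    using E integral_distr[of "\<lambda>t. t + u k" G borel "indicat_real E" for k] by (simp add: fun_eq_iff)
  finally show ?thesis .
qed

text \<open>This presents the conditional density of the response as one smoothed measure, so that
  \<open>gauss_conv_inj\<close> applies to the whole mixture at once.\<close>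

lemma gauss_conv_mixing:
  assumes s: "0 < \<sigma>"
  shows "gauss_conv \<sigma> (mixing K l u G) y = (\<Sum>k=1..K. l k * gauss_conv \<sigma> G (y - u k))"
proof -
  interpret G: real_distribution G by (rule G)
  have "gauss_conv \<sigma> (mixing K l u G) y = (\<Sum>k=1..K. l k * (LINT t|G. normal_density 0 \<sigma> (y - (t + u k))))"
    unfolding gauss_conv_def
  proof (rule integral_mixing)
    show "integrable G (\<lambda>t. normal_density 0 \<sigma> (y - (t + u k)))" for k
      using integrable_normal_density_diff[OF G s, of "y - u k"] by (simp add: algebra_simps)
  qed simp
  then show ?thesis by (simp add: gauss_conv_def algebra_simps)
qed

end

text \<open>
  Two representations of one mixture have the same components as soon as each support set of the
  second meets at most one of the disjoint support sets of the first.
\<close>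

lemma mixture_components_match:
  fixes Q Q' :: "'i \<Rightarrow> real measure" and l l' :: "'i \<Rightarrow> real"
  assumes I: "finite I"
    and Q: "\<And>k. k \<in> I \<Longrightarrow> real_distribution (Q k)" and Q': "\<And>k. k \<in> I \<Longrightarrow> real_distribution (Q' k)"
    and l: "\<And>k. k \<in> I \<Longrightarrow> 0 < l k" and l': "\<And>k. k \<in> I \<Longrightarrow> 0 < l' k"
    and eq: "\<And>E. E \<in> sets borel \<Longrightarrow> (\<Sum>k\<in>I. l k * measure (Q k) E) = (\<Sum>k\<in>I. l' k * measure (Q' k) E)"
    and A: "\<And>k. k \<in> I \<Longrightarrow> A k \<in> sets borel" and A': "\<And>k. k \<in> I \<Longrightarrow> A' k \<in> sets borel"
    and QA: "\<And>k. k \<in> I \<Longrightarrow> measure (Q k) (A k) = 1" and QA': "\<And>k. k \<in> I \<Longrightarrow> measure (Q' k) (A' k) = 1"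
    and disj: "\<And>i k. i \<in> I \<Longrightarrow> k \<in> I \<Longrightarrow> i \<noteq> k \<Longrightarrow> A i \<inter> A k = {}"
    and meet: "\<And>i k k'. i \<in> I \<Longrightarrow> k \<in> I \<Longrightarrow> k' \<in> I \<Longrightarrow> A' i \<inter> A k \<noteq> {} \<Longrightarrow> A' i \<inter> A k' \<noteq> {} \<Longrightarrow> k = k'"
  obtains \<pi> where "bij_betw \<pi> I I" "\<And>i. i \<in> I \<Longrightarrow> l' i = l (\<pi> i)"
    "\<And>i E. i \<in> I \<Longrightarrow> E \<in> sets borel \<Longrightarrow> measure (Q' i) E = measure (Q (\<pi> i)) E"
proof -
  have null: "measure M E = 0" if "real_distribution M" "B \<in> sets borel" "E \<in> sets borel" "measure M B = 1" "E \<inter> B = {}"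
    for M :: "real measure" and B E
  proof -
    interpret real_distribution M by fact
    have "measure M (E \<union> B) = measure M E + measure M B"
      by (rule finite_measure_Union) (use that in auto)
    then show ?thesis using prob_le_1[of "E \<union> B"] that measure_nonneg[of M E] by linarith
  qed
  have full: "measure M (E \<inter> B) = measure M E" if "real_distribution M" "B \<in> sets borel" "E \<in> sets borel" "measure M B = 1"
    for M :: "real measure" and B E
  proof -
    interpret real_distribution M by fact
    have "measure M E = measure M (E \<inter> B) + measure M (E - B)"
      by (subst finite_measure_Union[symmetric]) (use that in \<open>auto simp: Int_Diff_Un\<close>)
    moreover have "measure M (E - B) = 0" by (rule null[of M B]) (use that in auto)
    ultimately show ?thesis by simp
  qed
  \<comment> \<open>The first mixture gives no mass to \<open>N\<close>. As the weights
    \<open>l'\<close> are positive, no component of the second one charges \<open>N\<close>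
    either.\<close>
  define N where "N = UNIV - (\<Union>k\<in>I. A k)"
  have N: "N \<in> sets borel" unfolding N_def using I A by (intro sets.Diff sets.finite_UN) auto
  have "(\<Sum>k\<in>I. l k * measure (Q k) N) = 0"
    by (intro sum.neutral ballI) (use null[OF Q A N QA] in \<open>auto simp: N_def\<close>)
  then have "(\<Sum>k\<in>I. l' k * measure (Q' k) N) = 0" using eq[OF N] by simp
  moreover have "0 \<le> l' k * measure (Q' k) N" if "k \<in> I" for k
    using l'[OF that] by simp
  ultimately have "\<forall>k\<in>I. l' k * measure (Q' k) N = 0"
    using sum_nonneg_eq_0_iff[OF I, of "\<lambda>k. l' k * measure (Q' k) N"] by blast
  then have Q'N: "measure (Q' i) N = 0" if "i \<in> I" for i
    using l'[OF that] that by auto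
  have ex: "\<exists>k\<in>I. A' i \<inter> A k \<noteq> {}" if i: "i \<in> I" for i
  proof (rule ccontr)
    assume "\<not> ?thesis"
    then have "A' i = A' i \<inter> N" unfolding N_def by auto
    moreover have "measure (Q' i) (N \<inter> A' i) = measure (Q' i) N"
      by (rule full) (use i Q' A' N QA' in auto)
    ultimately show False using QA'[OF i] Q'N[OF i] by (simp add: Int_commute)
  qed
  \<comment> \<open>By \<open>meet\<close> the choice is unique; since \<open>Q' i\<close> avoids
    \<open>N\<close>, it has to live on \<open>A (\<pi> i)\<close>.\<close>
  define \<pi> where "\<pi> i = (SOME k. k \<in> I \<and> A' i \<inter> A k \<noteq> {})" for i
  have \<pi>: "\<pi> i \<in> I \<and> A' i \<inter> A (\<pi> i) \<noteq> {}" if "i \<in> I" for i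
    unfolding \<pi>_def by (rule someI_ex) (use ex[OF that] in auto)
  have Q'A: "measure (Q' i) (A (\<pi> i)) = 1" if i: "i \<in> I" for i
  proof -
    interpret real_distribution "Q' i" by (rule Q'[OF i])
    have "A' i - N \<subseteq> A (\<pi> i)"
      using \<pi>[OF i] meet[OF i] unfolding N_def by blast
    then have "measure (Q' i) (A' i - N) \<le> measure (Q' i) (A (\<pi> i))"
      by (intro finite_measure_mono) (use A \<pi>[OF i] in auto)
    moreover have "measure (Q' i) (A' i - N) = 1"
    proof -
      have "measure (Q' i) (A' i) = measure (Q' i) (A' i - N) + measure (Q' i) (A' i \<inter> N)"
        by (subst finite_measure_Union[symmetric]) (use A'[OF i] N in \<open>auto simp: Un_commute Int_Diff_Un Un_Diff_Int\<close>)
      moreover have "measure (Q' i) (A' i \<inter> N) \<le> measure (Q' i) N"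
        by (intro finite_measure_mono) (use N in auto)
      ultimately show ?thesis using Q'N[OF i] QA'[OF i] measure_nonneg[of "Q' i" "A' i \<inter> N"] by linarith
    qed
    ultimately show ?thesis using prob_le_1[of "A (\<pi> i)"] by linarith
  qed
  \<comment> \<open>Intersecting with \<open>A j\<close> isolates one component of the first
    mixture; \<open>small\<close> below does the same for the second, and \<open>eq\<close> compares
    the two.\<close>
  have big: "(\<Sum>k\<in>I. l k * measure (Q k) (E \<inter> A j)) = l j * measure (Q j) E"
    if j: "j \<in> I" and E: "E \<in> sets borel" for j E
  proof -
    have "(\<Sum>k\<in>I. l k * measure (Q k) (E \<inter> A j)) = (\<Sum>k\<in>I. if k = j then l j * measure (Q j) E else 0)"
    proof (rule sum.cong[OF refl])
      fix k assume k: "k \<in> I"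
      show "l k * measure (Q k) (E \<inter> A j) = (if k = j then l j * measure (Q j) E else 0)"
      proof (cases "k = j")
        case True
        have "measure (Q j) (E \<inter> A j) = measure (Q j) E"
          by (rule full) (use Q A E QA j in auto)
        with True show ?thesis by simp
      next
        case False
        then have "measure (Q k) (E \<inter> A j) = 0"
          by (intro null[OF Q[OF k] A[OF k] _ QA[OF k]]) (use disj[OF k j] A[OF j] E in auto)
        with False show ?thesis by simp
      qed
    qed
    then show ?thesis using j I by simp
  qed
  \<comment> \<open>The set \<open>A k\<close> has mass l k > 0, so some second component i charges
    it. That component lives on \<open>A (\<pi> i)\<close>, and disjointness gives k = \<pi> i. On a
    finite set surjectivity yields injectivity.\<close>
  have surj: "\<pi> ` I = I"
  proof (intro equalityI subsetI)
    fix k assume k: "k \<in> I"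
    have "(\<Sum>i\<in>I. l' i * measure (Q' i) (A k)) = l k"
      using big[OF k, of UNIV] eq[OF A[OF k]] Q[OF k] real_distribution.space_eq_univ[OF Q[OF k]]
        prob_space.prob_space[of "Q k"] real_distribution.axioms(1)[OF Q[OF k]] by simp
    then have "\<exists>i\<in>I. measure (Q' i) (A k) \<noteq> 0"
      using l[OF k] by (metis (no_types, lifting) less_irrefl mult_zero_right sum.neutral)
    then obtain i where i: "i \<in> I" "measure (Q' i) (A k) \<noteq> 0" by auto
    have "k = \<pi> i"
    proof (rule ccontr)
      assume "k \<noteq> \<pi> i"
      then have "measure (Q' i) (A k) = 0"
        by (intro null[OF Q'[OF i(1)] A _ Q'A[OF i(1)]]) (use disj[of k "\<pi> i"] \<pi>[OF i(1)] k A in auto)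
      with i show False by simp
    qed
    with i show "k \<in> \<pi> ` I" by auto
  qed (use \<pi> in auto)
  then have inj: "inj_on \<pi> I" using I by (simp add: eq_card_imp_inj_on)
  have small: "(\<Sum>k\<in>I. l' k * measure (Q' k) (E \<inter> A (\<pi> i))) = l' i * measure (Q' i) E"
    if i: "i \<in> I" and E: "E \<in> sets borel" for i E
  proof -
    have "(\<Sum>k\<in>I. l' k * measure (Q' k) (E \<inter> A (\<pi> i))) = (\<Sum>k\<in>I. if k = i then l' i * measure (Q' i) E else 0)"
    proof (rule sum.cong[OF refl])
      fix k assume k: "k \<in> I"
      show "l' k * measure (Q' k) (E \<inter> A (\<pi> i)) = (if k = i then l' i * measure (Q' i) E else 0)"
      proof (cases "k = i")
        case True
        have "measure (Q' i) (E \<inter> A (\<pi> i)) = measure (Q' i) E"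
          by (rule full) (use Q' i A \<pi> E Q'A in auto)
        with True show ?thesis by simp
      next
        case False
        then have "\<pi> k \<noteq> \<pi> i" using inj i k by (auto dest: inj_onD)
        then have "measure (Q' k) (E \<inter> A (\<pi> i)) = 0"
          by (intro null[OF Q'[OF k] A[of "\<pi> k"] _ Q'A[OF k]]) (use disj[of "\<pi> k" "\<pi> i"] \<pi>[OF k] \<pi>[OF i] A E in auto)
        with False show ?thesis by simp
      qed
    qed
    then show ?thesis using i I by simp
  qed
  have both: "l' i * measure (Q' i) E = l (\<pi> i) * measure (Q (\<pi> i)) E" if "i \<in> I" "E \<in> sets borel" for i E
    using small[OF that] big[of "\<pi> i" E] eq[of "E \<inter> A (\<pi> i)"] \<pi>[OF that(1)] that A by auto
  have one: "measure M UNIV = 1" if "real_distribution M" for M :: "real measure"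
  proof -
    interpret real_distribution M by fact
    show ?thesis using prob_space by simp
  qed
  have ll: "l' i = l (\<pi> i)" if "i \<in> I" for i
    using both[OF that, of UNIV] one[OF Q'[OF that]] one[OF Q[of "\<pi> i"]] \<pi>[OF that] by simp
  show thesis
  proof (rule that)
    show "bij_betw \<pi> I I" using surj inj by (simp add: bij_betw_def)
    show "measure (Q' i) E = measure (Q (\<pi> i)) E" if "i \<in> I" "E \<in> sets borel" for i E
      using both[OF that] ll[OF that(1)] l'[OF that(1)] by simp
  qed (rule ll)
qed

text \<open>Strict monotonicity forces i \<le> \<pi> i, and a bijection preserves the sum of the
  indices, so no inequality is strict. This removes the unknown relabelling once the weights are
  sorted.\<close>

lemma strict_mono_on_bij_betw_eq_id:
  fixes \<pi> :: "nat \<Rightarrow> nat"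
  assumes b: "bij_betw \<pi> {1..K} {1..K}" and m: "strict_mono_on {1..K} \<pi>" and k: "k \<in> {1..K}"
  shows "\<pi> k = k"
proof -
  have ge: "i \<in> {1..K} \<Longrightarrow> i \<le> \<pi> i" for i
  proof (induction i)
    case (Suc i)
    show ?case
    proof (cases "i = 0")
      case True
      then show ?thesis using bij_betwE[OF b] Suc.prems by force
    next
      case False
      then have "i \<in> {1..K}" using Suc.prems by auto
      then show ?thesis using Suc strict_mono_onD[OF m, of i "Suc i"] by fastforce
    qed
  qed simp
  have "(\<Sum>i\<in>{1..K}. \<pi> i) = (\<Sum>i\<in>{1..K}. i)" by (rule sum.reindex_bij_betw[OF b])
  then have "\<not> k < \<pi> k"
    using sum_strict_mono_ex1[of "{1..K}" "\<lambda>i. i" \<pi>] ge k by fastforce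
  then show ?thesis using ge[OF k] by simp
qed

text \<open>Both measures are centred, so the shifts are the means of the translates. Once they
  agree, translating back identifies the measures.\<close>

lemma shift_measure_eqD:
  assumes G: "real_distribution G" and H: "real_distribution H"
    and bG: "AE t in G. \<bar>t\<bar> \<le> B" and bH: "AE t in H. \<bar>t\<bar> \<le> B"
    and mG: "(LINT t|G. t) = 0" and mH: "(LINT t|H. t) = 0"
    and eq: "\<And>E. E \<in> sets borel \<Longrightarrow> measure (distr G borel (\<lambda>t. t + c)) E = measure (distr H borel (\<lambda>t. t + d)) E"
  shows "c = d" "G = H"
proof -
  interpret G: real_distribution G by (rule G)
  interpret H: real_distribution H by (rule H)
  interpret G': prob_space "distr G borel (\<lambda>t. t + c)" by (rule G.prob_space_distr) simp
  interpret H': prob_space "distr H borel (\<lambda>t. t + d)" by (rule H.prob_space_distr) simp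
  have D: "distr G borel (\<lambda>t. t + c) = distr H borel (\<lambda>t. t + d)"
    by (rule measure_eqI) (use eq in \<open>auto simp: G'.emeasure_eq_measure H'.emeasure_eq_measure\<close>)
  have iG: "integrable G (\<lambda>t. t)" by (rule G.integrable_const_bound[where B = B]) (use bG in auto)
  have iH: "integrable H (\<lambda>t. t)" by (rule H.integrable_const_bound[where B = B]) (use bH in auto)
  have "(LINT t|G. t + c) = integral\<^sup>L (distr G borel (\<lambda>t. t + c)) (\<lambda>x. x)"
    by (subst integral_distr) auto
  also have "\<dots> = (LINT t|H. t + d)" unfolding D by (subst integral_distr) auto
  finally show cd: "c = d" using iG iH mG mH G.prob_space H.prob_space by simp
  have "distr (distr G borel (\<lambda>t. t + c)) borel (\<lambda>t. t - c) = distr (distr H borel (\<lambda>t. t + d)) borel (\<lambda>t. t - c)"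
    using D by simp
  then show "G = H"
    using cd by (simp add: distr_distr comp_def distr_id2)
qed

text \<open>Component k of either mixture lives on an interval of length D or D'. The parameter with
  the longer intervals supplies the disjoint sets: its locations are at least twice that length
  apart, so the gaps are at least as long as the intervals, and an interval of the other parameter
  meets at most one of them. Sorted weights then make the matching the identity.\<close>

lemma mixing_identifiable:
  fixes l l' u u' :: "nat \<Rightarrow> real"
  assumes G: "real_distribution G" and G': "real_distribution G'"
    and sG: "AE t in G. s \<le> t \<and> t \<le> s + D" and sG': "AE t in G'. s' \<le> t \<and> t \<le> s' + D'"
    and D: "0 \<le> D" "0 \<le> D'"
    and mG: "(LINT t|G. t) = 0" and mG': "(LINT t|G'. t) = 0"
    and u: "\<And>i k. i \<in> {1..K} \<Longrightarrow> k \<in> {1..K} \<Longrightarrow> i \<noteq> k \<Longrightarrow> 2 * D < \<bar>u i - u k\<bar>"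
    and u': "\<And>i k. i \<in> {1..K} \<Longrightarrow> k \<in> {1..K} \<Longrightarrow> i \<noteq> k \<Longrightarrow> 2 * D' \<le> \<bar>u' i - u' k\<bar>"
    and l: "\<And>k. k \<in> {1..K} \<Longrightarrow> 0 < l k" and l': "\<And>k. k \<in> {1..K} \<Longrightarrow> 0 < l' k"
    and sl: "(\<Sum>k=1..K. l k) = 1" and sl': "(\<Sum>k=1..K. l' k) = 1"
    and ml: "strict_mono_on {1..K} l" and ml': "mono_on {1..K} l'"
    and K: "1 \<le> K"
    and eq: "mixing K l u G = mixing K l' u' G'"
  shows "G = G'" "\<And>k. k \<in> {1..K} \<Longrightarrow> l k = l' k"
proof -
  interpret G: real_distribution G by (rule G)
  interpret G': real_distribution G' by (rule G')
  define Q where "Q k = distr G borel (\<lambda>t. t + u k)" for k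
  define Q' where "Q' k = distr G' borel (\<lambda>t. t + u' k)" for k
  define A where "A k = {s + u k..s + D + u k}" for k
  define A' where "A' k = {s' + u' k..s' + D' + u' k}" for k
  have Q: "real_distribution (Q k)" for k
    unfolding Q_def by (rule G.real_distribution_distr) simp
  have Q': "real_distribution (Q' k)" for k
    unfolding Q'_def by (rule G'.real_distribution_distr) simp
  have QA: "measure (Q k) (A k) = 1" for k
  proof -
    have "measure (Q k) (A k) = measure G ((\<lambda>t. t + u k) -` A k \<inter> space G)"
      unfolding Q_def by (rule measure_distr) (auto simp: A_def)
    also have "\<dots> = 1"
    proof (subst G.prob_eq_1)
      show "(\<lambda>t. t + u k) -` A k \<inter> space G \<in> G.events"
        by (rule measurable_sets[of _ _ borel]) (auto simp: A_def A'_def)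
      show "AE x in G. x \<in> (\<lambda>t. t + u k) -` A k \<inter> space G"
        using sG by eventually_elim (auto simp: A_def)
    qed
    finally show ?thesis .
  qed
  have QA': "measure (Q' k) (A' k) = 1" for k
  proof -
    have "measure (Q' k) (A' k) = measure G' ((\<lambda>t. t + u' k) -` A' k \<inter> space G')"
      unfolding Q'_def by (rule measure_distr) (auto simp: A'_def)
    also have "\<dots> = 1"
    proof (subst G'.prob_eq_1)
      show "(\<lambda>t. t + u' k) -` A' k \<inter> space G' \<in> G'.events"
        by (rule measurable_sets[of _ _ borel]) (auto simp: A_def A'_def)
      show "AE x in G'. x \<in> (\<lambda>t. t + u' k) -` A' k \<inter> space G'"
        using sG' by eventually_elim (auto simp: A'_def)
    qed
    finally show ?thesis .
  qed
  have eqE: "(\<Sum>k\<in>{1..K}. l k * measure (Q k) E) = (\<Sum>k\<in>{1..K}. l' k * measure (Q' k) E)" if "E \<in> sets borel" for E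
    unfolding Q_def Q'_def
    using measure_mixing[OF G less_imp_le[OF l] sl that, of u] measure_mixing[OF G' less_imp_le[OF l'] sl' that, of u'] eq
    by simp
  have main: "G = G' \<and> (\<forall>k\<in>{1..K}. l k = l' k)"
    if *: "\<And>k. k \<in> {1..K} \<Longrightarrow> l k = l' k"
      "\<And>k E. k \<in> {1..K} \<Longrightarrow> E \<in> sets borel \<Longrightarrow> measure (Q k) E = measure (Q' k) E"
  proof -
    let ?B = "\<bar>s\<bar> + D + \<bar>s'\<bar> + D'"
    \<comment> \<open>One matched component already determines the centred noise; component 1 exists
      because K \<ge> 1.\<close>
    have "G = G'"
    proof (rule shift_measure_eqD(2)[OF G G' _ _ mG mG'])
      show "AE t in G. \<bar>t\<bar> \<le> ?B" using sG by eventually_elim (use D in linarith)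
      show "AE t in G'. \<bar>t\<bar> \<le> ?B" using sG' by eventually_elim (use D in linarith)
      show "measure (distr G borel (\<lambda>t. t + u 1)) E = measure (distr G' borel (\<lambda>t. t + u' 1)) E"
        if "E \<in> sets borel" for E
        using *(2)[of 1 E] that K by (simp add: Q_def Q'_def)
    qed
    with *(1) show ?thesis by auto
  qed
  have "G = G' \<and> (\<forall>k\<in>{1..K}. l k = l' k)"
  proof (cases "D' \<le> D")
    case True
    obtain \<pi> where \<pi>: "bij_betw \<pi> {1..K} {1..K}" "\<And>i. i \<in> {1..K} \<Longrightarrow> l' i = l (\<pi> i)"
      "\<And>i E. i \<in> {1..K} \<Longrightarrow> E \<in> sets borel \<Longrightarrow> measure (Q' i) E = measure (Q (\<pi> i)) E"
    proof (rule mixture_components_match[of "{1..K}" Q Q' l l' A A'])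
      show "A i \<inter> A k = {}" if "i \<in> {1..K}" "k \<in> {1..K}" "i \<noteq> k" for i k
        using u[OF that] D unfolding A_def by auto
      show "k = k'" if "i \<in> {1..K}" "k \<in> {1..K}" "k' \<in> {1..K}" "A' i \<inter> A k \<noteq> {}" "A' i \<inter> A k' \<noteq> {}" for i k k'
        using u[OF that(2,3)] that(4,5) D True unfolding A_def A'_def by fastforce
    qed (use Q Q' l l' eqE QA QA' in \<open>auto simp: A_def A'_def\<close>)
    \<comment> \<open>Ties in \<open>l'\<close> are possible, so \<open>\<pi>\<close> is at first
      only weakly increasing; its injectivity makes it strict.\<close>
    have "strict_mono_on {1..K} \<pi>"
    proof (rule strict_mono_onI)
      fix i k assume ik: "i \<in> {1..K}" "k \<in> {1..K}" "i < k"
      then have "l (\<pi> i) \<le> l (\<pi> k)"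
        using mono_onD[OF ml', of i k] \<pi>(2) by simp
      then have "\<pi> i \<le> \<pi> k"
        using strict_mono_onD[OF ml, of "\<pi> k" "\<pi> i"] bij_betwE[OF \<pi>(1)] ik by (meson leD leI)
      moreover have "\<pi> i \<noteq> \<pi> k"
        using bij_betw_imp_inj_on[OF \<pi>(1)] ik by (auto dest: inj_onD)
      ultimately show "\<pi> i < \<pi> k" by simp
    qed
    then have "\<pi> k = k" if "k \<in> {1..K}" for k
      using strict_mono_on_bij_betw_eq_id[OF \<pi>(1)] that by blast
    then show ?thesis by (intro main) (use \<pi> in auto)
  next
    \<comment> \<open>Here D < D', so a gap of length D' already exceeds the intervals of length D:
      for the second parameter the non-strict separation is enough. Since D' > 0, its intervals are
      disjoint.\<close>
    case False
    obtain \<pi> where \<pi>: "bij_betw \<pi> {1..K} {1..K}" "\<And>i. i \<in> {1..K} \<Longrightarrow> l i = l' (\<pi> i)"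
      "\<And>i E. i \<in> {1..K} \<Longrightarrow> E \<in> sets borel \<Longrightarrow> measure (Q i) E = measure (Q' (\<pi> i)) E"
    proof (rule mixture_components_match[of "{1..K}" Q' Q l' l A' A])
      show "A' i \<inter> A' k = {}" if "i \<in> {1..K}" "k \<in> {1..K}" "i \<noteq> k" for i k
        using u'[OF that] D False unfolding A'_def by auto
      show "k = k'" if "i \<in> {1..K}" "k \<in> {1..K}" "k' \<in> {1..K}" "A i \<inter> A' k \<noteq> {}" "A i \<inter> A' k' \<noteq> {}" for i k k'
        using u'[OF that(2,3)] that(4,5) D False unfolding A_def A'_def by fastforce
    qed (use Q Q' l l' eqE QA QA' in \<open>auto simp: A_def A'_def\<close>)
    have "strict_mono_on {1..K} \<pi>"
    proof (rule strict_mono_onI)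
      fix i k assume ik: "i \<in> {1..K}" "k \<in> {1..K}" "i < k"
      then have "l' (\<pi> i) < l' (\<pi> k)"
        using strict_mono_onD[OF ml, of i k] \<pi>(2) by simp
      then show "\<pi> i < \<pi> k"
        using mono_onD[OF ml', of "\<pi> k" "\<pi> i"] bij_betwE[OF \<pi>(1)] ik by (meson leD leI)
    qed
    then have "\<pi> k = k" if "k \<in> {1..K}" for k
      using strict_mono_on_bij_betw_eq_id[OF \<pi>(1)] that by blast
    then show ?thesis by (intro main) (use \<pi> in auto)
  qed
  then show "G = G'" "\<And>k. k \<in> {1..K} \<Longrightarrow> l k = l' k" by auto
qed

text \<open>
  Polynomials vanishing at all but one location turn equality of the weighted power sums into
  equality of the masses at that location.
\<close>

lemma power_sums_identifiable:
  fixes l u w :: "nat \<Rightarrow> real"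
  assumes I: "finite I" and l: "\<And>k. k \<in> I \<Longrightarrow> 0 < l k" and il: "inj_on l I" and iu: "inj_on u I"
    and eq: "\<And>r. (\<Sum>k\<in>I. l k * u k ^ r) = (\<Sum>k\<in>I. l k * w k ^ r)"
    and k: "k \<in> I"
  shows "w k = u k"
proof -
  have poly_eq: "(\<Sum>k\<in>I. l k * poly p (u k)) = (\<Sum>k\<in>I. l k * poly p (w k))" for p
  proof -
    have "(\<Sum>k\<in>I. l k * poly p (v k)) = (\<Sum>i\<le>degree p. coeff p i * (\<Sum>k\<in>I. l k * v k ^ i))" for v
      unfolding poly_altdef sum_distrib_left by (subst sum.swap) (simp add: mult_ac)
    then show ?thesis using eq by simp
  qed
  have mass: "(\<Sum>j | j \<in> I \<and> w j = u i. l j) = l i" if i: "i \<in> I" for i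
  proof -
    define S where "S = (u ` I \<union> w ` I) - {u i}"
    define p where "p = (\<Prod>z\<in>S. [:- z, 1:])"
    have S: "finite S" using I by (simp add: S_def)
    have p0: "poly p z = 0" if "z \<in> S" for z
      using that S unfolding p_def by (auto simp: poly_prod)
    have pi: "poly p (u i) \<noteq> 0"
      using S by (auto simp: p_def poly_prod S_def)
    have sums: "(\<Sum>j\<in>I. l j * poly p (v j)) = poly p (u i) * (\<Sum>j | j \<in> I \<and> v j = u i. l j)"
      if "v ` I \<subseteq> u ` I \<union> w ` I" for v
    proof -
      have "(\<Sum>j\<in>I. l j * poly p (v j)) = (\<Sum>j\<in>I. if v j = u i then l j * poly p (u i) else 0)"
        using that p0 by (intro sum.cong) (auto simp: S_def)
      also have "\<dots> = (\<Sum>j | j \<in> I \<and> v j = u i. l j * poly p (u i))"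
        using I by (simp add: sum.inter_filter)
      finally show ?thesis by (simp add: sum_distrib_left mult.commute)
    qed
    have "{j. j \<in> I \<and> u j = u i} = {i}" using iu i by (auto dest: inj_onD)
    then have "(\<Sum>j | j \<in> I \<and> u j = u i. l j) = l i" by simp
    then show ?thesis using sums[of u] sums[of w] poly_eq[of p] pi by simp
  qed
  have ne: "\<exists>j. j \<in> I \<and> w j = u i" if "i \<in> I" for i
  proof (rule ccontr)
    assume "\<not> ?thesis"
    then have "{j. j \<in> I \<and> w j = u i} = {}" by auto
    then have "l i = 0" using mass[OF that] by (simp only: sum.empty)
    then show False using l[OF that] by simp
  qed
  \<comment> \<open>Every \<open>u i\<close> carries positive mass in the second family, so it
    occurs among the \<open>w\<close>, and counting makes \<open>w\<close> injective. Each mass is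
    then a single weight, and distinct weights identify the index.\<close>
  have im: "u ` I \<subseteq> w ` I" using ne by (force simp: image_iff)
  moreover have "card (w ` I) \<le> card (u ` I)" using card_image[OF iu] card_image_le[OF I, of w] by simp
  ultimately have weq: "w ` I = u ` I" using I by (metis card_seteq finite_imageI)
  then have iw: "inj_on w I" using card_image[OF iu] I by (simp add: eq_card_imp_inj_on)
  obtain i where i: "i \<in> I" "w k = u i" using weq k by (metis imageE imageI)
  have "{j. j \<in> I \<and> w j = w k} = {k}" using iw k unfolding inj_on_def by blast
  then have "l k = l i" using mass[OF i(1)] unfolding i(2)[symmetric] by simp
  then have "k = i" using il k i by (auto dest: inj_onD)
  with i show ?thesis by simp
qed

text \<open>By the binomial theorem the moments of the mixture form a triangular system in the
  weighted power sums of the locations. Its coefficients are moments of \<open>G\<close>, with M 0 =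
  1 on the diagonal, so the power sums follow by induction. The clusters may overlap here. Moments
  also avoid a division by the characteristic function of \<open>G\<close>, which may have
  zeros.\<close>

lemma mixing_locations_identifiable:
  fixes l u w :: "nat \<Rightarrow> real"
  assumes G: "real_distribution G" and bG: "AE t in G. \<bar>t\<bar> \<le> B"
    and l: "\<And>k. k \<in> {1..K} \<Longrightarrow> 0 < l k" and sl: "(\<Sum>k=1..K. l k) = 1"
    and il: "inj_on l {1..K}" and iu: "inj_on u {1..K}"
    and eq: "mixing K l u G = mixing K l w G" and k: "k \<in> {1..K}"
  shows "w k = u k"
proof (rule power_sums_identifiable[OF finite_atLeastAtMost l il iu _ k])
  interpret G: real_distribution G by (rule G)
  define M where "M r = (LINT t|G. t ^ r)" for r
  have it: "integrable G (\<lambda>t. t ^ r)" for r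
    by (rule G.integrable_const_bound[where B = "B ^ r"])
       (use bG in \<open>auto simp: power_abs intro!: power_mono elim!: eventually_mono\<close>)
  have binom: "(t + v) ^ r = (\<Sum>i\<le>r. (of_nat (r choose i) * v ^ i) * t ^ (r - i))" for t v :: real and r
    by (subst add.commute, subst binomial_ring) (simp add: mult_ac)
  have mom: "(\<Sum>k=1..K. l k * (LINT t|G. (t + v k) ^ r)) = (\<Sum>i\<le>r. of_nat (r choose i) * M (r - i) * (\<Sum>k=1..K. l k * v k ^ i))"
    for v :: "nat \<Rightarrow> real" and r
  proof -
    have "(LINT t|G. (t + v k) ^ r) = (\<Sum>i\<le>r. (of_nat (r choose i) * v k ^ i) * M (r - i))" for k
      unfolding binom M_def by (subst Bochner_Integration.integral_sum) (auto intro: it)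
    then show ?thesis
      unfolding sum_distrib_left by (subst sum.swap) (simp add: sum_distrib_left mult_ac)
  qed
  have iv: "integrable G (\<lambda>t. (t + v) ^ r)" for v r
    unfolding binom by (intro Bochner_Integration.integrable_sum integrable_mult_right it)
  have "(\<Sum>k=1..K. l k * (LINT t|G. (t + u k) ^ r)) = (\<Sum>k=1..K. l k * (LINT t|G. (t + w k) ^ r))" for r
    using integral_mixing[OF G less_imp_le[OF l] sl, of "\<lambda>x. x ^ r" u]
      integral_mixing[OF G less_imp_le[OF l] sl, of "\<lambda>x. x ^ r" w] iv eq by simp
  note meq = this[unfolded mom]
  show "(\<Sum>k=1..K. l k * u k ^ r) = (\<Sum>k=1..K. l k * w k ^ r)" for r
  proof (induction r rule: less_induct)
    case (less r)
    have M0: "M 0 = 1" using G.prob_space by (simp add: M_def)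
    have split: "(\<Sum>i\<le>r. g i) = (\<Sum>i<r. g i) + g r" for g :: "nat \<Rightarrow> real"
      by (simp flip: lessThan_Suc_atMost)
    have "(\<Sum>i<r. of_nat (r choose i) * M (r - i) * (\<Sum>k=1..K. l k * u k ^ i))
        = (\<Sum>i<r. of_nat (r choose i) * M (r - i) * (\<Sum>k=1..K. l k * w k ^ i))"
      using less.IH by (intro sum.cong) auto
    then show ?case using meq[of r] unfolding split by (simp add: M0)
  qed
qed

section \<open>Candidate parameters\<close>

text \<open>A vertical section of the joint density: \<open>c\<close> is the covariate density at
  that point, \<open>u\<close> the locations there.\<close>

definition mix_density ::
    "nat \<Rightarrow> real \<Rightarrow> real measure \<Rightarrow> (nat \<Rightarrow> real) \<Rightarrow> real \<Rightarrow> (nat \<Rightarrow> real) \<Rightarrow> real \<Rightarrow> real" where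
  "mix_density K \<sigma> G l c u y = c * (\<Sum>k=1..K. l k * gauss_conv \<sigma> G (y - u k))"

definition rat_point :: "nat \<Rightarrow> real" where
  "rat_point r = real_of_rat (from_nat r)"

type_synonym cand =
  "real measure \<times> (nat \<Rightarrow> real) \<times> real \<times> (nat \<Rightarrow> real) \<times> real \<times> (nat \<Rightarrow> real)"

text \<open>
  A candidate \<open>(G, l, c0, u0, c1, u1)\<close> consists of the mixing measure, the weights, and the value of
  the covariate density and the locations at \<open>x0\<close> and at a second point \<open>x\<close>. Level \<open>j\<close> collects the
  candidates whose constants are bounded by \<open>j\<close>. The separation is required with \<open>\<le>\<close> so that it
  survives weak limits; identifiability still holds if it is strict for one of the two parameters.
\<close>

definition cand_level :: "nat \<Rightarrow> nat \<Rightarrow> cand set" where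
  "cand_level K j = {(G, l, c0, u0, c1, u1).
     real_distribution G \<and> (AE t in G. \<bar>t\<bar> \<le> real j) \<and> (LINT t|G. t) = 0 \<and>
     (\<forall>k\<in>{1..K}. 1 \<le> real j * l k) \<and> (\<Sum>k=1..K. l k) = 1 \<and> mono_on {1..K} l \<and>
     \<bar>c0\<bar> \<le> real j \<and> \<bar>c1\<bar> \<le> real j \<and> (\<forall>k\<in>{1..K}. \<bar>u0 k\<bar> \<le> real j \<and> \<bar>u1 k\<bar> \<le> real j) \<and>
     (\<exists>s D. \<bar>s\<bar> \<le> real j \<and> 0 \<le> D \<and> D \<le> real j \<and> (AE t in G. s \<le> t \<and> t \<le> s + D) \<and>
        (\<forall>i\<in>{1..K}. \<forall>k\<in>{1..K}. i \<noteq> k \<longrightarrow> 2 * D \<le> \<bar>u0 i - u0 k\<bar>))}"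

text \<open>Interleaving the two sections turns a candidate into one sequence of reals, the form
  that the selection lemma takes.\<close>

definition cand_obs :: "nat \<Rightarrow> real \<Rightarrow> cand \<Rightarrow> nat \<Rightarrow> real" where
  "cand_obs K \<sigma> = (\<lambda>(G, l, c0, u0, c1, u1) r.
     if even r then mix_density K \<sigma> G l c0 u0 (rat_point (r div 2))
     else mix_density K \<sigma> G l c1 u1 (rat_point (r div 2)))"

text \<open>Levels bound the weights by a product instead of l k \<ge> 1 / j, because 1 / 0 = 0
  would admit vanishing weights at level 0.\<close>

lemma pos_of_one_le_mult_nat:
  fixes x :: real
  assumes "1 \<le> real i * x"
  shows "0 < x"
proof -
  have "0 < real i * x" using assms by linarith
  then show ?thesis by (simp add: zero_less_mult_iff)
qed

lemma cand_level_mono: "i \<le> j \<Longrightarrow> cand_level K i \<subseteq> cand_level K j"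
proof
  fix \<theta> assume ij: "i \<le> j" and \<theta>: "\<theta> \<in> cand_level K i"
  then have ij': "real i \<le> real j" by simp
  obtain G l c0 u0 c1 u1 where t: "\<theta> = (G, l, c0, u0, c1, u1)" by (cases \<theta>) auto
  have p: "real_distribution G" "(LINT t|G. t) = 0" "(\<Sum>k=1..K. l k) = 1" "mono_on {1..K} l"
    and ae: "AE t in G. \<bar>t\<bar> \<le> real i"
    and l: "\<And>k. k \<in> {1..K} \<Longrightarrow> 1 \<le> real i * l k"
    and c: "\<bar>c0\<bar> \<le> real i" "\<bar>c1\<bar> \<le> real i"
    and u: "\<And>k. k \<in> {1..K} \<Longrightarrow> \<bar>u0 k\<bar> \<le> real i \<and> \<bar>u1 k\<bar> \<le> real i"
    using \<theta> unfolding cand_level_def t mem_Collect_eq case_prod_conv by blast+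
  obtain s D where s: "\<bar>s\<bar> \<le> real i" "0 \<le> D" "D \<le> real i" "AE t in G. s \<le> t \<and> t \<le> s + D"
    "\<forall>i\<in>{1..K}. \<forall>k\<in>{1..K}. i \<noteq> k \<longrightarrow> 2 * D \<le> \<bar>u0 i - u0 k\<bar>"
    using \<theta> unfolding cand_level_def t mem_Collect_eq case_prod_conv by blast+
  have "AE t in G. \<bar>t\<bar> \<le> real j" using ae by eventually_elim (use ij' in linarith)
  moreover have "1 \<le> real j * l k" if k: "k \<in> {1..K}" for k
  proof -
    have "0 < l k" using l[OF k] by (rule pos_of_one_le_mult_nat)
    then have "real i * l k \<le> real j * l k" using ij' by (intro mult_right_mono) auto
    then show ?thesis using l[OF k] by linarith
  qed
  moreover have "\<exists>s D. \<bar>s\<bar> \<le> real j \<and> 0 \<le> D \<and> D \<le> real j \<and> (AE t in G. s \<le> t \<and> t \<le> s + D) \<and>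
        (\<forall>i\<in>{1..K}. \<forall>k\<in>{1..K}. i \<noteq> k \<longrightarrow> 2 * D \<le> \<bar>u0 i - u0 k\<bar>)"
    using s ij' by (intro exI[of _ s] exI[of _ D]) auto
  moreover have "\<bar>c0\<bar> \<le> real j" "\<bar>c1\<bar> \<le> real j" using c ij' by linarith+
  moreover have "\<forall>k\<in>{1..K}. \<bar>u0 k\<bar> \<le> real j \<and> \<bar>u1 k\<bar> \<le> real j"
    using u ij' by (meson order_trans)
  ultimately show "\<theta> \<in> cand_level K j"
    unfolding cand_level_def t mem_Collect_eq case_prod_conv using p by blast
qed

lemma rat_point_dense: "closure (range rat_point) = UNIV"
proof -
  have "range rat_point = \<rat>"
    unfolding rat_point_def Rats_def using surj_from_nat[where 'a = rat]
    by (metis image_image)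
  then show ?thesis by (simp add: Rats_closure_real)
qed

text \<open>Continuity extends the agreement from the rationals to the line. Integrating over y
  gives the constants, as smoothed mixtures have mass one; after division
  \<open>gauss_conv_inj\<close> removes the Gaussian.\<close>

lemma mix_density_identifiable:
  assumes G: "real_distribution G" "real_distribution G'" and s: "0 < \<sigma>"
    and l: "\<And>k. k \<in> {1..K} \<Longrightarrow> 0 < l k" "\<And>k. k \<in> {1..K} \<Longrightarrow> 0 < l' k"
    and sl: "(\<Sum>k=1..K. l k) = 1" "(\<Sum>k=1..K. l' k) = 1"
    and c: "0 < c"
    and eq: "\<And>r. mix_density K \<sigma> G l c u (rat_point r) = mix_density K \<sigma> G' l' c' u' (rat_point r)"
  shows "c = c'" "mixing K l u G = mixing K l' u' G'"
proof -
  let ?H = "mixing K l u G" and ?H' = "mixing K l' u' G'"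
  have H: "real_distribution ?H" "real_distribution ?H'"
    using real_distribution_mixing[OF G(1) less_imp_le[OF l(1)] sl(1)]
      real_distribution_mixing[OF G(2) less_imp_le[OF l(2)] sl(2)] by auto
  have d: "mix_density K \<sigma> G l c u y = c * gauss_conv \<sigma> ?H y"
    "mix_density K \<sigma> G' l' c' u' y = c' * gauss_conv \<sigma> ?H' y" for y
    unfolding mix_density_def
    using gauss_conv_mixing[OF G(1) less_imp_le[OF l(1)] sl(1) s] gauss_conv_mixing[OF G(2) less_imp_le[OF l(2)] sl(2) s]
    by auto
  have "closed {y. c * gauss_conv \<sigma> ?H y = c' * gauss_conv \<sigma> ?H' y}"
    by (intro closed_Collect_eq continuous_intros continuous_on_gauss_conv H s)
  moreover have "range rat_point \<subseteq> {y. c * gauss_conv \<sigma> ?H y = c' * gauss_conv \<sigma> ?H' y}"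
    using eq unfolding d by auto
  ultimately have "closure (range rat_point) \<subseteq> {y. c * gauss_conv \<sigma> ?H y = c' * gauss_conv \<sigma> ?H' y}"
    by (rule closure_minimal[rotated])
  then have all: "c * gauss_conv \<sigma> ?H y = c' * gauss_conv \<sigma> ?H' y" for y
    unfolding rat_point_dense by auto
  have "(LINT y|lborel. c * gauss_conv \<sigma> ?H y) = c" "(LINT y|lborel. c' * gauss_conv \<sigma> ?H' y) = c'"
    using has_bochner_integral_gauss_conv[OF H(1) s] has_bochner_integral_gauss_conv[OF H(2) s]
    by (auto simp: has_bochner_integral_iff)
  then show cc: "c = c'" using all by simp
  then have "gauss_conv \<sigma> ?H = gauss_conv \<sigma> ?H'" using all c by (auto simp: fun_eq_iff)
  then show "?H = ?H'" by (rule gauss_conv_inj[OF H s])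
qed

text \<open>With the argument frozen at z the integrand is a bounded continuous test function. The
  remaining error is |y n - z| times a Lipschitz constant common to all \<open>G n\<close>.\<close>

lemma gauss_conv_tendsto:
  assumes G: "\<And>n. real_distribution (G n)" and H: "real_distribution H" and w: "weak_conv_m G H"
    and s: "0 < \<sigma>" and y: "y \<longlonglongrightarrow> z"
  shows "(\<lambda>n. gauss_conv \<sigma> (G n) (y n)) \<longlonglongrightarrow> gauss_conv \<sigma> H z"
proof -
  let ?L = "1 / (sqrt (2 * pi * \<sigma>\<^sup>2) * \<sigma>)"
  have a: "(\<lambda>n. gauss_conv \<sigma> (G n) z) \<longlonglongrightarrow> gauss_conv \<sigma> H z"
    unfolding gauss_conv_def
  proof (rule weak_conv_imp_integral_bdd_continuous_conv[OF G H w])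
    show "norm (normal_density 0 \<sigma> (z - t)) \<le> 1 / sqrt (2 * pi * \<sigma>\<^sup>2)" for t
      using normal_density_le[OF s] by simp
    have "continuous_on UNIV (\<lambda>t. normal_density 0 \<sigma> (z - t))"
      by (rule continuous_on_compose2[OF continuous_on_normal_density[of UNIV 0 \<sigma>]]) (auto intro!: continuous_intros)
    then show "isCont (\<lambda>t. normal_density 0 \<sigma> (z - t)) t" for t
      by (simp add: continuous_on_eq_continuous_at)
  qed
  have b: "(\<lambda>n. ?L * \<bar>y n - z\<bar>) \<longlonglongrightarrow> 0"
    using tendsto_mult_right_zero[OF tendsto_rabs_zero[OF LIM_zero[OF y]]] .
  have "(\<lambda>n. gauss_conv \<sigma> (G n) (y n) - gauss_conv \<sigma> (G n) z) \<longlonglongrightarrow> 0"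
    by (rule Lim_null_comparison[OF always_eventually b])
       (use gauss_conv_lipschitz[OF G s] in auto)
  from tendsto_add[OF this a] show ?thesis by simp
qed

section \<open>Subsequences and weak limits of measures with bounded support\<close>

lemma finite_family_convergent_subseq:
  fixes f :: "nat \<Rightarrow> 'i \<Rightarrow> real"
  assumes "finite I" and b: "\<And>i n. i \<in> I \<Longrightarrow> \<bar>f n i\<bar> \<le> B"
  shows "\<exists>\<rho>. strict_mono (\<rho> :: nat \<Rightarrow> nat) \<and> (\<forall>i\<in>I. convergent (\<lambda>n. f (\<rho> n) i))"
  using assms
proof (induction I rule: finite_induct)
  case empty
  show ?case by (intro exI[of _ id]) (auto simp: strict_mono_def)
next
  case (insert i I)
  then obtain \<rho> where \<rho>: "strict_mono \<rho>" "\<forall>i\<in>I. convergent (\<lambda>n. f (\<rho> n) i)" by auto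
  have "bounded (range (\<lambda>n. f (\<rho> n) i))"
    unfolding bounded_iff using insert.prems by auto
  then obtain x \<tau> where \<tau>: "strict_mono \<tau>" "((\<lambda>n. f (\<rho> n) i) \<circ> \<tau>) \<longlonglongrightarrow> x"
    using bounded_imp_convergent_subsequence by blast
  have "convergent (\<lambda>n. f (\<rho> (\<tau> n)) k)" if "k \<in> insert i I" for k
  proof (cases "k = i")
    case True
    then show ?thesis using \<tau>(2) by (auto simp: convergent_def comp_def)
  next
    case False
    then have "convergent (\<lambda>n. f (\<rho> n) k)" using \<rho> that by auto
    from convergent_subseq_convergent[OF this \<tau>(1)] show ?thesis by (simp add: comp_def)
  qed
  then show ?case
    using strict_mono_o[OF \<rho>(1) \<tau>(1)] by (intro exI[of _ "\<rho> \<circ> \<tau>"]) (auto simp: comp_def)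
qed

lemma tendsto_subsubseqI:
  fixes X :: "nat \<Rightarrow> 'a::topological_space"
  assumes "\<And>\<rho>. strict_mono \<rho> \<Longrightarrow> \<exists>\<tau>. strict_mono (\<tau> :: nat \<Rightarrow> nat) \<and> (\<lambda>n. X (\<rho> (\<tau> n))) \<longlonglongrightarrow> L"
  shows "X \<longlonglongrightarrow> L"
proof (rule topological_tendstoI, rule ccontr)
  fix S assume S: "open S" "L \<in> S" and "\<not> eventually (\<lambda>n. X n \<in> S) sequentially"
  then have "\<exists>\<^sub>\<infinity>n. X n \<notin> S"
    by (simp add: not_eventually cofinite_eq_sequentially)
  then have "infinite {n. X n \<notin> S}" by (simp add: INFM_iff_infinite)
  then obtain \<rho> :: "nat \<Rightarrow> nat" where \<rho>: "strict_mono \<rho>" "\<And>n. \<rho> n \<in> {n. X n \<notin> S}"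
    using infinite_enumerate by blast
  obtain \<tau> where "strict_mono (\<tau> :: nat \<Rightarrow> nat)" "(\<lambda>n. X (\<rho> (\<tau> n))) \<longlonglongrightarrow> L"
    using assms[OF \<rho>(1)] by blast
  from topological_tendstoD[OF this(2) S] \<rho>(2) show False
    by (auto simp: eventually_sequentially)
qed

text \<open>The test function \<open>g\<close> measures the excess of t beyond the limiting
  endpoints, cut off at 1. Under \<open>G n\<close> its integral is at most the displacement of the
  endpoints, which tends to 0, so \<open>g\<close> vanishes almost everywhere in the limit.\<close>

lemma weak_conv_support:
  assumes G: "\<And>n. real_distribution (G n)" and H: "real_distribution H" and w: "weak_conv_m G H"
    and ae: "\<And>n. AE t in G n. p n \<le> t \<and> t \<le> q n" and p: "p \<longlonglongrightarrow> p'" and q: "q \<longlonglongrightarrow> q'"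
  shows "AE t in H. p' \<le> t \<and> t \<le> q'"
proof -
  interpret H: real_distribution H by (rule H)
  interpret G: real_distribution "G n" for n by (rule G)
  define g where "g t = min 1 (max 0 (max (p' - t) (t - q')))" for t :: real
  have gc: "isCont g t" for t unfolding g_def by (intro continuous_intros)
  have gm [measurable]: "g \<in> borel_measurable borel" unfolding g_def by measurable
  have gb: "norm (g t) \<le> 1" for t unfolding g_def by auto
  have "(\<lambda>n. integral\<^sup>L (G n) g) \<longlonglongrightarrow> integral\<^sup>L H g"
    by (rule weak_conv_imp_integral_bdd_continuous_conv[OF G H w gc gb])
  moreover have "(\<lambda>n. integral\<^sup>L (G n) g) \<longlonglongrightarrow> 0"
  proof (rule Lim_null_comparison[OF always_eventually])
    have "(\<lambda>n. \<bar>p n - p'\<bar> + \<bar>q n - q'\<bar>) \<longlonglongrightarrow> \<bar>p' - p'\<bar> + \<bar>q' - q'\<bar>"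
      by (intro tendsto_intros p q)
    then show "(\<lambda>n. \<bar>p n - p'\<bar> + \<bar>q n - q'\<bar>) \<longlonglongrightarrow> 0" by simp
    show "\<forall>n. norm (integral\<^sup>L (G n) g) \<le> \<bar>p n - p'\<bar> + \<bar>q n - q'\<bar>"
    proof
      fix n
      have "0 \<le> integral\<^sup>L (G n) g"
        by (rule Bochner_Integration.integral_nonneg) (auto simp: g_def)
      moreover have "integral\<^sup>L (G n) g \<le> (LINT t|G n. \<bar>p n - p'\<bar> + \<bar>q n - q'\<bar>)"
      proof (rule integral_mono_AE)
        show "integrable (G n) g"
          by (rule real_distribution_integrable_bounded[OF G gm gb])
        show "AE t in G n. g t \<le> \<bar>p n - p'\<bar> + \<bar>q n - q'\<bar>"
          using ae[of n] by eventually_elim (auto simp: g_def min_def max_def)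
      qed simp
      ultimately show "norm (integral\<^sup>L (G n) g) \<le> \<bar>p n - p'\<bar> + \<bar>q n - q'\<bar>"
        using G.prob_space[of n] by simp
    qed
  qed
  ultimately have "integral\<^sup>L H g = 0" by (rule LIMSEQ_unique)
  then have "AE t in H. g t = 0"
    by (subst (asm) integral_nonneg_eq_0_iff_AE)
       (auto intro!: real_distribution_integrable_bounded[OF H gm gb] simp: g_def)
  then show ?thesis
    by eventually_elim (auto simp: g_def min_def max_def split: if_splits)
qed

text \<open>The identity is unbounded, so it is truncated at B; this changes nothing almost
  everywhere under \<open>G n\<close> and, by \<open>weak_conv_support\<close>, under
  \<open>H\<close>.\<close>

lemma weak_conv_mean:
  assumes G: "\<And>n. real_distribution (G n)" and H: "real_distribution H" and w: "weak_conv_m G H"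
    and ae: "\<And>n. AE t in G n. \<bar>t\<bar> \<le> B"
  shows "(\<lambda>n. LINT t|G n. t) \<longlonglongrightarrow> (LINT t|H. t)"
proof -
  interpret H: real_distribution H by (rule H)
  interpret G: real_distribution "G n" for n by (rule G)
  define g where "g t = min B (max (- B) t)" for t :: real
  have gc: "isCont g t" for t unfolding g_def by (intro continuous_intros)
  have gm [measurable]: "g \<in> borel_measurable borel" unfolding g_def by measurable
  have gb: "norm (g t) \<le> \<bar>B\<bar>" for t unfolding g_def by auto
  have "AE t in H. - B \<le> t \<and> t \<le> B"
    by (rule weak_conv_support[OF G H w, of "\<lambda>_. - B" "\<lambda>_. B"])
       (use ae in \<open>auto simp: abs_le_iff minus_le_iff\<close>)
  then have "AE t in H. t = g t" by eventually_elim (auto simp: g_def)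
  then have "(LINT t|H. t) = integral\<^sup>L H g"
    by (intro integral_cong_AE) auto
  moreover have "(LINT t|G n. t) = integral\<^sup>L (G n) g" for n
  proof (rule integral_cong_AE)
    show "AE t in G n. t = g t" using ae[of n] by eventually_elim (auto simp: g_def)
  qed auto
  moreover have "(\<lambda>n. integral\<^sup>L (G n) g) \<longlonglongrightarrow> integral\<^sup>L H g"
    by (rule weak_conv_imp_integral_bdd_continuous_conv[OF G H w gc gb])
  ultimately show ?thesis by simp
qed

lemma tight_bounded:
  assumes G: "\<And>n. real_distribution (G n)" and ae: "\<And>n. AE t in G n. \<bar>t\<bar> \<le> B"
  shows "tight G"
  unfolding tight_def
proof (intro conjI allI impI)
  fix e :: real assume e: "0 < e"
  \<comment> \<open>The intervals of \<open>tight\<close> are half-open and nondegenerate; the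
    margin 1 keeps -|B| inside and covers B = 0.\<close>
  have "measure (G n) {- \<bar>B\<bar> - 1<..\<bar>B\<bar> + 1} = 1" for n
  proof -
    interpret real_distribution "G n" by (rule G)
    show ?thesis by (subst prob_eq_1) (use ae[of n] in \<open>auto elim!: eventually_mono\<close>)
  qed
  then show "\<exists>a b. a < b \<and> (\<forall>n. measure (G n) {a<..b} > 1 - e)"
    using e by (intro exI[of _ "- \<bar>B\<bar> - 1"] exI[of _ "\<bar>B\<bar> + 1"]) auto
qed (rule G)

text \<open>Compactness of one level: bounded real coordinates and tight measures have convergent
  subsequences, and the closed conditions of the level pass to the limit. The limit has the
  observations of the truth. The section at x0 identifies the measure and the weights, and then the
  second section identifies the locations.\<close>

lemma cand_subseq_convergent:
  assumes s: "0 < \<sigma>" and K: "1 \<le> K"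
    and cand: "\<And>n. (G n, l n, c0 n, u0 n, c1 n, u1 n) \<in> cand_level K j"
    and G': "real_distribution G'" and sG': "AE t in G'. s' \<le> t \<and> t \<le> s' + D'" and D': "0 \<le> D'"
    and mG': "(LINT t|G'. t) = 0"
    and l': "\<And>k. k \<in> {1..K} \<Longrightarrow> 0 < l' k" and sl': "(\<Sum>k=1..K. l' k) = 1"
    and ml': "strict_mono_on {1..K} l'"
    and c0': "0 < c0'" and c1': "0 < c1'"
    and u0': "\<And>i k. i \<in> {1..K} \<Longrightarrow> k \<in> {1..K} \<Longrightarrow> i \<noteq> k \<Longrightarrow> 2 * D' < \<bar>u0' i - u0' k\<bar>"
    and obs: "\<And>r. (\<lambda>n. cand_obs K \<sigma> (G n, l n, c0 n, u0 n, c1 n, u1 n) r) \<longlonglongrightarrow> cand_obs K \<sigma> (G', l', c0', u0', c1', u1') r"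
  obtains \<rho> where "strict_mono (\<rho> :: nat \<Rightarrow> nat)" "weak_conv_m (G \<circ> \<rho>) G'"
    "\<And>k. k \<in> {1..K} \<Longrightarrow> (\<lambda>n. l (\<rho> n) k) \<longlonglongrightarrow> l' k"
    "\<And>k. inj_on u1' {1..K} \<Longrightarrow> k \<in> {1..K} \<Longrightarrow> (\<lambda>n. u1 (\<rho> n) k) \<longlonglongrightarrow> u1' k"
proof -
  have G: "\<And>n. real_distribution (G n)" and aeG: "\<And>n. AE t in G n. \<bar>t\<bar> \<le> real j" and mG: "\<And>n. (LINT t|G n. t) = 0"
    and l: "\<And>n k. k \<in> {1..K} \<Longrightarrow> 1 \<le> real j * l n k" and sl: "\<And>n. (\<Sum>k=1..K. l n k) = 1"
    and ml: "\<And>n. mono_on {1..K} (l n)"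
    and c0: "\<And>n. \<bar>c0 n\<bar> \<le> real j" and c1: "\<And>n. \<bar>c1 n\<bar> \<le> real j"
    and u0: "\<And>n k. k \<in> {1..K} \<Longrightarrow> \<bar>u0 n k\<bar> \<le> real j" and u1: "\<And>n k. k \<in> {1..K} \<Longrightarrow> \<bar>u1 n k\<bar> \<le> real j"
    using cand unfolding cand_level_def mem_Collect_eq case_prod_conv by blast+
  have "\<forall>n. \<exists>s D. \<bar>s\<bar> \<le> real j \<and> 0 \<le> D \<and> D \<le> real j \<and> (AE t in G n. s \<le> t \<and> t \<le> s + D) \<and>
        (\<forall>i\<in>{1..K}. \<forall>k\<in>{1..K}. i \<noteq> k \<longrightarrow> 2 * D \<le> \<bar>u0 n i - u0 n k\<bar>)"
    using cand unfolding cand_level_def mem_Collect_eq case_prod_conv by blast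
  then obtain S D where SD: "\<forall>n. \<bar>S n\<bar> \<le> real j \<and> 0 \<le> D n \<and> D n \<le> real j \<and> (AE t in G n. S n \<le> t \<and> t \<le> S n + D n) \<and>
        (\<forall>i\<in>{1..K}. \<forall>k\<in>{1..K}. i \<noteq> k \<longrightarrow> 2 * D n \<le> \<bar>u0 n i - u0 n k\<bar>)"
    unfolding choice_iff by (elim exE) (rule that)
  then have S: "\<And>n. \<bar>S n\<bar> \<le> real j" and D: "\<And>n. 0 \<le> D n" "\<And>n. D n \<le> real j"
    and aeS: "\<And>n. AE t in G n. S n \<le> t \<and> t \<le> S n + D n"
    and sep: "\<And>n i k. i \<in> {1..K} \<Longrightarrow> k \<in> {1..K} \<Longrightarrow> i \<noteq> k \<Longrightarrow> 2 * D n \<le> \<bar>u0 n i - u0 n k\<bar>"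
    by blast+
  have lpos: "0 < l n k" if "k \<in> {1..K}" for n k
    using l[OF that, of n] by (rule pos_of_one_le_mult_nat)
  have lle: "l n k \<le> 1" if "k \<in> {1..K}" for n k
    using member_le_sum[of k "{1..K}" "l n"] lpos[of _ n] that sl[of n] by (auto intro: less_imp_le)
  \<comment> \<open>All real coordinates form one finite family indexed by slot and component, so a
    single extraction serves them all. The four scalars are repeated for each k and read off at k =
    1.\<close>
  define f where "f n i = (case i of (a, k) \<Rightarrow>
     [c0 n, c1 n, S n, D n, u0 n k, u1 n k, l n k] ! a)" for n and i :: "nat \<times> nat"
  let ?I = "{..<7::nat} \<times> {1..K}"
  have fb: "\<bar>f n i\<bar> \<le> real j + 1" if i: "i \<in> ?I" for i n
  proof -
    obtain a k where ak: "i = (a, k)" "a < 7" "k \<in> {1..K}" using i by auto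
    then consider "a = 0" | "a = 1" | "a = 2" | "a = 3" | "a = 4" | "a = 5" | "a = 6" by linarith
    then show ?thesis
    proof cases
      case 1 then show ?thesis using c0[of n] by (simp add: f_def ak)
    next
      case 2 then show ?thesis using c1[of n] by (simp add: f_def ak)
    next
      case 3 then show ?thesis using S[of n] by (simp add: f_def ak)
    next
      case 4 then show ?thesis using D[of n] by (simp add: f_def ak)
    next
      case 5 then show ?thesis using u0[OF ak(3), of n] by (simp add: f_def ak)
    next
      case 6 then show ?thesis using u1[OF ak(3), of n] by (simp add: f_def ak)
    next
      case 7 then show ?thesis using lle[OF ak(3), of n] lpos[OF ak(3), of n] by (simp add: f_def ak)
    qed
  qed
  obtain \<rho>1 where \<rho>1: "strict_mono \<rho>1" "\<And>i. i \<in> ?I \<Longrightarrow> convergent (\<lambda>n. f (\<rho>1 n) i)"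
    using finite_family_convergent_subseq[of ?I f "real j + 1"] fb by blast
  obtain \<rho>2 H where \<rho>2: "strict_mono \<rho>2" and H: "real_distribution H" and w: "weak_conv_m (G \<circ> \<rho>1 \<circ> \<rho>2) H"
    using tight_imp_convergent_subsubsequence[OF tight_bounded[of G, OF G aeG] \<rho>1(1)] by (elim exE conjE) (rule that)
  define \<rho> where "\<rho> = \<rho>1 \<circ> \<rho>2"
  have \<rho>: "strict_mono \<rho>" unfolding \<rho>_def by (rule strict_mono_o[OF \<rho>1(1) \<rho>2])
  have w: "weak_conv_m (G \<circ> \<rho>) H" using w by (simp add: \<rho>_def comp_assoc)
  have conv: "convergent (\<lambda>n. f (\<rho> n) i)" if "i \<in> ?I" for i
    using convergent_subseq_convergent[OF \<rho>1(2)[OF that] \<rho>2] by (simp add: comp_def \<rho>_def)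
  define L where "L i = lim (\<lambda>n. f (\<rho> n) i)" for i
  have lim: "(\<lambda>n. f (\<rho> n) i) \<longlonglongrightarrow> L i" if "i \<in> ?I" for i
    using conv[OF that] unfolding L_def convergent_LIMSEQ_iff .
  have lc0: "(\<lambda>n. c0 (\<rho> n)) \<longlonglongrightarrow> L (0, 1)" using lim[of "(0, 1)"] K by (simp add: f_def)
  have lc1: "(\<lambda>n. c1 (\<rho> n)) \<longlonglongrightarrow> L (1, 1)" using lim[of "(1, 1)"] K by (simp add: f_def)
  have lS: "(\<lambda>n. S (\<rho> n)) \<longlonglongrightarrow> L (2, 1)" using lim[of "(2, 1)"] K by (simp add: f_def)
  have lD: "(\<lambda>n. D (\<rho> n)) \<longlonglongrightarrow> L (3, 1)" using lim[of "(3, 1)"] K by (simp add: f_def)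
  define v0 v1 m where "v0 k = L (4, k)" and "v1 k = L (5, k)" and "m k = L (6, k)" for k
  have lu0: "(\<lambda>n. u0 (\<rho> n) k) \<longlonglongrightarrow> v0 k" and lu1: "(\<lambda>n. u1 (\<rho> n) k) \<longlonglongrightarrow> v1 k" and ll: "(\<lambda>n. l (\<rho> n) k) \<longlonglongrightarrow> m k"
    if k: "k \<in> {1..K}" for k
    using lim[of "(4, k)"] lim[of "(5, k)"] lim[of "(6, k)"] k
    by (auto simp: v0_def v1_def m_def f_def)
  have D0: "0 \<le> L (3, 1)" by (rule LIMSEQ_le_const[OF lD]) (use D in auto)
  have aeH: "AE t in H. L (2, 1) \<le> t \<and> t \<le> L (2, 1) + L (3, 1)"
  proof (rule weak_conv_support[OF _ H w])
    show "AE t in (G \<circ> \<rho>) n. S (\<rho> n) \<le> t \<and> t \<le> S (\<rho> n) + D (\<rho> n)" for n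
      unfolding comp_def by (rule aeS)
  qed (use G lS lD in \<open>auto intro!: tendsto_intros\<close>)
  have mH: "(LINT t|H. t) = 0"
  proof -
    have "(\<lambda>n. LINT t|(G \<circ> \<rho>) n. t) \<longlonglongrightarrow> (LINT t|H. t)"
    proof (rule weak_conv_mean[OF _ H w])
      show "AE t in (G \<circ> \<rho>) n. \<bar>t\<bar> \<le> real j" for n unfolding comp_def by (rule aeG)
    qed (simp add: G)
    then show ?thesis using mG by (simp add: LIMSEQ_const_iff)
  qed
  \<comment> \<open>The level keeps the weights away from 0, so no component is lost in the
    limit.\<close>
  have mpos: "0 < m k" if k: "k \<in> {1..K}" for k
  proof -
    have "1 \<le> real j * m k"
      by (rule LIMSEQ_le_const[OF tendsto_mult[OF tendsto_const ll[OF k]]]) (use l[OF k] in auto)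
    then show ?thesis by (rule pos_of_one_le_mult_nat)
  qed
  have sm: "(\<Sum>k=1..K. m k) = 1"
  proof -
    have "(\<lambda>n. \<Sum>k=1..K. l (\<rho> n) k) \<longlonglongrightarrow> (\<Sum>k=1..K. m k)" by (intro tendsto_sum ll)
    then show ?thesis using sl by (simp add: LIMSEQ_const_iff)
  qed
  have mm: "mono_on {1..K} m"
  proof (rule mono_onI)
    fix i k assume ik: "i \<in> {1..K}" "k \<in> {1..K}" "i \<le> k"
    show "m i \<le> m k"
      by (rule LIMSEQ_le[OF ll[OF ik(1)] ll[OF ik(2)]]) (use mono_onD[OF ml] ik in auto)
  qed
  have v0sep: "2 * L (3, 1) \<le> \<bar>v0 i - v0 k\<bar>" if ik: "i \<in> {1..K}" "k \<in> {1..K}" "i \<noteq> k" for i k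
  proof (rule LIMSEQ_le)
    show "(\<lambda>n. 2 * D (\<rho> n)) \<longlonglongrightarrow> 2 * L (3, 1)" by (intro tendsto_intros lD)
    show "(\<lambda>n. \<bar>u0 (\<rho> n) i - u0 (\<rho> n) k\<bar>) \<longlonglongrightarrow> \<bar>v0 i - v0 k\<bar>" by (intro tendsto_intros lu0 ik)
  qed (use sep ik in auto)
  have dens: "(\<lambda>n. mix_density K \<sigma> (G (\<rho> n)) (l (\<rho> n)) (c n) (u n) y) \<longlonglongrightarrow> mix_density K \<sigma> H m d v y"
    if "c \<longlonglongrightarrow> d" "\<And>k. k \<in> {1..K} \<Longrightarrow> (\<lambda>n. u n k) \<longlonglongrightarrow> v k" for c d u v y
    unfolding mix_density_def
  proof (intro tendsto_mult that(1) tendsto_sum ll)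
    fix k assume k: "k \<in> {1..K}"
    have "(\<lambda>n. y - u n k) \<longlonglongrightarrow> y - v k" by (intro tendsto_intros that(2) k)
    from gauss_conv_tendsto[OF _ H w s this] G
    show "(\<lambda>n. gauss_conv \<sigma> (G (\<rho> n)) (y - u n k)) \<longlonglongrightarrow> gauss_conv \<sigma> H (y - v k)"
      by (simp add: comp_def)
  qed
  have obs\<rho>: "(\<lambda>n. cand_obs K \<sigma> (G (\<rho> n), l (\<rho> n), c0 (\<rho> n), u0 (\<rho> n), c1 (\<rho> n), u1 (\<rho> n)) r)
     \<longlonglongrightarrow> cand_obs K \<sigma> (G', l', c0', u0', c1', u1') r" for r
    using LIMSEQ_subseq_LIMSEQ[OF obs[of r] \<rho>] by (simp add: comp_def)
  have e0: "mix_density K \<sigma> G' l' c0' u0' (rat_point r) = mix_density K \<sigma> H m (L (0, 1)) v0 (rat_point r)" for r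
    using LIMSEQ_unique[OF obs\<rho>[of "2 * r"], unfolded cand_obs_def] dens[OF lc0 lu0] by simp
  have e1: "mix_density K \<sigma> G' l' c1' u1' (rat_point r) = mix_density K \<sigma> H m (L (1, 1)) v1 (rat_point r)" for r
    using LIMSEQ_unique[OF obs\<rho>[of "2 * r + 1"], unfolded cand_obs_def] dens[OF lc1 lu1] by simp
  have mix0: "mixing K l' u0' G' = mixing K m v0 H"
    by (rule mix_density_identifiable(2)[OF G' H s l' mpos sl' sm c0' e0])
  have mix1: "mixing K l' u1' G' = mixing K m v1 H"
    by (rule mix_density_identifiable(2)[OF G' H s l' mpos sl' sm c1' e1])
  \<comment> \<open>The truth takes the strict side, in the separation as in the order of the
    weights, and the limit the non-strict one.\<close>
  note id = mixing_identifiable[OF G' H sG' aeH D' D0 mG' mH u0' v0sep l' mpos sl' sm ml' mm K mix0]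
  have GH: "G' = H" by (rule id(1))
  have lm: "l' k = m k" if "k \<in> {1..K}" for k by (rule id(2)) (use that in auto)
  have mixm: "mixing K m v1 H = mixing K l' v1 H"
  proof -
    have "point_measure {1..K} (\<lambda>k. ennreal (m k)) = point_measure {1..K} (\<lambda>k. ennreal (l' k))"
      unfolding point_measure_def using lm by (intro density_cong) (auto simp: AE_count_space)
    then show ?thesis by (simp add: mixing_def)
  qed
  show thesis
  proof (rule that[OF \<rho>])
    show "weak_conv_m (G \<circ> \<rho>) G'" using w GH by simp
    show "(\<lambda>n. l (\<rho> n) k) \<longlonglongrightarrow> l' k" if "k \<in> {1..K}" for k using ll[OF that] lm[OF that] by simp
    show "(\<lambda>n. u1 (\<rho> n) k) \<longlonglongrightarrow> u1' k" if inj: "inj_on u1' {1..K}" and k: "k \<in> {1..K}" for k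
    proof -
      have "v1 k = u1' k"
      proof (rule mixing_locations_identifiable[OF G' _ l' sl' strict_mono_on_imp_inj_on[OF ml'] inj _ k])
        show "AE t in G'. \<bar>t\<bar> \<le> \<bar>s'\<bar> + D'" using sG' by eventually_elim (use D' in linarith)
        show "mixing K l' u1' G' = mixing K l' v1 G'" using mix1 mixm GH by simp
      qed
      then show ?thesis using lu1[OF k] by simp
    qed
  qed
qed

text \<open>Smoothing turns weak convergence into pointwise convergence of densities, and the common
  support bound gives one Gaussian envelope for all n.\<close>

lemma L1_dist_gauss_conv_tendsto:
  assumes s: "0 < \<sigma>" and G: "\<And>n. real_distribution (G n)" and H: "real_distribution H" and w: "weak_conv_m G H"
    and ae: "\<And>n. AE t in G n. \<bar>t\<bar> \<le> B"
  shows "(\<lambda>n. L1_dist_on UNIV (gauss_conv \<sigma> (G n)) (gauss_conv \<sigma> H)) \<longlonglongrightarrow> 0"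
proof -
  have [measurable]: "gauss_conv \<sigma> (G n) \<in> borel_measurable borel" "gauss_conv \<sigma> H \<in> borel_measurable borel" for n
    by (auto intro: borel_measurable_gauss_conv G H s)
  let ?w = "\<lambda>y. exp (B\<^sup>2 / (2 * \<sigma>\<^sup>2)) * sqrt 2 * normal_density 0 (sqrt 2 * \<sigma>) y"
  have iw: "integrable lborel (\<lambda>y. ?w y + gauss_conv \<sigma> H y)"
    using has_bochner_integral_gauss_conv[OF H s] s
    by (intro Bochner_Integration.integrable_add integrable_mult_right)
       (auto simp: has_bochner_integral_iff)
  have "(\<lambda>n. \<integral>\<^sup>+y. ennreal \<bar>gauss_conv \<sigma> (G n) y - gauss_conv \<sigma> H y\<bar> \<partial>lborel) \<longlonglongrightarrow> (\<integral>\<^sup>+(y::real). 0 \<partial>lborel)"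
  proof (rule nn_integral_dominated_convergence)
    show "(\<integral>\<^sup>+y. ennreal (?w y + gauss_conv \<sigma> H y) \<partial>lborel) < \<infinity>"
      using iw gauss_conv_nonneg[OF H s]
      by (subst nn_integral_eq_integral) auto
    show "AE y in lborel. ennreal \<bar>gauss_conv \<sigma> (G n) y - gauss_conv \<sigma> H y\<bar> \<le> ennreal (?w y + gauss_conv \<sigma> H y)" for n
    proof (intro AE_I2 ennreal_leI)
      fix y
      show "\<bar>gauss_conv \<sigma> (G n) y - gauss_conv \<sigma> H y\<bar> \<le> ?w y + gauss_conv \<sigma> H y"
        using gauss_conv_upper_bound[OF G s ae, of n y] gauss_conv_nonneg[OF G s, of n y] gauss_conv_nonneg[OF H s, of y]
        by linarith
    qed
    show "AE y in lborel. (\<lambda>n. ennreal \<bar>gauss_conv \<sigma> (G n) y - gauss_conv \<sigma> H y\<bar>) \<longlonglongrightarrow> 0"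
    proof (intro AE_I2)
      fix y
      have "(\<lambda>n. \<bar>gauss_conv \<sigma> (G n) y - gauss_conv \<sigma> H y\<bar>) \<longlonglongrightarrow> 0"
        by (intro tendsto_rabs_zero LIM_zero gauss_conv_tendsto[OF G H w s tendsto_const])
      from tendsto_ennrealI[OF this] show "(\<lambda>n. ennreal \<bar>gauss_conv \<sigma> (G n) y - gauss_conv \<sigma> H y\<bar>) \<longlonglongrightarrow> 0"
        by simp
    qed
  qed auto
  then show ?thesis by (simp add: L1_dist_on_def)
qed

text \<open>Every subsequence has a further subsequence with the same, identified limit, so the
  whole sequences converge.\<close>

lemma cand_consistent:
  assumes s: "0 < \<sigma>" and K: "1 \<le> K"
    and cand: "\<And>n. (G n, l n, c0 n, u0 n, c1 n, u1 n) \<in> cand_level K j"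
    and G': "real_distribution G'" and sG': "AE t in G'. s' \<le> t \<and> t \<le> s' + D'" and D': "0 \<le> D'"
    and mG': "(LINT t|G'. t) = 0"
    and l': "\<And>k. k \<in> {1..K} \<Longrightarrow> 0 < l' k" and sl': "(\<Sum>k=1..K. l' k) = 1"
    and ml': "strict_mono_on {1..K} l'"
    and c0': "0 < c0'" and c1': "0 < c1'"
    and u0': "\<And>i k. i \<in> {1..K} \<Longrightarrow> k \<in> {1..K} \<Longrightarrow> i \<noteq> k \<Longrightarrow> 2 * D' < \<bar>u0' i - u0' k\<bar>"
    and obs: "\<And>r. (\<lambda>n. cand_obs K \<sigma> (G n, l n, c0 n, u0 n, c1 n, u1 n) r) \<longlonglongrightarrow> cand_obs K \<sigma> (G', l', c0', u0', c1', u1') r"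
  shows "(\<lambda>n. L1_dist_on UNIV (gauss_conv \<sigma> (G n)) (gauss_conv \<sigma> G')) \<longlonglongrightarrow> 0"
    and "\<And>k. k \<in> {1..K} \<Longrightarrow> (\<lambda>n. l n k) \<longlonglongrightarrow> l' k"
    and "\<And>k. inj_on u1' {1..K} \<Longrightarrow> k \<in> {1..K} \<Longrightarrow> (\<lambda>n. u1 n k) \<longlonglongrightarrow> u1' k"
proof -
  have G: "real_distribution (G n)" and ae: "AE t in G n. \<bar>t\<bar> \<le> real j" for n
    using cand[of n] by (auto simp: cand_level_def)
  have sub: "\<exists>\<tau>. strict_mono \<tau> \<and> weak_conv_m (\<lambda>n. G (\<rho> (\<tau> n))) G' \<and>
      (\<forall>k\<in>{1..K}. (\<lambda>n. l (\<rho> (\<tau> n)) k) \<longlonglongrightarrow> l' k) \<and>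
      (\<forall>k\<in>{1..K}. inj_on u1' {1..K} \<longrightarrow> (\<lambda>n. u1 (\<rho> (\<tau> n)) k) \<longlonglongrightarrow> u1' k)"
    if \<rho>: "strict_mono \<rho>" for \<rho> :: "nat \<Rightarrow> nat"
  proof -
    have obs\<rho>: "(\<lambda>n. cand_obs K \<sigma> (G (\<rho> n), l (\<rho> n), c0 (\<rho> n), u0 (\<rho> n), c1 (\<rho> n), u1 (\<rho> n)) r)
        \<longlonglongrightarrow> cand_obs K \<sigma> (G', l', c0', u0', c1', u1') r" for r
      using LIMSEQ_subseq_LIMSEQ[OF obs[of r] \<rho>] by (simp add: comp_def)
    obtain \<tau> where "strict_mono \<tau>" "weak_conv_m ((\<lambda>n. G (\<rho> n)) \<circ> \<tau>) G'"
      "\<And>k. k \<in> {1..K} \<Longrightarrow> (\<lambda>n. l (\<rho> (\<tau> n)) k) \<longlonglongrightarrow> l' k"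
      "\<And>k. inj_on u1' {1..K} \<Longrightarrow> k \<in> {1..K} \<Longrightarrow> (\<lambda>n. u1 (\<rho> (\<tau> n)) k) \<longlonglongrightarrow> u1' k"
      using cand_subseq_convergent[OF s K cand G' sG' D' mG' l' sl' ml' c0' c1' u0' obs\<rho>] by blast
    then show ?thesis by (auto simp: comp_def)
  qed
  show "(\<lambda>n. L1_dist_on UNIV (gauss_conv \<sigma> (G n)) (gauss_conv \<sigma> G')) \<longlonglongrightarrow> 0"
  proof (rule tendsto_subsubseqI)
    fix \<rho> :: "nat \<Rightarrow> nat" assume "strict_mono \<rho>"
    then obtain \<tau> where \<tau>: "strict_mono \<tau>" "weak_conv_m (\<lambda>n. G (\<rho> (\<tau> n))) G'" using sub by blast
    show "\<exists>\<tau>. strict_mono \<tau> \<and> (\<lambda>n. L1_dist_on UNIV (gauss_conv \<sigma> (G (\<rho> (\<tau> n)))) (gauss_conv \<sigma> G')) \<longlonglongrightarrow> 0"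
      using L1_dist_gauss_conv_tendsto[OF s G G' \<tau>(2) ae] \<tau>(1) by blast
  qed
  show "(\<lambda>n. l n k) \<longlonglongrightarrow> l' k" if "k \<in> {1..K}" for k
    by (rule tendsto_subsubseqI) (use sub that in blast)
  show "(\<lambda>n. u1 n k) \<longlonglongrightarrow> u1' k" if "inj_on u1' {1..K}" "k \<in> {1..K}" for k
    by (rule tendsto_subsubseqI) (use sub that in blast)
qed

section \<open>Selection of a candidate\<close>

text \<open>The parameters need no topology of their own: their images under \<open>v\<close> lie in
  the space of real sequences, which has a countable basis. One parameter for each basic open set
  suffices, since control of the first n coordinates describes a product neighbourhood.\<close>

lemma countable_dense_family:
  fixes v :: "'p \<Rightarrow> nat \<Rightarrow> real"
  shows "\<exists>c :: nat \<Rightarrow> 'p. \<forall>\<theta>\<in>\<Theta>. \<forall>n e. 0 < e \<longrightarrow> (\<exists>i. c i \<in> \<Theta> \<and> (\<forall>r<n. \<bar>v (c i) r - v \<theta> r\<bar> \<le> e))"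
proof (cases "\<Theta> = {}")
  case False
  obtain B :: "(nat \<Rightarrow> real) set set" where B: "countable B" "topological_basis B"
    using ex_countable_basis by blast
  \<comment> \<open>For a basic set that meets no image the choice is arbitrary, which is why the
    claim keeps \<open>c i \<in> \<Theta>\<close>.\<close>
  define pick where "pick b = (SOME \<theta>. \<theta> \<in> \<Theta> \<and> v \<theta> \<in> b)" for b
  define c where "c i = pick (from_nat_into B i)" for i
  have "\<exists>i. c i \<in> \<Theta> \<and> (\<forall>r<n. \<bar>v (c i) r - v \<theta> r\<bar> \<le> e)" if "\<theta> \<in> \<Theta>" "0 < e" for \<theta> n e
  proof -
    define U where "U = (\<Inter>r\<in>{..<n}. {w :: nat \<Rightarrow> real. \<bar>w r - v \<theta> r\<bar> < e})"
    have "open {w :: nat \<Rightarrow> real. \<bar>w r - v \<theta> r\<bar> < e}" for r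
      by (intro open_Collect_less continuous_intros continuous_on_product_coordinates)
    then have "open U" unfolding U_def by (intro open_INT) auto
    moreover have "v \<theta> \<in> U" using that by (auto simp: U_def)
    ultimately obtain b where b: "b \<in> B" "v \<theta> \<in> b" "b \<subseteq> U"
      using topological_basisE[OF B(2)] by blast
    have p: "pick b \<in> \<Theta> \<and> v (pick b) \<in> b"
      unfolding pick_def by (rule someI_ex) (use that b in auto)
    obtain i where "from_nat_into B i = b" using from_nat_into_surj[OF B(1) b(1)] by blast
    then have "c i \<in> \<Theta> \<and> v (c i) \<in> U" using p b(3) by (auto simp: c_def)
    then show ?thesis by (intro exI[of _ i]) (auto simp: U_def less_imp_le)
  qed
  then show ?thesis by blast
qed auto

text \<open>
  Choosing the lowest level that matches the data keeps the selected candidates in one fixed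
  (compact) level, without any knowledge of the level of the truth.
\<close>

lemma minimal_level_selection:
  fixes v :: "'p \<Rightarrow> nat \<Rightarrow> real" and \<Theta> :: "nat \<Rightarrow> 'p set"
  obtains c :: "nat \<times> nat \<Rightarrow> 'p" and sel :: "nat \<Rightarrow> real \<Rightarrow> (nat \<Rightarrow> real) \<Rightarrow> nat \<times> nat"
  where "\<And>n e w (M :: 'a measure). (\<And>r. (\<lambda>\<omega>. w \<omega> r) \<in> borel_measurable M) \<Longrightarrow>
      (\<lambda>\<omega>. sel n e (w \<omega>)) \<in> measurable M (count_space UNIV)"
    "\<And>n e w \<theta> j. 0 < e \<Longrightarrow> \<theta> \<in> \<Theta> j \<Longrightarrow> (\<And>r. r < n \<Longrightarrow> \<bar>w r - v \<theta> r\<bar> \<le> e) \<Longrightarrow> \<exists>j'\<le>j. c (sel n e w) \<in> \<Theta> j'"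
    "\<And>n e w \<theta> j r. 0 < e \<Longrightarrow> \<theta> \<in> \<Theta> j \<Longrightarrow> (\<And>r. r < n \<Longrightarrow> \<bar>w r - v \<theta> r\<bar> \<le> e) \<Longrightarrow>
      r < n \<Longrightarrow> \<bar>w r - v (c (sel n e w)) r\<bar> \<le> 2 * e"
proof -
  have "\<forall>j. \<exists>c :: nat \<Rightarrow> 'p. \<forall>\<theta>\<in>\<Theta> j. \<forall>n e. 0 < e \<longrightarrow> (\<exists>i. c i \<in> \<Theta> j \<and> (\<forall>r<n. \<bar>v (c i) r - v \<theta> r\<bar> \<le> e))"
    using countable_dense_family by blast
  from choice[OF this] obtain C :: "nat \<Rightarrow> nat \<Rightarrow> 'p" where "\<forall>j. \<forall>\<theta>\<in>\<Theta> j. \<forall>n e. 0 < e \<longrightarrow> (\<exists>i. C j i \<in> \<Theta> j \<and> (\<forall>r<n. \<bar>v (C j i) r - v \<theta> r\<bar> \<le> e))"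
    ..
  then have C: "\<And>j \<theta> n e. \<theta> \<in> \<Theta> j \<Longrightarrow> 0 < e \<Longrightarrow> \<exists>i. C j i \<in> \<Theta> j \<and> (\<forall>r<n. \<bar>v (C j i) r - v \<theta> r\<bar> \<le> e)"
    by blast
  \<comment> \<open>Of \<open>2 * e\<close>, one half is for the error of the data and one for
    replacing the truth by a member of the countable family.\<close>
  define ok where "ok n e w j i \<longleftrightarrow> C j i \<in> \<Theta> j \<and> (\<forall>r<n. \<bar>w r - v (C j i) r\<bar> \<le> 2 * e)" for n e w j i
  \<comment> \<open>If nothing matches, \<open>LEAST\<close> is an unspecified but fixed number, so
    the selection is total and measurable for all data.\<close>
  define J where "J n e w = (LEAST j. \<exists>i. ok n e w j i)" for n e w
  define sel where "sel n e w = (J n e w, LEAST i. ok n e w (J n e w) i)" for n e w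
  have *: "ok n e w (fst (sel n e w)) (snd (sel n e w)) \<and> fst (sel n e w) \<le> j"
    if e: "0 < e" and \<theta>: "\<theta> \<in> \<Theta> j" and w: "\<And>r. r < n \<Longrightarrow> \<bar>w r - v \<theta> r\<bar> \<le> e" for n e w \<theta> j
  proof -
    obtain i where i: "C j i \<in> \<Theta> j" "\<forall>r<n. \<bar>v (C j i) r - v \<theta> r\<bar> \<le> e"
      using C[OF \<theta> e] by blast
    have "\<bar>w r - v (C j i) r\<bar> \<le> 2 * e" if r: "r < n" for r
      using i(2) w[OF r] r by force
    then have ex: "\<exists>i. ok n e w j i" using i unfolding ok_def by blast
    then have "\<exists>i. ok n e w (J n e w) i" unfolding J_def by (rule LeastI)
    then have "ok n e w (J n e w) (LEAST i. ok n e w (J n e w) i)" by (rule LeastI_ex)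
    moreover have "J n e w \<le> j" unfolding J_def using ex by (rule Least_le)
    ultimately show ?thesis by (simp add: sel_def)
  qed
  show thesis
  proof (rule that[of sel "\<lambda>(j, i). C j i"])
    fix n e and w :: "'a \<Rightarrow> nat \<Rightarrow> real" and M :: "'a measure"
    assume w [measurable]: "\<And>r. (\<lambda>\<omega>. w \<omega> r) \<in> borel_measurable M"
    have ok: "Measurable.pred M (\<lambda>\<omega>. ok n e (w \<omega>) j i)" for j i
      unfolding ok_def by measurable
    have J: "(\<lambda>\<omega>. J n e (w \<omega>)) \<in> measurable M (count_space UNIV)"
      unfolding J_def by (intro measurable_Least pred_intros_countable ok)
    have "(\<lambda>\<omega>. (j, LEAST i. ok n e (w \<omega>) j i)) \<in> measurable M (count_space UNIV)" for j
      by (rule measurable_compose[OF measurable_Least[OF ok], of "Pair j"]) simp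
    from measurable_compose_countable[OF this J]
    show "(\<lambda>\<omega>. sel n e (w \<omega>)) \<in> measurable M (count_space UNIV)"
      unfolding sel_def .
  next
    fix n e w \<theta> j assume "0 < e" "\<theta> \<in> \<Theta> j" "\<And>r. r < n \<Longrightarrow> \<bar>w r - v \<theta> r\<bar> \<le> e"
    from *[OF this] show "\<exists>j'\<le>j. (case sel n e w of (j, i) \<Rightarrow> C j i) \<in> \<Theta> j'"
      by (auto simp: ok_def case_prod_unfold)
  next
    fix n e w \<theta> j r assume "0 < e" "\<theta> \<in> \<Theta> j" "\<And>r. r < n \<Longrightarrow> \<bar>w r - v \<theta> r\<bar> \<le> e" and r: "r < n"
    from *[OF this(1-3)] r show "\<bar>w r - v (case sel n e w of (j, i) \<Rightarrow> C j i) r\<bar> \<le> 2 * e"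
      by (auto simp: ok_def case_prod_unfold)
  qed
qed

section \<open>The histogram\<close>

text \<open>For N of order n^(1/16) a cell has area of order N^(-2), and the Hoeffding exponent is
  of order n N^(-4) tol^2, that is n^(3/4) / (ln n)^2. This beats the N n cells of the union bound.
  \<open>Suc\<close> excludes N = 0.\<close>

definition nbins :: "nat \<Rightarrow> nat" where
  "nbins n = Suc (nat \<lfloor>real n powr (1/16)\<rfloor>)"

text \<open>The shift by 3 keeps the logarithm positive from n = 0 on.\<close>

definition tol :: "nat \<Rightarrow> real" where
  "tol n = 1 / ln (real n + 3)"

text \<open>In x the cells form a grid, while in y a cell starts at the query point \<open>q\<close>
  itself. Cells may overlap, as each one serves only its own estimate.\<close>

definition cell :: "real \<Rightarrow> real \<Rightarrow> nat \<Rightarrow> nat \<Rightarrow> real \<Rightarrow> (real \<times> real) set" where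
  "cell a b N j q = {a + real j * ((b - a) / real N)..a + real (Suc j) * ((b - a) / real N)} \<times> {q..q + 1 / real N}"

definition histogram :: "real \<Rightarrow> real \<Rightarrow> nat \<Rightarrow> (nat \<Rightarrow> real \<times> real) \<Rightarrow> nat \<Rightarrow> real \<Rightarrow> real" where
  "histogram a b n D j q = (\<Sum>i<n. indicat_real (cell a b (nbins n) j q) (D i)) / (real n * ((b - a) / (real (nbins n))\<^sup>2))"

text \<open>On [a, b] the minimum acts at x = b, which it puts into the last bin.\<close>

definition bin_index :: "real \<Rightarrow> real \<Rightarrow> nat \<Rightarrow> real \<Rightarrow> nat" where
  "bin_index a b N x = min (N - 1) (nat \<lfloor>(x - a) / ((b - a) / real N)\<rfloor>)"

section \<open>Geometry of the cells and the bias\<close>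

lemma tol_pos: "0 < tol n"
  by (simp add: tol_def)

lemma tol_tendsto: "tol \<longlonglongrightarrow> 0"
  unfolding tol_def by real_asymp

lemma nbins_bounds: "real n powr (1/16) \<le> real (nbins n)" "real (nbins n) \<le> real n powr (1/16) + 1" "0 < nbins n"
  unfolding nbins_def by (auto simp: of_nat_nat) linarith+

lemma bin_index_less: "0 < N \<Longrightarrow> bin_index a b N x < N"
  unfolding bin_index_def by simp

lemma bin_index_bounds:
  assumes ab: "a < b" and N: "0 < N" and x: "x \<in> {a..b}"
  shows "x \<in> {a + real (bin_index a b N x) * ((b - a) / real N)..a + real (Suc (bin_index a b N x)) * ((b - a) / real N)}"
proof -
  define h where "h = (b - a) / real N"
  have h: "0 < h" using ab N by (simp add: h_def)
  define f where "f = nat \<lfloor>(x - a) / h\<rfloor>"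
  have "0 \<le> (x - a) / h" using x h by simp
  then have f: "real f \<le> (x - a) / h" "(x - a) / h < real f + 1" unfolding f_def by linarith+
  have f': "real f * h \<le> x - a" "x - a < (real f + 1) * h"
    using f h by (auto simp: field_simps)
  have bf: "bin_index a b N x = min (N - 1) f" by (simp add: bin_index_def f_def h_def)
  have top: "a + real N * h = b" using N by (simp add: h_def)
  show ?thesis
  proof (cases "f \<le> N - 1")
    case True
    then show ?thesis using f' by (simp add: bf flip: h_def) (simp add: algebra_simps)
  next
    case False
    then have "real (N - 1) * h \<le> real f * h" using h by (intro mult_right_mono) auto
    moreover have "real (Suc (N - 1)) = real N" using N by simp
    ultimately show ?thesis using False f' x top by (simp add: bf min_def flip: h_def)
  qed
qed

lemma cell_eq_cbox:
  "cell a b N j q = cbox (a + real j * ((b - a) / real N), q) (a + real (Suc j) * ((b - a) / real N), q + 1 / real N)"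
  by (simp add: cell_def cbox_Pair_eq)

lemma sets_cell [measurable]: "cell a b N j q \<in> sets borel"
  by (simp add: cell_eq_cbox)

lemma measure_cell: "a < b \<Longrightarrow> 0 < N \<Longrightarrow> measure lborel (cell a b N j q) = (b - a) / (real N)\<^sup>2"
  unfolding cell_eq_cbox by (subst content_Pair) (simp add: field_simps power2_eq_square)

lemma cell_subset:
  assumes "a < b" "j < N" 
  shows "cell a b N j q \<subseteq> {a..b} \<times> UNIV"
proof -
  have "real (Suc j) * ((b - a) / real N) \<le> real N * ((b - a) / real N)"
    using assms by (intro mult_right_mono) auto
  then have "a + real (Suc j) * ((b - a) / real N) \<le> b" using assms by simp
  moreover have "0 \<le> real j * ((b - a) / real N)" using assms by simp
  ultimately show ?thesis unfolding cell_def by auto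
qed

lemma cell_dist:
  assumes "a < b" "0 < N" "z \<in> cell a b N j q"
    "x \<in> {a + real j * ((b - a) / real N)..a + real (Suc j) * ((b - a) / real N)}"
  shows "dist z (x, q) \<le> (b - a + 1) / real N"
proof -
  obtain x' y' where z: "z = (x', y')" by (cases z)
  define h where "h = (b - a) / real N"
  have "\<bar>x' - x\<bar> \<le> h" "\<bar>y' - q\<bar> \<le> 1 / real N"
    using assms(3,4) unfolding z cell_def h_def[symmetric] by (auto simp: algebra_simps)
  then have "dist x' x + dist y' q \<le> (b - a + 1) / real N"
    by (simp add: dist_real_def add_divide_distrib h_def)
  moreover have "dist z (x, q) \<le> dist x' x + dist y' q"
    unfolding z dist_Pair_Pair by (rule sqrt_sum_squares_le_sum) auto
  ultimately show ?thesis by linarith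
qed

lemma holder_continuous_on_imp_continuous_on:
  assumes "holder_continuous_on \<beta> S g" "0 < \<beta>"
  shows "continuous_on S g"
proof -
  obtain C where C: "\<And>z w. z \<in> S \<Longrightarrow> w \<in> S \<Longrightarrow> \<bar>g z - g w\<bar> \<le> C * dist z w powr \<beta>"
    using assms(1) unfolding holder_continuous_on_def by auto
  show ?thesis
    unfolding continuous_on_def
  proof
    fix x assume x: "x \<in> S"
    have "((\<lambda>z. dist z x) \<longlongrightarrow> dist x x) (at x within S)" by (intro tendsto_intros)
    then have d: "((\<lambda>z. dist z x) \<longlongrightarrow> 0) (at x within S)" by simp
    have "((\<lambda>z. C * dist z x powr \<beta>) \<longlongrightarrow> C * 0) (at x within S)"
      by (intro tendsto_mult tendsto_const tendsto_zero_powrI[OF d tendsto_const] assms(2)) simp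
    then have "((\<lambda>z. C * dist z x powr \<beta>) \<longlongrightarrow> 0) (at x within S)" by simp
    moreover have "\<forall>\<^sub>F z in at x within S. norm (g z - g x) \<le> C * dist z x powr \<beta>"
      unfolding eventually_at_filter using C x by (intro always_eventually) auto
    ultimately have "((\<lambda>z. g z - g x) \<longlongrightarrow> 0) (at x within S)"
      by (rule Lim_null_comparison[rotated])
    then show "(g \<longlongrightarrow> g x) (at x within S)" by (rule LIM_zero_cancel)
  qed
qed

text \<open>The probability of a cell is its area times the mean of \<open>p\<close> on it, so the
  error is governed by the oscillation of \<open>p\<close> there. As x may be any point of the bin,
  the bound is uniform over the bin.\<close>

lemma measure_cell_bias:
  fixes p :: "real \<times> real \<Rightarrow> real"
  assumes ab: "a < b" and N: "j < N"
    and p0: "\<And>z. z \<in> {a..b} \<times> UNIV \<Longrightarrow> 0 \<le> p z" and pc: "continuous_on ({a..b} \<times> UNIV) p"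
    and P: "P = density lborel (\<lambda>z. ennreal (indicator ({a..b} \<times> UNIV) z * p z))"
    and C: "\<And>z w. z \<in> {a..b} \<times> UNIV \<Longrightarrow> w \<in> {a..b} \<times> UNIV \<Longrightarrow> \<bar>p z - p w\<bar> \<le> C * dist z w powr \<beta>"
    and C0: "0 \<le> C" and b0: "0 < \<beta>"
    and x: "x \<in> {a + real j * ((b - a) / real N)..a + real (Suc j) * ((b - a) / real N)}"
  shows "\<bar>measure P (cell a b N j q) - (b - a) / (real N)\<^sup>2 * p (x, q)\<bar>
    \<le> (b - a) / (real N)\<^sup>2 * (C * ((b - a + 1) / real N) powr \<beta>)"
proof -
  let ?S = "{a..b} \<times> (UNIV :: real set)" and ?c = "cell a b N j q"
  let ?V = "(b - a) / (real N)\<^sup>2" and ?B = "C * ((b - a + 1) / real N) powr \<beta>"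
  have N0: "0 < N" using N by simp
  have cS: "?c \<subseteq> ?S" by (rule cell_subset[OF ab N])
  have cS': "closed ?S" by (intro closed_Times) auto
  have m: "(\<lambda>z. indicator ?S z * p z) \<in> borel_measurable borel"
    using borel_measurable_continuous_on_indicator[OF _ pc] cS' by (auto simp: borel_closed)
  have comp: "compact ?c" by (simp add: cell_eq_cbox)
  have i: "integrable lborel (\<lambda>z. indicator ?c z * p z)"
    using borel_integrable_compact[OF comp continuous_on_subset[OF pc cS]] by simp
  have vol: "measure lborel ?c = ?V" by (rule measure_cell[OF ab N0])
  have fin: "emeasure lborel ?c < \<infinity>" unfolding cell_eq_cbox by (rule emeasure_lborel_cbox_finite)
  have "emeasure P ?c = (\<integral>\<^sup>+z. ennreal (indicator ?S z * p z) * indicator ?c z \<partial>lborel)"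
    unfolding P using m by (subst emeasure_density) auto
  also have "\<dots> = (\<integral>\<^sup>+z. ennreal (indicator ?c z * p z) \<partial>lborel)"
    using cS by (intro nn_integral_cong) (auto simp: indicator_def)
  also have "\<dots> = ennreal (LINT z|lborel. indicator ?c z * p z)"
  proof (rule nn_integral_eq_integral[OF i], rule AE_I2)
    show "0 \<le> indicator ?c z * p z" for z using p0[of z] cS by (auto simp: indicator_def)
  qed
  finally have mP: "measure P ?c = (LINT z|lborel. indicator ?c z * p z)"
    using p0 cS by (subst measure_eq_emeasure_eq_ennreal[of "LINT z|lborel. indicator ?c z * p z"])
      (auto intro!: Bochner_Integration.integral_nonneg simp: indicator_def)
  have "(x, q) \<in> ?c" using x N0 unfolding cell_def by simp
  then have xS: "(x, q) \<in> ?S" using cS by blast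
  have dev: "\<bar>p z - p (x, q)\<bar> \<le> ?B" if z: "z \<in> ?c" for z
  proof -
    have "\<bar>p z - p (x, q)\<bar> \<le> C * dist z (x, q) powr \<beta>" using C z cS xS by blast
    also have "\<dots> \<le> ?B"
      using cell_dist[OF ab N0 z x] C0 b0 by (intro mult_left_mono powr_mono2) auto
    finally show ?thesis .
  qed
  have ic: "integrable lborel (\<lambda>z. indicat_real ?c z * d)" for d
    using fin by (intro integrable_mult_left integrable_real_indicator) auto
  have val: "(LINT z|lborel. indicat_real ?c z * d) = ?V * d" for d
    using vol fin by simp
  have "(LINT z|lborel. indicator ?c z * p z) \<le> (LINT z|lborel. indicat_real ?c z * (p (x, q) + ?B))"
    using dev by (intro integral_mono i ic) (fastforce simp: indicator_def abs_le_iff)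
  moreover have "(LINT z|lborel. indicat_real ?c z * (p (x, q) - ?B)) \<le> (LINT z|lborel. indicator ?c z * p z)"
    using dev by (intro integral_mono i ic) (fastforce simp: indicator_def abs_le_iff)
  ultimately show ?thesis
    unfolding mP val abs_le_iff by (simp add: algebra_simps)
qed

text \<open>The infinite product carries the samples of all sizes on one space, as Borel--Cantelli
  requires; its coordinates are independent with law \<open>P\<close>.\<close>

lemma hoeffding_frequency:
  fixes P :: "'a measure"
  assumes P: "prob_space P" and A: "A \<in> sets P" and n: "0 < n" and t: "0 \<le> t"
  shows "measure (\<Pi>\<^sub>M i\<in>(UNIV :: nat set). P)
      {\<omega> \<in> space (\<Pi>\<^sub>M i\<in>(UNIV :: nat set). P). t \<le> \<bar>(\<Sum>i<n. indicat_real A (\<omega> i)) - real n * measure P A\<bar>}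
    \<le> 2 * exp (- 2 * t\<^sup>2 / real n)"
proof -
  let ?M = "\<Pi>\<^sub>M i\<in>(UNIV :: nat set). P"
  interpret P: prob_space P by (rule P)
  interpret M: prob_space ?M by (rule prob_space_PiM) (rule P)
  interpret PP: product_prob_space "\<lambda>_ :: nat. P" UNIV ..
  let ?X = "\<lambda>i \<omega>. indicat_real A (\<omega> i)"
  have dc: "distr ?M P (\<lambda>\<omega>. \<omega> i) = P" for i
    using distr_PiM_component[of UNIV "\<lambda>_. P" i] P by simp
  have indep: "M.indep_vars (\<lambda>_. P) (\<lambda>i \<omega>. \<omega> i) {..<n}"
  proof (subst M.indep_vars_iff_distr_eq_PiM')
    show "distr ?M (\<Pi>\<^sub>M i\<in>{..<n}. P) (\<lambda>x. \<lambda>i\<in>{..<n}. x i) = (\<Pi>\<^sub>M i\<in>{..<n}. distr ?M P (\<lambda>\<omega>. \<omega> i))"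
      using PP.distr_PiM_restrict_finite[of "{..<n}"] by (simp add: dc)
  qed (use n in \<open>auto intro: measurable_component_singleton\<close>)
  have indepX: "M.indep_vars (\<lambda>_. borel) ?X {..<n}"
    by (rule M.indep_vars_compose2[OF indep]) (use A in auto)
  have E: "M.expectation (?X i) = measure P A" for i
  proof -
    have "M.expectation (?X i) = integral\<^sup>L (distr ?M P (\<lambda>\<omega>. \<omega> i)) (indicat_real A)"
      using A by (subst integral_distr) (auto intro: measurable_component_singleton)
    then show ?thesis using A sets.sets_into_space[OF A] by (simp add: dc Int_absorb2)
  qed
  interpret H: Hoeffding_ineq ?M "{..<n}" ?X "\<lambda>_. 0" "\<lambda>_. 1" "\<Sum>i\<in>{..<n}. M.expectation (?X i)"
    by unfold_locales (use indepX in \<open>auto simp: indicator_def\<close>)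
  show ?thesis
    using H.Hoeffding_ineq_abs_ge[OF t] n by (simp add: E)
qed

lemma deviation_summable:
  assumes d: "0 < d"
  shows "summable (\<lambda>n. real (nbins n) * (real n * (2 * exp (- real n * (d / (real (nbins n))\<^sup>2 * tol n)\<^sup>2 / 2))))"
proof (rule summable_comparison_test_ev)
  show "summable (\<lambda>n. inverse (real n ^ 2))" by (rule inverse_power_summable) simp
  \<comment> \<open>The summand increases with the number of bins, so the floor in
    \<open>nbins\<close> is avoided by passing to an upper bound.\<close>
  let ?w = "\<lambda>n. real n powr (1/16) + 1"
  have asym: "\<forall>\<^sub>F n :: nat in sequentially. ?w n * (real n * (2 * exp (- real n * (d / (?w n)\<^sup>2 * (1 / ln (real n + 3)))\<^sup>2 / 2))) \<le> inverse (real n ^ 2)"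
    using d by real_asymp
  show "\<forall>\<^sub>F n in sequentially. norm (real (nbins n) * (real n * (2 * exp (- real n * (d / (real (nbins n))\<^sup>2 * tol n)\<^sup>2 / 2)))) \<le> inverse (real n ^ 2)"
    using asym
  proof eventually_elim
    case (elim n)
    have "d / (?w n)\<^sup>2 * tol n \<le> d / (real (nbins n))\<^sup>2 * tol n"
      using nbins_bounds[of n] d tol_pos[of n]
      by (intro mult_right_mono divide_left_mono power_mono mult_pos_pos) auto
    moreover have "0 \<le> d / (?w n)\<^sup>2 * tol n" using d tol_pos[of n] by simp
    ultimately have "(d / (?w n)\<^sup>2 * tol n)\<^sup>2 \<le> (d / (real (nbins n))\<^sup>2 * tol n)\<^sup>2" by (rule power_mono)
    then have "exp (- real n * (d / (real (nbins n))\<^sup>2 * tol n)\<^sup>2 / 2) \<le> exp (- real n * (d / (?w n)\<^sup>2 * tol n)\<^sup>2 / 2)"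
      by (simp add: mult_left_mono)
    then have le: "real (nbins n) * (real n * (2 * exp (- real n * (d / (real (nbins n))\<^sup>2 * tol n)\<^sup>2 / 2)))
        \<le> ?w n * (real n * (2 * exp (- real n * (d / (?w n)\<^sup>2 * tol n)\<^sup>2 / 2)))"
      using nbins_bounds(2)[of n] by (intro mult_mono) auto
    have "0 \<le> real (nbins n) * (real n * (2 * exp (- real n * (d / (real (nbins n))\<^sup>2 * tol n)\<^sup>2 / 2)))" by simp
    with order_trans[OF le elim[folded tol_def]] show ?case by (simp only: real_norm_def abs_of_nonneg)
  qed
qed

lemma bias_eventually:
  assumes "0 < C" "0 < \<beta>" "0 < d"
  shows "\<forall>\<^sub>F n in sequentially. C * (d / real (nbins n)) powr \<beta> \<le> tol n / 2"
proof -
  have "\<forall>\<^sub>F n :: nat in sequentially. C * (d / (real n powr (1/16))) powr \<beta> \<le> 1 / ln (real n + 3) / 2"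
    using assms by real_asymp
  then show ?thesis
    \<comment> \<open>The bias decreases in the number of bins, so a lower bound for
      \<open>nbins\<close> enters. At n = 0 that bound is 0 and division by it would give 0.\<close>
    using eventually_gt_at_top[of 0]
  proof eventually_elim
    case (elim n)
    have "C * (d / real (nbins n)) powr \<beta> \<le> C * (d / (real n powr (1/16))) powr \<beta>"
      using assms nbins_bounds[of n] elim by (intro mult_left_mono powr_mono2 divide_left_mono) auto
    then show ?case using elim by (simp add: tol_def)
  qed
qed

text \<open>
  The tolerance \<^const>\<open>tol\<close> decays more slowly than every power of the bin width, so that it
  eventually exceeds the bias for all Hoelder constants and exponents.
\<close>

lemma histogram_consistent:
  fixes p :: "real \<times> real \<Rightarrow> real"
  assumes ab: "a < b"
    and p0: "\<And>z. z \<in> {a..b} \<times> UNIV \<Longrightarrow> 0 \<le> p z"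
    and hp: "holder_continuous_on \<beta> ({a..b} \<times> UNIV) p" and b0: "0 < \<beta>"
    and P: "P = density lborel (\<lambda>z. ennreal (indicator ({a..b} \<times> UNIV) z * p z))" and prob: "prob_space P"
  shows "AE \<omega> in (\<Pi>\<^sub>M i\<in>(UNIV :: nat set). P). \<forall>\<^sub>F n in sequentially.
    \<forall>x\<in>{a..b}. \<forall>r<n. \<bar>histogram a b n \<omega> (bin_index a b (nbins n) x) (rat_point r) - p (x, rat_point r)\<bar> \<le> tol n"
proof -
  let ?M = "\<Pi>\<^sub>M i\<in>(UNIV :: nat set). P"
  interpret M: prob_space ?M by (rule prob_space_PiM) (rule prob)
  have pc: "continuous_on ({a..b} \<times> UNIV) p"
    by (rule holder_continuous_on_imp_continuous_on[OF hp b0])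
  obtain C' where C': "\<And>z w. z \<in> {a..b} \<times> UNIV \<Longrightarrow> w \<in> {a..b} \<times> UNIV \<Longrightarrow> \<bar>p z - p w\<bar> \<le> C' * dist z w powr \<beta>"
    using hp unfolding holder_continuous_on_def by blast
  \<comment> \<open>The Hoelder condition fixes no sign for its constant; the bias estimates ask for
    a positive one.\<close>
  define C where "C = max C' 1"
  have C: "\<bar>p z - p w\<bar> \<le> C * dist z w powr \<beta>" if "z \<in> {a..b} \<times> UNIV" "w \<in> {a..b} \<times> UNIV" for z w
    using C'[OF that] mult_right_mono[of C' C "dist z w powr \<beta>"] unfolding C_def by simp
  have C0: "0 < C" by (simp add: C_def)
  let ?N = nbins
  define V where "V n = (b - a) / (real (?N n))\<^sup>2" for n
  have V: "0 < V n" for n using ab nbins_bounds(3)[of n] by (simp add: V_def)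
  have sP: "sets P = sets borel" by (simp add: P)
  \<comment> \<open>Half of the tolerance on the scale of counts; the other half is spent on the
    bias.\<close>
  define t where "t n = real n * (V n * tol n / 2)" for n
  define E where "E n j r = {\<omega> \<in> space ?M. t n \<le> \<bar>(\<Sum>i<n. indicat_real (cell a b (?N n) j (rat_point r)) (\<omega> i)) - real n * measure P (cell a b (?N n) j (rat_point r))\<bar>}" for n j r
  \<comment> \<open>All x fall into finitely many bins, so a finite union covers failure at any x,
    and the exceptional null set does not depend on x.\<close>
  define A where "A n = (\<Union>j\<in>{..<?N n}. \<Union>r\<in>{..<n}. E n j r)" for n
  have cP [measurable]: "cell a b N j q \<in> sets P" for N j q using sP by simp
  have E_sets [measurable]: "E n j r \<in> sets ?M" for n j r
    unfolding E_def by measurable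
  have A_sets: "A n \<in> sets ?M" for n unfolding A_def by auto
  have measE: "measure ?M (E n j r) \<le> 2 * exp (- real n * (V n * tol n)\<^sup>2 / 2)" if "0 < n" for n j r
  proof -
    have "0 \<le> t n" using V[of n] tol_pos[of n] by (simp add: t_def)
    from hoeffding_frequency[OF prob cP that this]
    have "measure ?M (E n j r) \<le> 2 * exp (- 2 * (t n)\<^sup>2 / real n)" unfolding E_def .
    also have "- 2 * (t n)\<^sup>2 / real n = - real n * (V n * tol n)\<^sup>2 / 2"
      using that by (simp add: t_def power2_eq_square field_simps)
    finally show ?thesis .
  qed
  have measA: "measure ?M (A n) \<le> real (?N n) * (real n * (2 * exp (- real n * (V n * tol n)\<^sup>2 / 2)))" for n
  proof -
    have "measure ?M (A n) \<le> (\<Sum>j<?N n. measure ?M (\<Union>r\<in>{..<n}. E n j r))"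
      unfolding A_def by (rule M.finite_measure_subadditive_finite) auto
    also have "\<dots> \<le> (\<Sum>j<?N n. \<Sum>r<n. measure ?M (E n j r))"
      by (intro sum_mono M.finite_measure_subadditive_finite) auto
    also have "\<dots> \<le> (\<Sum>j<?N n. \<Sum>r<n. 2 * exp (- real n * (V n * tol n)\<^sup>2 / 2))"
      by (intro sum_mono measE) auto
    finally show ?thesis by simp
  qed
  have "AE \<omega> in ?M. eventually (\<lambda>n. \<omega> \<in> space ?M - A n) sequentially"
  proof (rule borel_cantelli_AE1[OF A_sets])
    show "emeasure ?M (A n) < \<infinity>" for n by (simp add: M.emeasure_eq_measure)
    show "summable (\<lambda>n. measure ?M (A n))"
      by (rule summable_comparison_test'[OF deviation_summable[of "b - a"], of 0])
         (use measA ab in \<open>auto simp: V_def\<close>)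
  qed
  then show ?thesis
  proof eventually_elim
    case (elim \<omega>)
    have d: "0 < b - a + 1" using ab by simp
    from elim bias_eventually[OF C0 b0 d] eventually_gt_at_top[of 0]
    show ?case
    proof eventually_elim
      case (elim n)
      show ?case
      proof (intro ballI allI impI)
        fix x r assume x: "x \<in> {a..b}" and r: "r < n"
        let ?j = "bin_index a b (?N n) x" and ?q = "rat_point r"
        let ?c = "cell a b (?N n) ?j ?q"
        let ?s = "\<Sum>i<n. indicat_real ?c (\<omega> i)"
        have j: "?j < ?N n" using nbins_bounds(3)[of n] by (rule bin_index_less)
        have "\<omega> \<notin> E n ?j r" using elim j r unfolding A_def by auto
        then have dev: "\<bar>?s - real n * measure P ?c\<bar> < t n"
          using elim unfolding E_def by auto
        have bias: "\<bar>measure P ?c - V n * p (x, ?q)\<bar> \<le> V n * (C * ((b - a + 1) / real (?N n)) powr \<beta>)"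
          unfolding V_def
          by (rule measure_cell_bias[OF ab j p0 pc P C less_imp_le[OF C0] b0 bin_index_bounds[OF ab nbins_bounds(3) x]])
        also have "\<dots> \<le> V n * (tol n / 2)"
          using elim V[of n] by (intro mult_left_mono) auto
        finally have "real n * \<bar>measure P ?c - V n * p (x, ?q)\<bar> \<le> t n"
          using elim by (simp add: t_def)
        moreover have scale: "real n * \<bar>z\<bar> = \<bar>real n * z\<bar>" for z by (simp add: abs_mult)
        have "\<bar>?s - real n * V n * p (x, ?q)\<bar>
            \<le> \<bar>?s - real n * measure P ?c\<bar> + real n * \<bar>measure P ?c - V n * p (x, ?q)\<bar>"
          using abs_triangle_ineq[of "?s - real n * measure P ?c" "real n * (measure P ?c - V n * p (x, ?q))"]
          unfolding scale by (simp add: algebra_simps)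
        ultimately have "\<bar>?s - real n * V n * p (x, ?q)\<bar> \<le> real n * V n * tol n"
          using dev by (simp add: t_def)
        then have "\<bar>?s - real n * V n * p (x, ?q)\<bar> / (real n * V n) \<le> tol n"
          using elim V[of n] by (simp add: field_simps)
        moreover have "histogram a b n \<omega> ?j ?q - p (x, ?q) = (?s - real n * V n * p (x, ?q)) / (real n * V n)"
          using elim V[of n] nbins_bounds(3)[of n] ab by (simp add: histogram_def V_def diff_divide_distrib)
        ultimately show "\<bar>histogram a b n \<omega> ?j ?q - p (x, ?q)\<bar> \<le> tol n"
          using elim V[of n] by (simp add: abs_mult)
      qed
    qed
  qed
qed

section \<open>Parameters of the model\<close>

text \<open>A point outside the support has a null neighbourhood taken from a countable basis, so
  the complement is covered by countably many null sets.\<close>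

lemma AE_measure_supp:
  fixes G :: "real measure"
  assumes G: "sets G = sets borel"
  shows "AE t in G. t \<in> measure_supp G"
proof -
  obtain B :: "real set set" where B: "countable B" "topological_basis B"
    using ex_countable_basis by blast
  have op: "open b" if "b \<in> B" for b using topological_basis_open[OF B(2) that] .
  have "AE t in G. \<forall>b\<in>{b\<in>B. emeasure G b = 0}. t \<notin> b"
  proof (subst AE_ball_countable)
    show "countable {b\<in>B. emeasure G b = 0}" using B(1) by (rule countable_subset[rotated]) auto
    show "\<forall>b\<in>{b\<in>B. emeasure G b = 0}. AE t in G. t \<notin> b"
    proof
      fix b assume "b \<in> {b\<in>B. emeasure G b = 0}"
      then have "b \<in> null_sets G" using op G by (auto simp: null_sets_def)
      then show "AE t in G. t \<notin> b" by (rule AE_not_in)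
    qed
  qed
  then show ?thesis
  proof eventually_elim
    case (elim t)
    show ?case
      unfolding measure_supp_def
    proof (intro CollectI allI impI)
      fix U :: "real set" assume U: "open U" "t \<in> U"
      then obtain b where b: "b \<in> B" "t \<in> b" "b \<subseteq> U" using topological_basisE[OF B(2)] by blast
      then have "emeasure G b \<noteq> 0" using elim by auto
      moreover have "emeasure G b \<le> emeasure G U"
        using b U G by (intro emeasure_mono) auto
      ultimately show "0 < emeasure G U"
        by (metis less_le_trans zero_less_iff_neq_zero)
    qed
  qed
qed

text \<open>The left end is the least point of the support, which is nonempty because it carries all
  the mass. This turns the diameter condition into the interval form used by the levels.\<close>

lemma compactly_supported_prob_interval:
  assumes G: "compactly_supported_prob G"
  obtains s where "real_distribution G" "0 \<le> diameter (measure_supp G)"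
    "AE t in G. s \<le> t \<and> t \<le> s + diameter (measure_supp G)"
proof -
  let ?S = "measure_supp G"
  interpret prob_space G using G by (simp add: compactly_supported_prob_def)
  have sG: "sets G = sets borel" and cS: "compact ?S" using G by (auto simp: compactly_supported_prob_def)
  have ae: "AE t in G. t \<in> ?S" by (rule AE_measure_supp[OF sG])
  have ne: "?S \<noteq> {}"
  proof
    assume "?S = {}"
    then have "AE t in G. False" using ae by simp
    then show False by simp
  qed
  have bd: "bdd_below ?S" using bounded_imp_bdd_below[OF compact_imp_bounded[OF cS]] .
  have inf: "Inf ?S \<in> ?S" by (rule closed_contains_Inf[OF ne bd compact_imp_closed[OF cS]])
  have "Inf ?S \<le> t \<and> t \<le> Inf ?S + diameter ?S" if "t \<in> ?S" for t
  proof -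
    have "Inf ?S \<le> t" by (rule cInf_lower[OF that bd])
    moreover have "dist t (Inf ?S) \<le> diameter ?S"
      by (rule diameter_bounded_bound[OF compact_imp_bounded[OF cS] that inf])
    ultimately show ?thesis by (simp add: dist_real_def)
  qed
  then have "AE t in G. Inf ?S \<le> t \<and> t \<le> Inf ?S + diameter ?S"
    using ae by (auto elim!: eventually_mono)
  moreover have "real_distribution G" by unfold_locales (rule sG)
  moreover have "0 \<le> diameter ?S" by (rule diameter_ge_0[OF compact_imp_bounded[OF cS]])
  ultimately show thesis by (intro that)
qed

text \<open>The Gaussian is centred, so smoothing preserves the mean. This transfers the centring of
  the error density to the mixing measure.\<close>

lemma mean_gauss_conv:
  assumes G: "real_distribution G" and s: "0 < \<sigma>" and ae: "AE t in G. \<bar>t\<bar> \<le> B"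
  shows "(LINT y|lborel. y * gauss_conv \<sigma> G y) = (LINT t|G. t)"
proof -
  interpret real_distribution G by (rule G)
  interpret P: pair_sigma_finite G lborel ..
  have i1: "has_bochner_integral lborel (\<lambda>y. y * normal_density 0 \<sigma> (y - t)) t" for t
    using normal_moment_nz_1[OF s, of t] by (simp add: normal_density_diff mult.commute)
  \<comment> \<open>The first absolute moment of the centred Gaussian; it makes the integrand
    absolutely integrable for Fubini.\<close>
  let ?c = "\<sigma> * sqrt (2 / pi)"
  have abs_le: "(LINT y|lborel. norm (y * normal_density 0 \<sigma> (y - t))) \<le> ?c + \<bar>t\<bar>" for t
  proof -
    have "(LINT y|lborel. norm (y * normal_density 0 \<sigma> (y - t)))
        \<le> (LINT y|lborel. normal_density t \<sigma> y * \<bar>y - t\<bar> ^ 1 + \<bar>t\<bar> * normal_density t \<sigma> y)"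
    proof (rule integral_mono)
      show "integrable lborel (\<lambda>y. norm (y * normal_density 0 \<sigma> (y - t)))"
        using i1[of t] by (intro integrable_norm) (simp add: has_bochner_integral_iff)
      show "integrable lborel (\<lambda>y. normal_density t \<sigma> y * \<bar>y - t\<bar> ^ 1 + \<bar>t\<bar> * normal_density t \<sigma> y)"
        by (intro Bochner_Integration.integrable_add integrable_mult_right integrable_normal_moment_abs integrable_normal_density s)
      show "norm (y * normal_density 0 \<sigma> (y - t)) \<le> normal_density t \<sigma> y * \<bar>y - t\<bar> ^ 1 + \<bar>t\<bar> * normal_density t \<sigma> y" for y
      proof -
        have "\<bar>y\<bar> * normal_density t \<sigma> y \<le> (\<bar>y - t\<bar> + \<bar>t\<bar>) * normal_density t \<sigma> y"
          by (intro mult_right_mono) auto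
        then show ?thesis by (simp add: normal_density_diff abs_mult algebra_simps)
      qed
    qed
    also have "\<dots> = ?c + \<bar>t\<bar>"
      using integral_normal_moment_abs_odd[OF s, of t 0] integrable_normal_moment_abs[OF s, of t 1] s
      by (subst Bochner_Integration.integral_add) auto
    finally show ?thesis .
  qed
  have I: "integrable (G \<Otimes>\<^sub>M lborel) (\<lambda>(t, y). y * normal_density 0 \<sigma> (y - t))"
  proof (rule P.Fubini_integrable)
    have [measurable]: "(\<lambda>t. LINT y|lborel. norm (y * normal_density 0 \<sigma> (y - t))) \<in> borel_measurable G"
      by measurable
    show "integrable G (\<lambda>t. LINT y|lborel. norm (case (t, y) of (t, y) \<Rightarrow> y * normal_density 0 \<sigma> (y - t)))"
      unfolding prod.case
    proof (rule integrable_const_bound[where B = "?c + B"])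
      show "AE t in G. norm (LINT y|lborel. norm (y * normal_density 0 \<sigma> (y - t))) \<le> ?c + B"
        using ae
      proof eventually_elim
        case (elim t)
        have "0 \<le> (LINT y|lborel. norm (y * normal_density 0 \<sigma> (y - t)))"
          by (rule Bochner_Integration.integral_nonneg) simp
        then show ?case using abs_le[of t] elim by simp
      qed
    qed measurable
    show "AE t in G. integrable lborel (\<lambda>y. case (t, y) of (t, y) \<Rightarrow> y * normal_density 0 \<sigma> (y - t))"
      using i1 by (simp add: has_bochner_integral_iff)
  qed measurable
  have "(LINT y|lborel. y * gauss_conv \<sigma> G y) = (LINT y|lborel. LINT t|G. y * normal_density 0 \<sigma> (y - t))"
    by (simp add: gauss_conv_def)
  also have "\<dots> = (LINT t|G. LINT y|lborel. y * normal_density 0 \<sigma> (y - t))"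
    using P.Fubini_integral[OF I] by simp
  also have "\<dots> = (LINT t|G. t)"
    using i1 by (simp add: has_bochner_integral_iff)
  finally show ?thesis .
qed

lemma joint_eq_mix_density:
  "joint K (pX, gauss_conv \<sigma> G, lam, m) (x, y) = mix_density K \<sigma> G lam (pX x) (\<lambda>k. m k x) y"
  by (simp add: joint_def mix_density_def)

text \<open>Each vertical section is \<open>pX x\<close> times a smoothed probability measure, so
  integrating over y first leaves \<open>pX\<close>. Continuity on the strip provides measurability
  in the plane.\<close>

lemma prob_space_joint_measure:
  assumes G: "real_distribution G" and s: "0 < \<sigma>"
    and pX: "density_on {a..b} pX"
    and lam: "\<And>k. k \<in> {1..K} \<Longrightarrow> 0 \<le> lam k" and sl: "(\<Sum>k=1..K. lam k) = 1"
    and cont: "continuous_on ({a..b} \<times> UNIV) (joint K (pX, gauss_conv \<sigma> G, lam, m))"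
  shows "prob_space (joint_measure a b K (pX, gauss_conv \<sigma> G, lam, m))"
proof
  let ?J = "joint K (pX, gauss_conv \<sigma> G, lam, m)" and ?S = "{a..b} \<times> (UNIV :: real set)"
  have "closed ?S" by (intro closed_Times) auto
  then have m [measurable]: "(\<lambda>z. indicator ?S z * ?J z) \<in> borel_measurable borel"
    using borel_measurable_continuous_on_indicator[OF _ cont] by (auto simp: borel_closed)
  have pX0: "0 \<le> pX x" if "x \<in> {a..b}" for x using pX that by (auto simp: density_on_def)
  have inner: "(\<integral>\<^sup>+y. ennreal (indicator ?S (x, y) * ?J (x, y)) \<partial>lborel) = ennreal (indicator {a..b} x * pX x)" for x
  proof (cases "x \<in> {a..b}")
    case True
    let ?H = "mixing K lam (\<lambda>k. m k x) G"
    have H: "real_distribution ?H" by (rule real_distribution_mixing[OF G lam sl])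
    have "?J (x, y) = pX x * gauss_conv \<sigma> ?H y" for y
      unfolding joint_eq_mix_density mix_density_def using gauss_conv_mixing[OF G lam sl s] by simp
    then have "(\<integral>\<^sup>+y. ennreal (indicator ?S (x, y) * ?J (x, y)) \<partial>lborel) = (\<integral>\<^sup>+y. ennreal (pX x * gauss_conv \<sigma> ?H y) \<partial>lborel)"
      using True by simp
    also have "\<dots> = ennreal (LINT y|lborel. pX x * gauss_conv \<sigma> ?H y)"
      using has_bochner_integral_gauss_conv[OF H s] gauss_conv_nonneg[OF H s] pX0[OF True]
      by (intro nn_integral_eq_integral) (auto simp: has_bochner_integral_iff)
    also have "\<dots> = ennreal (indicator {a..b} x * pX x)"
      using has_bochner_integral_gauss_conv[OF H s] True by (simp add: has_bochner_integral_iff)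
    finally show ?thesis .
  qed simp
  have "emeasure (joint_measure a b K (pX, gauss_conv \<sigma> G, lam, m)) UNIV
      = (\<integral>\<^sup>+z. ennreal (indicator ?S z * ?J z) \<partial>lborel)"
    unfolding joint_measure_def using m by (subst emeasure_density) auto
  also have "\<dots> = (\<integral>\<^sup>+z. ennreal (indicator ?S z * ?J z) \<partial>(lborel \<Otimes>\<^sub>M lborel))"
    by (simp add: lborel_prod)
  also have "\<dots> = (\<integral>\<^sup>+x. \<integral>\<^sup>+y. ennreal (indicator ?S (x, y) * ?J (x, y)) \<partial>lborel \<partial>lborel)"
    using m by (intro lborel.nn_integral_fst[symmetric]) (simp add: lborel_prod)
  also have "\<dots> = (\<integral>\<^sup>+x. ennreal (indicator {a..b} x * pX x) \<partial>lborel)"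
    unfolding inner ..
  also have "\<dots> = ennreal (LINT x:{a..b}|lborel. pX x)"
    unfolding set_lebesgue_integral_def real_scaleR_def
  proof (rule nn_integral_eq_integral)
    show "integrable lborel (\<lambda>x. indicat_real {a..b} x * pX x)"
      using pX by (simp add: density_on_def set_integrable_def)
    show "AE x in lborel. 0 \<le> indicat_real {a..b} x * pX x"
      using pX0 by (intro AE_I2) (auto simp: indicator_def)
  qed
  also have "\<dots> = 1" using pX by (simp add: density_on_def)
  finally show "emeasure (joint_measure a b K (pX, gauss_conv \<sigma> G, lam, m))
      (space (joint_measure a b K (pX, gauss_conv \<sigma> G, lam, m))) = 1"
    by (simp add: joint_measure_def)
qed

text \<open>Beyond unpacking the class, this provides one level j that contains the true candidate
  for all x in [a, b] at once.\<close>

lemma holder_model_classE: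
  fixes \<sigma> :: real
  assumes \<theta>: "(pX, f, lam, m) \<in> holder_model_class a b K \<sigma> x0"
    and mono: "strict_mono_on {1..K} lam"
    and ab: "a < b" and K: "1 \<le> K" and s: "0 < \<sigma>" and x0: "x0 \<in> {a..b}"
  obtains G s D j \<beta> where "real_distribution G" "f = gauss_conv \<sigma> G" "AE t in G. s \<le> t \<and> t \<le> s + D" "0 \<le> D"
    "(LINT t|G. t) = 0"
    "\<And>i k. i \<in> {1..K} \<Longrightarrow> k \<in> {1..K} \<Longrightarrow> i \<noteq> k \<Longrightarrow> 2 * D < \<bar>m i x0 - m k x0\<bar>"
    "\<And>k. k \<in> {1..K} \<Longrightarrow> 0 < lam k" "(\<Sum>k=1..K. lam k) = 1"
    "\<And>x. x \<in> {a..b} \<Longrightarrow> 0 < pX x"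
    "0 < \<beta>" "holder_continuous_on \<beta> ({a..b} \<times> UNIV) (joint K (pX, f, lam, m))"
    "\<And>x. x \<in> {a..b} \<Longrightarrow> (G, lam, pX x0, \<lambda>k. m k x0, pX x, \<lambda>k. m k x) \<in> cand_level K j"
    "prob_space (joint_measure a b K (pX, f, lam, m))"
    "\<And>k. k \<in> {1..K} \<Longrightarrow> continuous_on {a..b} (m k)"
    "countable {x\<in>{a..b}. \<exists>j\<in>{1..K}. \<exists>k\<in>{1..K}. j \<noteq> k \<and> m j x = m k x}"
proof -
  obtain \<beta> where \<beta>: "0 < \<beta>" "holder_continuous_on \<beta> ({a..b} \<times> UNIV) (joint K (pX, f, lam, m))"
    and \<theta>': "(pX, f, lam, m) \<in> model_class a b K \<sigma> x0"
    using \<theta> unfolding holder_model_class_def by blast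
  note mc = \<theta>'[unfolded model_class_def mem_Collect_eq case_prod_conv]
  have pX: "density_on {a..b} pX" and infpX: "0 < (INF x\<in>{a..b}. pX x)"
    and mean_f: "has_bochner_integral lborel (\<lambda>y. y * f y) 0"
    and lam: "\<And>k. k \<in> {1..K} \<Longrightarrow> 0 < lam k" and sl: "(\<Sum>k=1..K. lam k) = 1"
    and mc_cont: "\<And>k. k \<in> {1..K} \<Longrightarrow> continuous_on {a..b} (m k)"
    and cnt: "countable {x\<in>{a..b}. \<exists>j\<in>{1..K}. \<exists>k\<in>{1..K}. j \<noteq> k \<and> m j x = m k x}"
    using mc by blast+
  obtain G where G0: "compactly_supported_prob G" and f: "f = gauss_conv \<sigma> G"
    and sep: "\<And>i k. i \<in> {1..K} \<Longrightarrow> k \<in> {1..K} \<Longrightarrow> i \<noteq> k \<Longrightarrow> 2 * diameter (measure_supp G) < \<bar>m i x0 - m k x0\<bar>"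
    using mc by blast
  define D where "D = diameter (measure_supp G)"
  obtain s where G: "real_distribution G" and D0: "0 \<le> D" and sup: "AE t in G. s \<le> t \<and> t \<le> s + D"
    using compactly_supported_prob_interval[OF G0] unfolding D_def by blast
  have aeG: "AE t in G. \<bar>t\<bar> \<le> \<bar>s\<bar> + D" using sup by eventually_elim (use D0 in linarith)
  have meanG: "(LINT t|G. t) = 0"
    using mean_gauss_conv[OF G \<open>0 < \<sigma>\<close> aeG] mean_f by (simp add: f has_bochner_integral_iff)
  have pX0: "0 \<le> pX x" if "x \<in> {a..b}" for x using pX that by (auto simp: density_on_def)
  have pXpos: "0 < pX x" if "x \<in> {a..b}" for x
  proof -
    have "(INF x\<in>{a..b}. pX x) \<le> pX x"
      by (rule cINF_lower[OF _ that]) (use pX0 in \<open>auto intro!: bdd_belowI2[where m = 0]\<close>)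
    then show ?thesis using infpX by linarith
  qed
  have cont: "continuous_on ({a..b} \<times> UNIV) (joint K (pX, f, lam, m))"
    by (rule holder_continuous_on_imp_continuous_on[OF \<beta>(2,1)])
  have "\<exists>B. \<forall>k\<in>{1..K}. \<forall>x\<in>{a..b}. \<bar>m k x\<bar> \<le> B"
  proof -
    have "\<exists>B. \<forall>x\<in>{a..b}. \<bar>m k x\<bar> \<le> B" if "k \<in> {1..K}" for k
      using compact_imp_bounded[OF compact_continuous_image[OF mc_cont[OF that] compact_Icc]]
      unfolding bounded_iff by auto
    then obtain B where B: "\<And>k x. k \<in> {1..K} \<Longrightarrow> x \<in> {a..b} \<Longrightarrow> \<bar>m k x\<bar> \<le> B k" by metis
    have "\<bar>m k x\<bar> \<le> Max (B ` {1..K})" if "k \<in> {1..K}" "x \<in> {a..b}" for k x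
      using B[OF that] that by (intro order_trans[OF B[OF that] Max_ge]) auto
    then show ?thesis by blast
  qed
  then obtain B where B: "\<And>k x. k \<in> {1..K} \<Longrightarrow> x \<in> {a..b} \<Longrightarrow> \<bar>m k x\<bar> \<le> B" by blast
  \<comment> \<open>An upper bound for \<open>pX\<close> has to be derived. At y = 0 the joint
    density is continuous on [a, b], hence bounded, and it is at least \<open>pX x\<close> times a
    positive constant because the locations are bounded.\<close>
  have "\<exists>L. \<forall>x\<in>{a..b}. pX x \<le> L"
  proof -
    let ?c = "normal_density 0 \<sigma> (\<bar>s\<bar> + D + B)"
    have c: "0 < ?c" by (rule normal_density_pos[OF \<open>0 < \<sigma>\<close>])
    have "continuous_on {a..b} (\<lambda>x. joint K (pX, f, lam, m) (x, 0))"
      by (rule continuous_on_compose2[OF cont]) (auto intro!: continuous_intros)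
    from compact_imp_bounded[OF compact_continuous_image[OF this compact_Icc]]
    obtain J where "\<forall>z\<in>(\<lambda>x. joint K (pX, f, lam, m) (x, 0)) ` {a..b}. norm z \<le> J"
      unfolding bounded_iff by blast
    then have J: "\<bar>joint K (pX, f, lam, m) (x, 0)\<bar> \<le> J" if "x \<in> {a..b}" for x
      using that by simp
    have "pX x \<le> J / ?c" if x: "x \<in> {a..b}" for x
    proof -
      have "?c = (\<Sum>k=1..K. lam k * ?c)" using sl by (simp flip: sum_distrib_right)
      also have "\<dots> \<le> (\<Sum>k=1..K. lam k * f (0 - m k x))"
      proof (intro sum_mono mult_left_mono)
        fix k assume k: "k \<in> {1..K}"
        show "?c \<le> f (0 - m k x)"
          unfolding f by (rule gauss_conv_lower_bound[OF G \<open>0 < \<sigma>\<close> aeG]) (use B[OF k x] in simp)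
        show "0 \<le> lam k" using lam[OF k] by simp
      qed
      finally have "pX x * ?c \<le> joint K (pX, f, lam, m) (x, 0)"
        unfolding joint_def using pX0[OF x] by (simp add: mult_left_mono)
      then show ?thesis using J[OF x] c by (simp add: field_simps)
    qed
    then show ?thesis by blast
  qed
  then obtain L where L: "\<And>x. x \<in> {a..b} \<Longrightarrow> pX x \<le> L" by blast
  \<comment> \<open>One number above all constants of the level; the reciprocals of the weights
    account for their lower bound.\<close>
  define W where "W = \<bar>s\<bar> + D + \<bar>B\<bar> + \<bar>L\<bar> + (\<Sum>k=1..K. 1 / lam k)"
  define j where "j = nat \<lceil>W\<rceil>"
  have lamW: "1 / lam k \<le> (\<Sum>k=1..K. 1 / lam k)" if "k \<in> {1..K}" for k
    using member_le_sum[of k "{1..K}" "\<lambda>k. 1 / lam k"] that lam by (auto intro: less_imp_le)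
  have W0: "0 \<le> (\<Sum>k=1..K. 1 / lam k)" using lam by (intro sum_nonneg) (auto intro: less_imp_le)
  have jW: "W \<le> real j" unfolding j_def by linarith
  have level: "(G, lam, pX x0, \<lambda>k. m k x0, pX x, \<lambda>k. m k x) \<in> cand_level K j" if x: "x \<in> {a..b}" for x
    unfolding cand_level_def mem_Collect_eq case_prod_conv
  proof (intro conjI ballI)
    show "AE t in G. \<bar>t\<bar> \<le> real j" using aeG by eventually_elim (use jW W0 in \<open>unfold W_def, linarith\<close>)
    show "1 \<le> real j * lam k" if k: "k \<in> {1..K}" for k
    proof -
      have "1 / lam k \<le> real j" using lamW[OF k] jW D0 unfolding W_def by linarith
      then show ?thesis using lam[OF k] by (simp add: field_simps)
    qed
    show "mono_on {1..K} lam" using mono by (rule strict_mono_on_imp_mono_on)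
    show "\<bar>pX x0\<bar> \<le> real j" using pX0[OF x0] L[OF x0] jW W0 D0 unfolding W_def by linarith
    show "\<bar>pX x\<bar> \<le> real j" using pX0[OF x] L[OF x] jW W0 D0 unfolding W_def by linarith
    show "\<bar>m k x0\<bar> \<le> real j" if "k \<in> {1..K}" for k using B[OF that x0] jW W0 D0 unfolding W_def by linarith
    show "\<bar>m k x\<bar> \<le> real j" if "k \<in> {1..K}" for k using B[OF that x] jW W0 D0 unfolding W_def by linarith
    show "\<exists>s D. \<bar>s\<bar> \<le> real j \<and> 0 \<le> D \<and> D \<le> real j \<and> (AE t in G. s \<le> t \<and> t \<le> s + D) \<and>
        (\<forall>i\<in>{1..K}. \<forall>k\<in>{1..K}. i \<noteq> k \<longrightarrow> 2 * D \<le> \<bar>m i x0 - m k x0\<bar>)"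
    proof (rule exI[of _ s], rule exI[of _ D], intro conjI ballI impI)
      show "\<bar>s\<bar> \<le> real j" "D \<le> real j" using jW W0 D0 unfolding W_def by linarith+
      show "2 * D \<le> \<bar>m i x0 - m k x0\<bar>" if "i \<in> {1..K}" "k \<in> {1..K}" "i \<noteq> k" for i k
        using sep[OF that] by (simp add: D_def)
    qed (use D0 sup in auto)
  qed (use G meanG sl in auto)
  have prob: "prob_space (joint_measure a b K (pX, f, lam, m))"
    using prob_space_joint_measure[OF G \<open>0 < \<sigma>\<close> pX less_imp_le[OF lam] sl cont[unfolded f]] unfolding f .
  show thesis
    by (rule that[OF G f sup D0 meanG _ lam sl pXpos \<beta> level prob mc_cont cnt]) (use sep in \<open>auto simp: D_def\<close>)
qed

section \<open>The estimators\<close>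

definition cand_weights :: "cand \<Rightarrow> nat \<Rightarrow> real" where
  "cand_weights \<theta> = fst (snd \<theta>)"

definition cand_means :: "cand \<Rightarrow> nat \<Rightarrow> real" where
  "cand_means \<theta> = snd (snd (snd (snd (snd \<theta>))))"

text \<open>The guard makes the density measurable for junk candidates as well.\<close>

definition cand_density :: "real \<Rightarrow> cand \<Rightarrow> real \<Rightarrow> real" where
  "cand_density \<sigma> \<theta> y = (if real_distribution (fst \<theta>) then gauss_conv \<sigma> (fst \<theta>) y else 0)"

text \<open>The empirical counterpart of \<open>cand_obs\<close>: even indices look at x0, odd ones
  at x.\<close>

definition data_obs :: "real \<Rightarrow> real \<Rightarrow> real \<Rightarrow> nat \<Rightarrow> (nat \<Rightarrow> real \<times> real) \<Rightarrow> real \<Rightarrow> nat \<Rightarrow> real" where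
  "data_obs a b x0 n D x r = histogram a b n D (bin_index a b (nbins n) (if even r then x0 else x)) (rat_point (r div 2))"

section \<open>Measurability of the data and L1 convergence on the interval\<close>

lemma measurable_histogram [measurable]:
  "(\<lambda>D. histogram a b n D j q) \<in> borel_measurable (sample_space n)"
proof -
  have "(\<lambda>D. indicat_real (cell a b (nbins n) j q) (D i)) \<in> borel_measurable (sample_space n)" if "i \<in> {..<n}" for i
    by (rule measurable_compose[OF measurable_component_singleton[OF that] borel_measurable_indicator[OF sets_cell]])
  then show ?thesis unfolding histogram_def by (intro borel_measurable_divide borel_measurable_sum) auto
qed

lemma measurable_bin_index [measurable]: "bin_index a b N \<in> measurable borel (count_space UNIV)"
  unfolding bin_index_def[abs_def] by measurable

lemma measurable_data_obs:
  "(\<lambda>(D, x). data_obs a b x0 n D x r) \<in> borel_measurable (sample_space n \<Otimes>\<^sub>M borel)"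
proof -
  have h: "(\<lambda>z. histogram a b n (fst z) j q) \<in> borel_measurable (sample_space n \<Otimes>\<^sub>M borel)" for j q
    by (rule measurable_compose[OF measurable_fst measurable_histogram])
  have b: "(\<lambda>z. bin_index a b (nbins n) (if even r then x0 else snd z)) \<in> measurable (sample_space n \<Otimes>\<^sub>M borel) (count_space UNIV)"
    by (rule measurable_compose[OF _ measurable_bin_index]) auto
  show ?thesis
    using measurable_compose_countable[OF h b] by (simp add: data_obs_def case_prod_unfold)
qed

lemma data_obs_restrict: "data_obs a b x0 n (restrict \<omega> {..<n}) x r = data_obs a b x0 n \<omega> x r"
  by (simp add: data_obs_def histogram_def)

lemma L1_dist_on_tendsto_0:
  fixes g :: "nat \<Rightarrow> real \<Rightarrow> real"
  assumes g: "\<And>n. g n \<in> borel_measurable borel" and h: "continuous_on {a..b} h"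
    and lim: "AE x in lborel. x \<in> {a..b} \<longrightarrow> (\<lambda>n. g n x) \<longlonglongrightarrow> h x"
    and bd: "\<And>n x. x \<in> {a..b} \<Longrightarrow> \<bar>g n x\<bar> \<le> B" and bh: "\<And>x. x \<in> {a..b} \<Longrightarrow> \<bar>h x\<bar> \<le> B"
  shows "(\<lambda>n. L1_dist_on {a..b} (g n) h) \<longlonglongrightarrow> 0"
proof -
  let ?i = "indicat_real {a..b}"
  \<comment> \<open>Outside the interval \<open>h\<close> is arbitrary, so it is cut off before
    measurability is claimed.\<close>
  have hm [measurable]: "(\<lambda>x. ?i x * h x) \<in> borel_measurable borel"
    using borel_measurable_continuous_on_indicator[OF _ h] by simp
  have [measurable]: "g n \<in> borel_measurable borel" for n by (rule g)
  have eq: "L1_dist_on {a..b} (g n) h = (\<integral>\<^sup>+x. ennreal \<bar>?i x * g n x - ?i x * h x\<bar> \<partial>lborel)" for n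
    unfolding L1_dist_on_def by (intro nn_integral_cong) (auto simp: indicator_def)
  have "(\<lambda>n. \<integral>\<^sup>+x. ennreal \<bar>?i x * g n x - ?i x * h x\<bar> \<partial>lborel) \<longlonglongrightarrow> (\<integral>\<^sup>+(x::real). 0 \<partial>lborel)"
  proof (rule nn_integral_dominated_convergence)
    show "(\<integral>\<^sup>+x. ennreal (2 * \<bar>B\<bar> * ?i x) \<partial>lborel) < \<infinity>"
      by (subst ennreal_mult) (auto simp: nn_integral_cmult ennreal_indicator ennreal_mult_less_top emeasure_lborel_Icc_eq)
    show "AE x in lborel. ennreal \<bar>?i x * g n x - ?i x * h x\<bar> \<le> ennreal (2 * \<bar>B\<bar> * ?i x)" for n
    proof (intro AE_I2 ennreal_leI)
      fix x
      show "\<bar>?i x * g n x - ?i x * h x\<bar> \<le> 2 * \<bar>B\<bar> * ?i x"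
        using bd[of x n] bh[of x] by (cases "x \<in> {a..b}") auto
    qed
    show "AE x in lborel. (\<lambda>n. ennreal \<bar>?i x * g n x - ?i x * h x\<bar>) \<longlonglongrightarrow> 0"
      using lim
    proof eventually_elim
      case (elim x)
      have "(\<lambda>n. \<bar>?i x * g n x - ?i x * h x\<bar>) \<longlonglongrightarrow> 0"
      proof (cases "x \<in> {a..b}")
        case True
        then have "(\<lambda>n. g n x - h x) \<longlonglongrightarrow> 0" using elim by (intro LIM_zero) auto
        from tendsto_rabs_zero[OF this] True show ?thesis by simp
      qed simp
      from tendsto_ennrealI[OF this] show ?case by simp
    qed
  qed auto
  then show ?thesis unfolding eq by simp
qed

theorem proposition3p6:
  fixes a b \<sigma> x0 :: real and K :: nat
  assumes "a < b" and "1 \<le> K" and "0 < \<sigma>" and "x0 \<in> {a..b}"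
  shows "\<exists>(fhat :: nat \<Rightarrow> (nat \<Rightarrow> real \<times> real) \<Rightarrow> real \<Rightarrow> real)
          (lamhat :: nat \<Rightarrow> (nat \<Rightarrow> real \<times> real) \<Rightarrow> nat \<Rightarrow> real)
          (mhat :: nat \<Rightarrow> (nat \<Rightarrow> real \<times> real) \<Rightarrow> nat \<Rightarrow> real \<Rightarrow> real).
      (\<forall>n. (\<lambda>(D, y). fhat n D y) \<in> borel_measurable (sample_space n \<Otimes>\<^sub>M borel)) \<and>
      (\<forall>n. \<forall>k\<in>{1..K}. (\<lambda>D. lamhat n D k) \<in> borel_measurable (sample_space n)) \<and>
      (\<forall>n. \<forall>k\<in>{1..K}. (\<lambda>(D, x). mhat n D k x) \<in> borel_measurable (sample_space n \<Otimes>\<^sub>M borel)) \<and>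
      (\<forall>pX f lam m.
         (pX, f, lam, m) \<in> holder_model_class a b K \<sigma> x0 \<longrightarrow> strict_mono_on {1..K} lam \<longrightarrow>
         (AE \<omega> in (\<Pi>\<^sub>M i\<in>(UNIV :: nat set). joint_measure a b K (pX, f, lam, m)).
            (\<lambda>n. let D = restrict \<omega> {..<n} in
               max (L1_dist_on UNIV (fhat n D) f)
                 (max (ennreal (MAX k\<in>{1..K}. \<bar>lamhat n D k - lam k\<bar>))
                      (MAX k\<in>{1..K}. L1_dist_on {a..b} (mhat n D k) (m k))))
            \<longlonglongrightarrow> 0))"
proof -
  note ab = assms(1) and K = assms(2) and s = assms(3) and x0 = assms(4)
  obtain c :: "nat \<times> nat \<Rightarrow> cand" and sel where
    meas: "\<And>n e w (M :: ((nat \<Rightarrow> real \<times> real) \<times> real) measure).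
      (\<And>r. (\<lambda>\<omega>. w \<omega> r) \<in> borel_measurable M) \<Longrightarrow> (\<lambda>\<omega>. sel n e (w \<omega>)) \<in> measurable M (count_space UNIV)"
    and sel_level: "\<And>n e w \<theta> j. 0 < e \<Longrightarrow> \<theta> \<in> cand_level K j \<Longrightarrow> (\<And>r. r < n \<Longrightarrow> \<bar>w r - cand_obs K \<sigma> \<theta> r\<bar> \<le> e) \<Longrightarrow>
      \<exists>j'\<le>j. c (sel n e w) \<in> cand_level K j'"
    and sel_obs: "\<And>n e w \<theta> j r. 0 < e \<Longrightarrow> \<theta> \<in> cand_level K j \<Longrightarrow> (\<And>r. r < n \<Longrightarrow> \<bar>w r - cand_obs K \<sigma> \<theta> r\<bar> \<le> e) \<Longrightarrow>
      r < n \<Longrightarrow> \<bar>w r - cand_obs K \<sigma> (c (sel n e w)) r\<bar> \<le> 2 * e"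
  proof (rule minimal_level_selection[where 'a = "(nat \<Rightarrow> real \<times> real) \<times> real", of "cand_level K" "cand_obs K \<sigma>"], goal_cases)
    case (1 c sel)
    show ?case by (rule 1(1)) (fact 1(2-4))+
  qed
  define S where "S n D x = sel n (tol n) (data_obs a b x0 n D x)" for n D x
  have S_meas: "(\<lambda>(D, x). S n D x) \<in> measurable (sample_space n \<Otimes>\<^sub>M borel) (count_space UNIV)" for n
    using meas[of "\<lambda>(D, x). data_obs a b x0 n D x" "sample_space n \<Otimes>\<^sub>M borel" n "tol n"] measurable_data_obs[of a b x0 n]
    unfolding S_def case_prod_unfold by blast
  have S_meas0: "(\<lambda>D. S n D x0) \<in> measurable (sample_space n) (count_space UNIV)" for n
  proof -
    have "(\<lambda>D. (D, x0)) \<in> measurable (sample_space n) (sample_space n \<Otimes>\<^sub>M borel)"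
      by (intro measurable_Pair) auto
    from measurable_compose[OF this S_meas] show ?thesis by simp
  qed
  \<comment> \<open>The density and the weights come from the fit whose second point is x0 itself;
    the locations come from a separate fit at every x.\<close>
  define fhat where "fhat n D = cand_density \<sigma> (c (S n D x0))" for n D
  define lamhat where "lamhat n D = cand_weights (c (S n D x0))" for n D
  define mhat where "mhat n D k x = cand_means (c (S n D x)) k" for n D k x
  have fhat_meas: "(\<lambda>(D, y). fhat n D y) \<in> borel_measurable (sample_space n \<Otimes>\<^sub>M borel)" for n
  proof -
    have "cand_density \<sigma> (c i) \<in> borel_measurable borel" for i
      using borel_measurable_gauss_conv[of "fst (c i)" \<sigma>] s
      by (cases "real_distribution (fst (c i))") (simp_all add: cand_density_def[abs_def])
    then have "(\<lambda>z. cand_density \<sigma> (c i) (snd z)) \<in> borel_measurable (sample_space n \<Otimes>\<^sub>M borel)" for i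
      by (rule measurable_compose[OF measurable_snd])
    from measurable_compose_countable[OF this measurable_compose[OF measurable_fst S_meas0]]
    show ?thesis by (simp add: fhat_def case_prod_unfold)
  qed
  have lamhat_meas: "(\<lambda>D. lamhat n D k) \<in> borel_measurable (sample_space n)" for n k
    unfolding lamhat_def by (rule measurable_compose[OF S_meas0]) simp
  have mhat_meas: "(\<lambda>(D, x). mhat n D k x) \<in> borel_measurable (sample_space n \<Otimes>\<^sub>M borel)" for n k
    using measurable_compose[OF S_meas, of "\<lambda>i. cand_means (c i) k" borel n]
    unfolding mhat_def case_prod_unfold by simp
  have cons: "AE \<omega> in (\<Pi>\<^sub>M i\<in>(UNIV :: nat set). joint_measure a b K (pX, f, lam, m)).
            (\<lambda>n. let D = restrict \<omega> {..<n} in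
               max (L1_dist_on UNIV (fhat n D) f)
                 (max (ennreal (MAX k\<in>{1..K}. \<bar>lamhat n D k - lam k\<bar>))
                      (MAX k\<in>{1..K}. L1_dist_on {a..b} (mhat n D k) (m k)))) \<longlonglongrightarrow> 0"
    if \<theta>: "(pX, f, lam, m) \<in> holder_model_class a b K \<sigma> x0" and mono: "strict_mono_on {1..K} lam" for pX f lam m
  proof -
    obtain G s' D' j \<beta> where G: "real_distribution G" and f: "f = gauss_conv \<sigma> G"
      and sup: "AE t in G. s' \<le> t \<and> t \<le> s' + D'" and D': "0 \<le> D'" and mean: "(LINT t|G. t) = 0"
      and sep: "\<And>i k. i \<in> {1..K} \<Longrightarrow> k \<in> {1..K} \<Longrightarrow> i \<noteq> k \<Longrightarrow> 2 * D' < \<bar>m i x0 - m k x0\<bar>"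
      and lam: "\<And>k. k \<in> {1..K} \<Longrightarrow> 0 < lam k" and sl: "(\<Sum>k=1..K. lam k) = 1"
      and pX: "\<And>x. x \<in> {a..b} \<Longrightarrow> 0 < pX x"
      and \<beta>: "0 < \<beta>" "holder_continuous_on \<beta> ({a..b} \<times> UNIV) (joint K (pX, f, lam, m))"
      and level: "\<And>x. x \<in> {a..b} \<Longrightarrow> (G, lam, pX x0, \<lambda>k. m k x0, pX x, \<lambda>k. m k x) \<in> cand_level K j"
      and prob: "prob_space (joint_measure a b K (pX, f, lam, m))"
      and m_cont: "\<And>k. k \<in> {1..K} \<Longrightarrow> continuous_on {a..b} (m k)"
      and cnt: "countable {x\<in>{a..b}. \<exists>j\<in>{1..K}. \<exists>k\<in>{1..K}. j \<noteq> k \<and> m j x = m k x}"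
    proof (rule holder_model_classE[OF \<theta> mono ab K s x0], goal_cases)
      case (1 G s' D' j \<beta>)
      show ?case by (rule 1(1)[of G s' D' \<beta> j]) (fact 1)+
    qed
    let ?J = "joint K (pX, f, lam, m)"
    have J0: "0 \<le> ?J z" if zS: "z \<in> {a..b} \<times> UNIV" for z
    proof -
      obtain x y where z: "z = (x, y)" "x \<in> {a..b}" using zS by (cases z) auto
      have "0 \<le> (\<Sum>k=1..K. lam k * f (y - m k x))"
        unfolding f using lam gauss_conv_nonneg[OF G s] by (intro sum_nonneg mult_nonneg_nonneg) (auto intro: less_imp_le)
      then show ?thesis using pX[OF z(2)] by (simp add: z joint_def)
    qed
    \<comment> \<open>A single almost sure event for all x; from here on the argument is
      deterministic.\<close>
    have "AE \<omega> in (\<Pi>\<^sub>M i\<in>(UNIV :: nat set). joint_measure a b K (pX, f, lam, m)). \<forall>\<^sub>F n in sequentially.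
        \<forall>x\<in>{a..b}. \<forall>r<n. \<bar>histogram a b n \<omega> (bin_index a b (nbins n) x) (rat_point r) - ?J (x, rat_point r)\<bar> \<le> tol n"
      by (rule histogram_consistent[OF ab J0 \<beta>(2,1) _ prob]) (simp_all add: joint_measure_def)
    then show ?thesis
    proof eventually_elim
      case (elim \<omega>)
      then obtain n0 where n0: "\<And>n x r. n0 \<le> n \<Longrightarrow> x \<in> {a..b} \<Longrightarrow> r < n \<Longrightarrow>
          \<bar>histogram a b n \<omega> (bin_index a b (nbins n) x) (rat_point r) - ?J (x, rat_point r)\<bar> \<le> tol n"
        unfolding eventually_sequentially by blast
      define truth where "truth x = (G, lam, pX x0, \<lambda>k. m k x0, pX x, \<lambda>k. m k x)" for x
      define D where "D n = restrict \<omega> {..<n}" for n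
      define \<theta>h where "\<theta>h n x = c (S n (D n) x)" for n x
      have data: "\<bar>data_obs a b x0 n (D n) x r - cand_obs K \<sigma> (truth x) r\<bar> \<le> tol n"
        if "n0 \<le> n" "x \<in> {a..b}" "r < n" for n x r
      proof -
        have "r div 2 < n" using that(3) by linarith
        then show ?thesis
          using n0[OF that(1) x0] n0[OF that(1,2)]
          unfolding D_def data_obs_restrict by (simp add: data_obs_def truth_def cand_obs_def f joint_eq_mix_density)
      qed
      have lev: "\<theta>h n x \<in> cand_level K j" if "n0 \<le> n" "x \<in> {a..b}" for n x
      proof -
        have "\<exists>j'\<le>j. \<theta>h n x \<in> cand_level K j'"
          unfolding \<theta>h_def S_def
          by (rule sel_level[OF tol_pos level[OF that(2), folded truth_def] data[OF that]])
        then show ?thesis using cand_level_mono by blast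
      qed
      have obs: "\<bar>cand_obs K \<sigma> (\<theta>h n x) r - cand_obs K \<sigma> (truth x) r\<bar> \<le> 3 * tol n"
        if "n0 \<le> n" "x \<in> {a..b}" "r < n" for n x r
      proof -
        have "\<bar>data_obs a b x0 n (D n) x r - cand_obs K \<sigma> (\<theta>h n x) r\<bar> \<le> 2 * tol n"
          unfolding \<theta>h_def S_def
          by (rule sel_obs[OF tol_pos level[OF that(2), folded truth_def] data[OF that(1,2)] that(3)])
        then show ?thesis using data[OF that] by linarith
      qed
      \<comment> \<open>Membership in level j is known from \<open>n0\<close> on only, so the
        sequences are shifted to have all their terms there.\<close>
      have obs_lim: "(\<lambda>n. cand_obs K \<sigma> (\<theta>h (n + n0) x) r) \<longlonglongrightarrow> cand_obs K \<sigma> (truth x) r" if x: "x \<in> {a..b}" for x r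
      proof (rule LIM_zero_cancel, rule Lim_null_comparison)
        show "\<forall>\<^sub>F n in sequentially. norm (cand_obs K \<sigma> (\<theta>h (n + n0) x) r - cand_obs K \<sigma> (truth x) r) \<le> 3 * tol (n + n0)"
          using eventually_gt_at_top[of r] by eventually_elim (use obs x in auto)
        have "(\<lambda>n. 3 * tol (n + n0)) \<longlonglongrightarrow> 3 * 0"
          by (intro tendsto_mult tendsto_const LIMSEQ_ignore_initial_segment tol_tendsto)
        then show "(\<lambda>n. 3 * tol (n + n0)) \<longlonglongrightarrow> 0" by simp
      qed
      let ?G = "\<lambda>n x. fst (\<theta>h (n + n0) x)" and ?l = "\<lambda>n x. cand_weights (\<theta>h (n + n0) x)"
        and ?c0 = "\<lambda>n x. fst (snd (snd (\<theta>h (n + n0) x)))" and ?u0 = "\<lambda>n x. fst (snd (snd (snd (\<theta>h (n + n0) x))))"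
        and ?c1 = "\<lambda>n x. fst (snd (snd (snd (snd (\<theta>h (n + n0) x)))))" and ?u1 = "\<lambda>n x. cand_means (\<theta>h (n + n0) x)"
      have tup: "(?G n x, ?l n x, ?c0 n x, ?u0 n x, ?c1 n x, ?u1 n x) = \<theta>h (n + n0) x" for n x
        by (simp add: cand_weights_def cand_means_def)
      have lev': "(?G n x, ?l n x, ?c0 n x, ?u0 n x, ?c1 n x, ?u1 n x) \<in> cand_level K j" if "x \<in> {a..b}" for n x
        unfolding tup using that by (intro lev) auto
      have obs': "(\<lambda>n. cand_obs K \<sigma> (?G n x, ?l n x, ?c0 n x, ?u0 n x, ?c1 n x, ?u1 n x) r)
          \<longlonglongrightarrow> cand_obs K \<sigma> (G, lam, pX x0, \<lambda>k. m k x0, pX x, \<lambda>k. m k x) r" if "x \<in> {a..b}" for x r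
        unfolding tup using obs_lim[OF that, of r] by (simp add: truth_def)
      have con_f: "(\<lambda>n. L1_dist_on UNIV (gauss_conv \<sigma> (?G n x0)) (gauss_conv \<sigma> G)) \<longlonglongrightarrow> 0"
        by (rule cand_consistent(1)[OF s K lev'[OF x0] G sup D' mean lam sl mono pX[OF x0] pX[OF x0] sep obs'[OF x0]])
      have con_lam: "(\<lambda>n. ?l n x0 k) \<longlonglongrightarrow> lam k" if "k \<in> {1..K}" for k
        by (rule cand_consistent(2)[OF s K lev'[OF x0] G sup D' mean lam sl mono pX[OF x0] pX[OF x0] sep obs'[OF x0] that])
      have con_m: "(\<lambda>n. ?u1 n x k) \<longlonglongrightarrow> m k x" if "inj_on (\<lambda>k. m k x) {1..K}" "k \<in> {1..K}" and x: "x \<in> {a..b}" for x k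
        by (rule cand_consistent(3)[OF s K lev'[OF x] G sup D' mean lam sl mono pX[OF x0] pX[OF x] sep obs'[OF x] that(1,2)])
      have rd: "real_distribution (?G n x)" if "x \<in> {a..b}" for n x
        using lev'[OF that, of n] unfolding cand_level_def by blast
      have f_lim: "(\<lambda>n. L1_dist_on UNIV (fhat n (D n)) f) \<longlonglongrightarrow> 0"
      proof (rule LIMSEQ_offset[of _ n0])
        have "fhat (n + n0) (D (n + n0)) = gauss_conv \<sigma> (?G n x0)" for n
          using rd[OF x0, of n] by (simp add: fhat_def cand_density_def fun_eq_iff \<theta>h_def)
        then show "(\<lambda>n. L1_dist_on UNIV (fhat (n + n0) (D (n + n0))) f) \<longlonglongrightarrow> 0"
          using con_f by (simp add: f)
      qed
      have lam_lim: "(\<lambda>n. lamhat n (D n) k) \<longlonglongrightarrow> lam k" if k: "k \<in> {1..K}" for k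
      proof (rule LIMSEQ_offset[of _ n0])
        show "(\<lambda>n. lamhat (n + n0) (D (n + n0)) k) \<longlonglongrightarrow> lam k"
          using con_lam[OF k] by (simp add: lamhat_def \<theta>h_def)
      qed
      have m_lim: "(\<lambda>n. L1_dist_on {a..b} (mhat n (D n) k) (m k)) \<longlonglongrightarrow> 0" if k: "k \<in> {1..K}" for k
      proof (rule LIMSEQ_offset[of _ n0], rule L1_dist_on_tendsto_0[OF _ m_cont[OF k]])
        have "D n \<in> space (sample_space n)" for n by (simp add: D_def space_PiM PiE_def)
        from measurable_Pair2[OF mhat_meas this]
        show "mhat (n + n0) (D (n + n0)) k \<in> borel_measurable borel" for n by simp
        show "\<bar>mhat (n + n0) (D (n + n0)) k x\<bar> \<le> real j" if "x \<in> {a..b}" for n x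
        proof -
          have "\<bar>?u1 n x k\<bar> \<le> real j"
            using lev'[OF that, of n] k unfolding cand_level_def by blast
          then show ?thesis by (simp add: mhat_def \<theta>h_def)
        qed
        show "\<bar>m k x\<bar> \<le> real j" if "x \<in> {a..b}" for x
          using level[OF that] k unfolding cand_level_def by blast
        \<comment> \<open>The crossings of the locations are countable, hence Lebesgue null;
          elsewhere the locations at x are identified.\<close>
        have "AE x in lborel. x \<notin> {x\<in>{a..b}. \<exists>j\<in>{1..K}. \<exists>k\<in>{1..K}. j \<noteq> k \<and> m j x = m k x}"
          by (rule AE_not_in[OF countable_imp_null_set_lborel[OF cnt]])
        then show "AE x in lborel. x \<in> {a..b} \<longrightarrow> (\<lambda>n. mhat (n + n0) (D (n + n0)) k x) \<longlonglongrightarrow> m k x"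
        proof eventually_elim
          case (elim x)
          show ?case
          proof
            assume x: "x \<in> {a..b}"
            have "inj_on (\<lambda>k. m k x) {1..K}"
              using elim x by (intro inj_onI) blast
            from con_m[OF this k x]
            show "(\<lambda>n. mhat (n + n0) (D (n + n0)) k x) \<longlonglongrightarrow> m k x"
              by (simp add: mhat_def \<theta>h_def)
          qed
        qed
      qed
      have ne: "{1..K} \<noteq> {}" using K by simp
      have lam_max: "(\<lambda>n. ennreal (MAX k\<in>{1..K}. \<bar>lamhat n (D n) k - lam k\<bar>)) \<longlonglongrightarrow> 0"
      proof (rule tendsto_sandwich[OF _ _ tendsto_const])
        have "(\<lambda>n. \<Sum>k=1..K. \<bar>lamhat n (D n) k - lam k\<bar>) \<longlonglongrightarrow> (\<Sum>k=1..K. 0)"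
          by (intro tendsto_sum tendsto_rabs_zero LIM_zero lam_lim)
        from tendsto_ennrealI[OF this]
        show "(\<lambda>n. ennreal (\<Sum>k=1..K. \<bar>lamhat n (D n) k - lam k\<bar>)) \<longlonglongrightarrow> 0" by simp
        show "\<forall>\<^sub>F n in sequentially. ennreal (MAX k\<in>{1..K}. \<bar>lamhat n (D n) k - lam k\<bar>)
            \<le> ennreal (\<Sum>k=1..K. \<bar>lamhat n (D n) k - lam k\<bar>)"
          using ne by (intro always_eventually allI ennreal_leI Max.boundedI) (auto intro!: member_le_sum)
      qed auto
      have m_max: "(\<lambda>n. MAX k\<in>{1..K}. L1_dist_on {a..b} (mhat n (D n) k) (m k)) \<longlonglongrightarrow> 0"
      proof (rule tendsto_sandwich[OF _ _ tendsto_const])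
        have "(\<lambda>n. \<Sum>k=1..K. L1_dist_on {a..b} (mhat n (D n) k) (m k)) \<longlonglongrightarrow> (\<Sum>k=1..K. 0)"
          by (intro tendsto_sum m_lim)
        then show "(\<lambda>n. \<Sum>k=1..K. L1_dist_on {a..b} (mhat n (D n) k) (m k)) \<longlonglongrightarrow> 0" by simp
        show "\<forall>\<^sub>F n in sequentially. (MAX k\<in>{1..K}. L1_dist_on {a..b} (mhat n (D n) k) (m k))
            \<le> (\<Sum>k=1..K. L1_dist_on {a..b} (mhat n (D n) k) (m k))"
          using ne by (intro always_eventually allI Max.boundedI) (auto intro!: member_le_sum)
      qed auto
      show ?case
        using tendsto_max[OF f_lim tendsto_max[OF lam_max m_max]] unfolding Let_def D_def by simp
    qed
  qed
  show ?thesis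
    by (rule exI[of _ fhat], rule exI[of _ lamhat], rule exI[of _ mhat])
       (use fhat_meas lamhat_meas mhat_meas cons in blast)
qed

end
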